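(* Let $m,p,q\ge1$ be integers and $\sigma_1,\sigma_2,\sigma_3\in\{\pm1\}$ with $(q,\sigma_3)\ne(1,1)$, and write $\tau=\sigma_1\sigma_2\sigma_3$. The quadratic Euler $\tilde S$-sums $\tilde S_{m,p,q}^{\sigma_1,\sigma_2,\sigma_3}=\sum_{n=1}^\infty\sigma_3^{n-1}\frac{h_{n}^{(m)}(\sigma_1)h_{n}^{(p)}(\sigma_2)}{n^q}$ satisfy \[ \tau\,\delta_{\sigma_1\sigma_2}^{m+p+q-1}\,\tilde S_{m,p,q}^{\sigma_1,\sigma_2,\sigma_3} =\mathcal{H}_1+\mathcal{H}_2+\mathcal{H}_3+\mathcal{H}_4+\mathcal{H}_5, \] where \begin{align*} \mathcal{H}_1&=-\tau(-1)^m\delta_{\sigma_2}^{p+q}\,\tilde t(m;\sigma_1)\tilde S_{p,q}^{\sigma_2,\sigma_3} -\tau(-1)^p\delta_{\sigma_1}^{m+q}\,\tilde t(p;\sigma_2)\tilde S_{m,q}^{\sigma_1,\sigma_3}\\ &\quad-\sigma_1\sigma_2(-1)^{m+p}(1+(-1)^q)\,\tilde t(m;\sigma_1)\tilde t(p;\sigma_2)\zeta(q;\sigma_3),\\ \mathcal{H}_2&=\sigma_1\sigma_2(-1)^{m+p}\sum_{k=0}^{m+p-1} \binom{m+p+q-k-2}{q-1}\delta_{\tau}^k\,\tilde t(k+1;\tau)\,\tilde t(m+p+q-k-1;\sigma_3),\\ \mathcal{H}_3&=\sigma_1\sigma_3(-1)^m\sum_{j=1}^m\sum_{k=0}^{m-j}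 \binom{p+j-2}{p-1}\binom{m+q-j-k-1}{q-1}\delta_{\tau}^k\,\tilde t(k+1;\tau)\\ &\qquad\times\Big\{R_{p+j-1,m+q-j-k}^{\sigma_2,\sigma_3}-\sigma_2\sigma_3(-1)^{p+j}\zeta(p+j-1;\sigma_2)\,\tilde t(m+q-j-k;\sigma_3)\Big\}\\ &\quad+\sigma_2\sigma_3(-1)^p\sum_{j=1}^p\sum_{k=0}^{p-j} \binom{m+j-2}{m-1}\binom{p+q-j-k-1}{q-1}\delta_{\tau}^k\,\tilde t(k+1;\tau)\\ &\qquad\times\Big\{R_{m+j-1,p+q-j-k}^{\sigma_1,\sigma_3}-\sigma_1\sigma_3(-1)^{m+j}\zeta(m+j-1;\sigma_1)\,\tilde t(p+q-j-k;\sigma_3)\Big\},\\ \mathcal{H}_4&=-\sigma_1\sigma_2(-1)^{m+p}\sum_{\substack{k_1+k_2=q\\k_1,k_2\geq 0}} \binom{m+k_1-1}{m-1}\binom{p+k_2-1}{p-1}\tilde t(m+k_1;\sigma_1)\,\tilde t(p+k_2;\sigma_2),\\ \mathcal{H}_5&=2\sigma_1\sigma_2(-1)^{m+p}\sum_{j=1}^{\lfloor q/2\rfloor} \sum_{\substack{k_1+k_2=q-2j\\k_1,k_2\geq 0}} \binom{m+k_1-1}{m-1}\binom{p+k_2-1}{p-1}\zeta(2j;\tau)\,\tilde t(m+k_1;\sigma_1)\,\tilde t(p+k_2;\sigma_2), \end{align*} with $\zeta(1;1):=0$ and $\tilde t(1;1):=2\ln2$ wherever they occur.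
   Context: For $\sigma\in\{\pm1\}$, integers $n\ge0$, $r\ge1$: $h_n^{(r)}(\sigma)=\sum_{k=1}^n\frac{\sigma^{k-1}}{(k-1/2)^r}$ and $H_n^{(r)}(\sigma)=\sum_{k=1}^n\frac{\sigma^{k-1}}{k^r}$. Linear sums, for $(q,\sigma_2)\ne(1,1)$: $\tilde S_{p,q}^{\sigma_1,\sigma_2}=\sum_{n\ge1}\sigma_2^{n-1}\frac{h_{n}^{(p)}(\sigma_1)}{n^q}$ and $R_{p,q}^{\sigma_1,\sigma_2}=\sum_{n\ge1}\sigma_2^{n-1}\frac{H_{n-1}^{(p)}(\sigma_1)}{(n-1/2)^q}$. For $(s,\sigma)\ne(1,1)$: $\zeta(s;\sigma)=\sum_{n\ge1}\frac{\sigma^n}{n^s}$, $\tilde t(s;\sigma)=\sum_{n\ge1}\frac{\sigma^n}{(n-1/2)^s}$. Also $\delta_\sigma^k=1-\sigma(-1)^k$. *)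

theory Defs
  imports "HOL-Analysis.Analysis"
begin

text \<open>
  Signs \<open>\<sigma> \<in> {1, -1}\<close> are real numbers.  A series over \<open>n \<ge> 1\<close> is written as a library
  \<open>suminf\<close> over \<open>n \<ge> 0\<close> with \<open>n\<close> replaced by \<open>Suc n\<close>, so that the terms are summed in their
  natural order; for index \<open>1\<close> and sign \<open>-1\<close> the convergence may be only conditional.
\<close>

definition h_sum :: "nat \<Rightarrow> real \<Rightarrow> nat \<Rightarrow> real" where
  "h_sum r \<sigma> n = (\<Sum>k=1..n. \<sigma> ^ (k - 1) / (real k - 1/2) ^ r)"

definition H_sum :: "nat \<Rightarrow> real \<Rightarrow> nat \<Rightarrow> real" where
  "H_sum r \<sigma> n = (\<Sum>k=1..n. \<sigma> ^ (k - 1) / real k ^ r)"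

definition S_lin :: "nat \<Rightarrow> nat \<Rightarrow> real \<Rightarrow> real \<Rightarrow> real" where
  "S_lin p q \<sigma>1 \<sigma>2 = (\<Sum>n. \<sigma>2 ^ n * h_sum p \<sigma>1 (Suc n) / real (Suc n) ^ q)"

definition R_lin :: "nat \<Rightarrow> nat \<Rightarrow> real \<Rightarrow> real \<Rightarrow> real" where
  "R_lin p q \<sigma>1 \<sigma>2 = (\<Sum>n. \<sigma>2 ^ n * H_sum p \<sigma>1 n / (real (Suc n) - 1/2) ^ q)"

definition S_quad :: "nat \<Rightarrow> nat \<Rightarrow> nat \<Rightarrow> real \<Rightarrow> real \<Rightarrow> real \<Rightarrow> real" where
  "S_quad m p q \<sigma>1 \<sigma>2 \<sigma>3 =
     (\<Sum>n. \<sigma>3 ^ n * (h_sum m \<sigma>1 (Suc n) * h_sum p \<sigma>2 (Suc n)) / real (Suc n) ^ q)"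

text \<open>
  At \<open>(s, \<sigma>) = (1, 1)\<close> the following two series diverge; the values there are conventions.
  Note the exponent \<open>n\<close> of \<open>\<sigma>\<close>, in contrast to \<open>n - 1\<close> above.
\<close>

definition alt_zeta :: "nat \<Rightarrow> real \<Rightarrow> real" where
  "alt_zeta s \<sigma> = (if s = 1 \<and> \<sigma> = 1 then 0 else (\<Sum>n. \<sigma> ^ Suc n / real (Suc n) ^ s))"

definition alt_t :: "nat \<Rightarrow> real \<Rightarrow> real" where
  "alt_t s \<sigma> = (if s = 1 \<and> \<sigma> = 1 then 2 * ln 2
                else (\<Sum>n. \<sigma> ^ Suc n / (real (Suc n) - 1/2) ^ s))"

definition parity_delta :: "real \<Rightarrow> nat \<Rightarrow> real" where
  "parity_delta \<sigma> k = 1 - \<sigma> * (-1) ^ k"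

text \<open>
  The five terms on the right-hand side, with \<open>\<tau> = \<sigma>1 \<sigma>2 \<sigma>3\<close>.  For \<open>m, p, q \<ge> 1\<close> no
  subtraction of natural numbers below is truncated.
\<close>

definition term1 :: "nat \<Rightarrow> nat \<Rightarrow> nat \<Rightarrow> real \<Rightarrow> real \<Rightarrow> real \<Rightarrow> real" where
  "term1 m p q \<sigma>1 \<sigma>2 \<sigma>3 = (let \<tau> = \<sigma>1 * \<sigma>2 * \<sigma>3 in
     - \<tau> * (-1) ^ m * parity_delta \<sigma>2 (p + q) * alt_t m \<sigma>1 * S_lin p q \<sigma>2 \<sigma>3
     - \<tau> * (-1) ^ p * parity_delta \<sigma>1 (m + q) * alt_t p \<sigma>2 * S_lin m q \<sigma>1 \<sigma>3
     - \<sigma>1 * \<sigma>2 * (-1) ^ (m + p) * (1 + (-1) ^ q) * alt_t m \<sigma>1 * alt_t p \<sigma>2 * alt_zeta q \<sigma>3)"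

definition term2 :: "nat \<Rightarrow> nat \<Rightarrow> nat \<Rightarrow> real \<Rightarrow> real \<Rightarrow> real \<Rightarrow> real" where
  "term2 m p q \<sigma>1 \<sigma>2 \<sigma>3 = (let \<tau> = \<sigma>1 * \<sigma>2 * \<sigma>3 in
     \<sigma>1 * \<sigma>2 * (-1) ^ (m + p) *
       (\<Sum>k=0..m+p-1. real ((m + p + q - k - 2) choose (q - 1)) * parity_delta \<tau> k
          * alt_t (k + 1) \<tau> * alt_t (m + p + q - k - 1) \<sigma>3))"

definition term3 :: "nat \<Rightarrow> nat \<Rightarrow> nat \<Rightarrow> real \<Rightarrow> real \<Rightarrow> real \<Rightarrow> real" where
  "term3 m p q \<sigma>1 \<sigma>2 \<sigma>3 = (let \<tau> = \<sigma>1 * \<sigma>2 * \<sigma>3 in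
     \<sigma>1 * \<sigma>3 * (-1) ^ m *
       (\<Sum>j=1..m. \<Sum>k=0..m-j.
          real ((p + j - 2) choose (p - 1)) * real ((m + q - j - k - 1) choose (q - 1))
          * parity_delta \<tau> k * alt_t (k + 1) \<tau>
          * (R_lin (p + j - 1) (m + q - j - k) \<sigma>2 \<sigma>3
             - \<sigma>2 * \<sigma>3 * (-1) ^ (p + j) * alt_zeta (p + j - 1) \<sigma>2 * alt_t (m + q - j - k) \<sigma>3))
   + \<sigma>2 * \<sigma>3 * (-1) ^ p *
       (\<Sum>j=1..p. \<Sum>k=0..p-j.
          real ((m + j - 2) choose (m - 1)) * real ((p + q - j - k - 1) choose (q - 1))
          * parity_delta \<tau> k * alt_t (k + 1) \<tau>
          * (R_lin (m + j - 1) (p + q - j - k) \<sigma>1 \<sigma>3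
             - \<sigma>1 * \<sigma>3 * (-1) ^ (m + j) * alt_zeta (m + j - 1) \<sigma>1 * alt_t (p + q - j - k) \<sigma>3)))"

definition term4 :: "nat \<Rightarrow> nat \<Rightarrow> nat \<Rightarrow> real \<Rightarrow> real \<Rightarrow> real" where
  "term4 m p q \<sigma>1 \<sigma>2 =
     - \<sigma>1 * \<sigma>2 * (-1) ^ (m + p) *
       (\<Sum>(k1, k2) \<in> {(k1, k2). k1 + k2 = q}.
          real ((m + k1 - 1) choose (m - 1)) * real ((p + k2 - 1) choose (p - 1))
          * alt_t (m + k1) \<sigma>1 * alt_t (p + k2) \<sigma>2)"

definition term5 :: "nat \<Rightarrow> nat \<Rightarrow> nat \<Rightarrow> real \<Rightarrow> real \<Rightarrow> real \<Rightarrow> real" where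
  "term5 m p q \<sigma>1 \<sigma>2 \<sigma>3 = (let \<tau> = \<sigma>1 * \<sigma>2 * \<sigma>3 in
     2 * \<sigma>1 * \<sigma>2 * (-1) ^ (m + p) *
       (\<Sum>j=1..q div 2. \<Sum>(k1, k2) \<in> {(k1, k2). k1 + k2 = q - 2 * j}.
          real ((m + k1 - 1) choose (m - 1)) * real ((p + k2 - 1) choose (p - 1))
          * alt_zeta (2 * j) \<tau> * alt_t (m + k1) \<sigma>1 * alt_t (p + k2) \<sigma>2))"

end

theory Submission
  imports Defs "HOL-Complex_Analysis.Complex_Analysis" "HOL-Real_Asymp.Real_Asymp"
begin

text \<open>
  Let \<open>L_m(\<sigma>; z)\<close> be the sum of \<open>\<sigma>^b / (b + z)^m\<close> over \<open>b \<ge> 0\<close>, regularised for \<open>m = 1\<close>, and put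
  \<open>\<Phi>(s) = L_1(\<tau>; s) - \<tau> L_1(\<tau>; 1 - s)\<close>, which is \<open>\<pi> cot (\<pi> s)\<close> or \<open>\<pi> / sin (\<pi> s)\<close>.  The function
  \<open>\<Phi>(s) L_m(\<sigma>1; 1/2 - s) L_p(\<sigma>2; 1/2 - s) / s^q\<close> tends to \<open>0\<close> fast enough on large rectangles for the
  sum of all its residues to vanish.  The residues at \<open>n\<close> and \<open>- n\<close> for \<open>n \<ge> 1\<close> yield the quadratic sum and
  the first term, the pole of order \<open>q + 1\<close> at \<open>0\<close> yields the fourth and fifth, and the poles of order
  \<open>m + p\<close> at the positive half-integers yield the second and third.  All local expansions follow from the
  functional equation \<open>L_m(\<sigma>; z) = z^(-m) + \<sigma> L_m(\<sigma>; z + 1)\<close> and \<open>L_m' = - m L_(m+1)\<close>.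
\<close>

section \<open>Lerch functions with a sign\<close>

text \<open>The relation between the signs is forced: \<tau>^n \<sigma>1^n \<sigma>2^n must equal
  \<sigma>3^n, for the series over integers and for the one over half-integers alike. The quadratic
  term arises at n with sign \<sigma>1 \<sigma>2 (-1)^(m+p) and at -n with sign (-1)^q; together
  these give the parity factor on the left, times the common sign (-1)^(m+p) that is cancelled at
  the end.

  The obstacle is q = 1. Logarithmic bounds for the three factors and a single 1/s are too weak on
  the long horizontal sides. But then \<sigma>3 = -1, hence one of \<tau>, \<sigma>1, \<sigma>2 is
  -1, and a Lerch function of sign -1 decays away from the real axis. Several series also converge
  only conditionally in this case; their convergence is proved without contours, so the limit may be
  taken along a sparse sequence of rectangles and split into separate series afterwards.

  For m = 1 and sign 1 the regularised function is -\<psi>(z) - \<gamma> with the digamma function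
  \<psi>. Its values 0 at 1 and 2 ln 2 at 1/2 are the origin of the two conventions. Poles,
  quasi-periodicity and growth are all read off the series, not off trigonometric formulas.\<close>

definition lerch_term :: "real \<Rightarrow> nat \<Rightarrow> complex \<Rightarrow> nat \<Rightarrow> complex" where
  "lerch_term \<sigma> m z b =
     of_real (\<sigma> ^ b) * (1 / (of_nat b + z) ^ m - (if m = 1 then 1 / of_nat (Suc b) else 0))"

text \<open>
  The constant for \<open>m = 1\<close> makes \<open>lerch\<close> take the values \<open>\<sigma> * alt_zeta m \<sigma>\<close> at \<open>1\<close> and
  \<open>\<sigma> * alt_t m \<sigma>\<close> at \<open>1/2\<close> without exception, so the conventions at \<open>(1, 1)\<close> need no
  separate treatment.
\<close>

definition lerch :: "real \<Rightarrow> nat \<Rightarrow> complex \<Rightarrow> complex" where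
  "lerch \<sigma> m z = (\<Sum>b. lerch_term \<sigma> m z b) + (if m = 1 then of_real (\<sigma> * alt_zeta 1 \<sigma>) else 0)"

lemma norm_of_nat_add_ge:
  fixes z :: complex
  assumes "2 * norm z \<le> real b"
  shows "real b / 2 \<le> norm (of_nat b + z)"
proof -
  have "real b - norm z \<le> norm (of_nat b + z)"
    using norm_diff_ineq[of "of_nat b" z] by simp
  then show ?thesis using assms by linarith
qed

text \<open>For m = 1 the subtracted 1/(b+1) leaves (1 - z)/((b+z)(b+1)), so quadratic decay holds
  for every m and even the alternating series of exponent 1 converges absolutely. The constant 6 = 2
  + 4 covers both the bound 2 + 2|z| of that case and the bound 4 for larger m.\<close>

lemma norm_lerch_term_le:
  assumes "\<bar>\<sigma>\<bar> = 1" "m \<ge> 1" "b \<ge> 2" "real b / 2 \<le> norm (of_nat b + z)"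
  shows "norm (lerch_term \<sigma> m z b) \<le> (6 + 2 * norm z) / real b ^ 2"
proof -
  have pos: "norm (of_nat b + z) > 0" "of_nat b + z \<noteq> 0" using assms by auto
  have bz: "1 / norm (of_nat b + z) \<le> 2 / real b"
    using assms pos by (simp add: field_simps)
  have n: "norm (lerch_term \<sigma> m z b) = norm (1 / (of_nat b + z) ^ m - (if m = 1 then 1 / of_nat (Suc b) else 0))"
    using assms(1) by (simp add: lerch_term_def norm_mult norm_power)
  show ?thesis
  proof (cases "m = 1")
    case True
    have "1 / (of_nat b + z) - 1 / of_nat (Suc b) = (1 - z) * (1 / (of_nat b + z)) * (1 / of_nat (Suc b))"
      using pos of_nat_neq_0[of b, where ?'a=complex] by (simp add: field_simps)
    then have "norm (lerch_term \<sigma> m z b) = norm (1 - z) * (1 / norm (of_nat b + z)) * (1 / real (Suc b))"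
      unfolding n using True by (simp add: norm_mult norm_divide del: of_nat_Suc)
    also have "\<dots> \<le> (1 + norm z) * (2 / real b) * (1 / real b)"
      using assms bz norm_triangle_ineq4[of 1 z] by (intro mult_mono) (auto simp: field_simps)
    also have "\<dots> = (2 + 2 * norm z) / real b ^ 2" by (simp add: power2_eq_square)
    also have "\<dots> \<le> (6 + 2 * norm z) / real b ^ 2" by (intro divide_right_mono) auto
    finally show ?thesis .
  next
    case False
    have "norm (lerch_term \<sigma> m z b) = (1 / norm (of_nat b + z)) ^ m"
      unfolding n using False by (simp add: norm_divide norm_power power_one_over)
    also have "\<dots> \<le> (2 / real b) ^ m" using bz by (intro power_mono) auto
    also have "\<dots> \<le> (2 / real b) ^ 2" using assms False by (intro power_decreasing) auto
    also have "\<dots> \<le> (6 + 2 * norm z) / real b ^ 2"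
      unfolding power_divide by (intro divide_right_mono) auto
    finally show ?thesis .
  qed
qed

lemma eventually_lerch_term_le:
  assumes "\<bar>\<sigma>\<bar> = 1" "m \<ge> 1"
  shows "eventually (\<lambda>b. \<forall>z\<in>cball 0 R. norm (lerch_term \<sigma> m z b) \<le> (6 + 2 * R) / real b ^ 2) sequentially"
proof -
  have "eventually (\<lambda>b. b \<ge> max 2 (nat \<lceil>2 * R\<rceil>)) sequentially" by (rule eventually_ge_at_top)
  then show ?thesis
  proof eventually_elim
    case (elim b)
    show ?case
    proof
      fix z :: complex assume z: "z \<in> cball 0 R"
      have R: "2 * R \<le> real b" using elim by linarith
      have "norm (lerch_term \<sigma> m z b) \<le> (6 + 2 * norm z) / real b ^ 2"
        using z elim R by (intro norm_lerch_term_le assms norm_of_nat_add_ge) auto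
      also have "\<dots> \<le> (6 + 2 * R) / real b ^ 2" using z by (intro divide_right_mono) auto
      finally show "norm (lerch_term \<sigma> m z b) \<le> (6 + 2 * R) / real b ^ 2" .
    qed
  qed
qed

lemma summable_const_over_square: "summable (\<lambda>b. C / real b ^ 2)"
  using summable_mult[OF inverse_power_summable[of 2, where ?'a = real], of C] by (simp add: divide_inverse)

lemma summable_lerch_term:
  assumes "\<bar>\<sigma>\<bar> = 1" "m \<ge> 1"
  shows "summable (lerch_term \<sigma> m z)"
  by (rule summable_comparison_test_ev[OF _ summable_const_over_square])
     (use eventually_lerch_term_le[OF assms, of "norm z"] in \<open>auto elim!: eventually_mono\<close>)

text \<open>Termwise differentiation on a disc that avoids the poles; the majorant is needed only
  for large b, as early terms may be large near a pole. The constant subtracted for m = 1 drops out,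
  so one rule covers all m.\<close>

lemma has_field_derivative_lerch:
  assumes "\<bar>\<sigma>\<bar> = 1" "m \<ge> 1" "z \<notin> \<int>\<^sub>\<le>\<^sub>0"
  shows "(lerch \<sigma> m has_field_derivative - of_nat m * lerch \<sigma> (Suc m) z) (at z)"
proof -
  have "open (- \<int>\<^sub>\<le>\<^sub>0 :: complex set)" by (simp add: closed_nonpos_Ints open_Compl)
  then obtain r where r: "r > 0" "ball z r \<subseteq> - \<int>\<^sub>\<le>\<^sub>0" using assms(3) by (auto simp: open_contains_ball)
  define f' where "f' = (\<lambda>b w. - of_nat m * lerch_term \<sigma> (Suc m) w b)"
  have nz: "of_nat b + w \<noteq> 0" if "w \<in> ball z r" for b w
    using r that plus_of_nat_eq_0_imp[of w b] by (auto simp: add.commute)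
  have "uniformly_convergent_on (ball z r) (\<lambda>n w. \<Sum>i<n. f' i w)"
  proof (rule Weierstrass_m_test'_ev[OF _ summable_mult[OF summable_const_over_square]])
    have sub: "ball z r \<subseteq> cball 0 (norm z + r)"
    proof
      fix w assume "w \<in> ball z r"
      then show "w \<in> cball 0 (norm z + r)"
        using norm_triangle_ineq2[of w z] by (auto simp: dist_norm norm_minus_commute)
    qed
    show "\<forall>\<^sub>F n in sequentially. \<forall>w\<in>ball z r. norm (f' n w)
        \<le> real m * ((6 + 2 * (norm z + r)) / real n ^ 2)"
      using eventually_lerch_term_le[OF assms(1), of "Suc m" "norm z + r", simplified]
    proof eventually_elim
      case (elim n)
      show ?case
      proof
        fix w assume "w \<in> ball z r"
        then have "norm (lerch_term \<sigma> (Suc m) w n) \<le> (6 + 2 * (norm z + r)) / real n ^ 2"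
          using elim sub by auto
        then show "norm (f' n w) \<le> real m * ((6 + 2 * (norm z + r)) / real n ^ 2)"
          unfolding f'_def norm_mult by (intro mult_mono) auto
      qed
    qed
  qed
  moreover have "((\<lambda>w. lerch_term \<sigma> m w b) has_field_derivative f' b w) (at w within ball z r)"
    if "w \<in> ball z r" for b w
  proof -
    have "((\<lambda>w. of_real (\<sigma> ^ b) * (1 / (of_nat b + w) ^ m - (if m = 1 then 1 / of_nat (Suc b) else 0)))
      has_field_derivative of_real (\<sigma> ^ b) * (- (of_nat m * (of_nat b + w) ^ (m - 1)) / ((of_nat b + w) ^ m)\<^sup>2)) (at w within ball z r)"
      using nz[OF that, of b] by (auto intro!: derivative_eq_intros simp: power2_eq_square)
    moreover have "(of_nat b + w) ^ m = (of_nat b + w) ^ (m - 1) * (of_nat b + w)"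
      using assms(2) by (metis Suc_diff_le diff_Suc_1 power_Suc2 One_nat_def)
    then have "- (of_nat m * (of_nat b + w) ^ (m - 1)) / ((of_nat b + w) ^ m)\<^sup>2 = - of_nat m / (of_nat b + w) ^ Suc m"
      using nz[OF that, of b] by (simp add: power2_eq_square)
    moreover have "f' b w = of_real (\<sigma> ^ b) * (- of_nat m / (of_nat b + w) ^ Suc m)"
      using assms(2) by (simp add: f'_def lerch_term_def)
    ultimately show ?thesis by (simp only: lerch_term_def)
  qed
  ultimately have "((\<lambda>w. \<Sum>b. lerch_term \<sigma> m w b) has_field_derivative (\<Sum>b. f' b z)) (at z)"
    using r summable_lerch_term[OF assms(1,2), of z]
    by (intro has_field_derivative_series'(2)[where S = "ball z r" and ?x0.0 = z]) auto
  moreover have "(\<Sum>b. f' b z) = - of_nat m * lerch \<sigma> (Suc m) z"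
    using summable_lerch_term[OF assms(1), of "Suc m" z] assms(2)
    by (simp add: f'_def lerch_def suminf_minus suminf_mult)
  ultimately show ?thesis unfolding lerch_def[abs_def]
    using assms(2) by (auto intro!: derivative_eq_intros)
qed

section \<open>Special values at 1 and 1/2, and the functional equation\<close>

lemma sign_square: "\<bar>\<sigma>::real\<bar> = 1 \<Longrightarrow> \<sigma> * \<sigma> = 1"
  by (metis abs_mult_self_eq mult_1)

lemma summable_alternating_half: "summable (\<lambda>b. (-1) ^ b / (real b + 1/2))"
proof -
  have "(\<lambda>b. 1 / (real b + 1/2)) \<longlonglongrightarrow> 0" by real_asymp
  moreover have "0 \<le> 1 / (real n + 1/2) \<and> 1 / (real (Suc n) + 1/2) \<le> 1 / (real n + 1/2)" for n
    by (auto intro!: divide_left_mono)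
  ultimately have "summable (\<lambda>b. (-1) ^ b * (1 / (real b + 1/2)))"
    by (intro summable_Leibniz(1)) (auto simp: monoseq_Suc)
  then show ?thesis by simp
qed

text \<open>Half of each term is 1/(2b+1) - 1/(2b+2), a consecutive pair of the alternating harmonic
  series.\<close>

lemma sums_half_diff: "(\<lambda>b. 1 / (real b + 1/2) - 1 / real (Suc b)) sums (2 * ln 2)"
proof -
  have "(\<lambda>n. \<Sum>k=n*2..<n*2+2. (-1) ^ k / real (Suc k)) sums ln 2"
    using sums_group[OF alternating_harmonic_series_sums, of 2] by simp
  moreover have "(\<Sum>k=n*2..<n*2+2. (-1) ^ k / real (Suc k)) = (1 / (real n + 1/2) - 1 / real (Suc n)) / 2" for n
  proof -
    have "{n*2..<n*2+2} = {n*2, Suc (n*2)}" by auto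
    then show ?thesis by (simp add: field_simps)
  qed
  ultimately have "(\<lambda>b. (1 / (real b + 1/2) - 1 / real (Suc b)) / 2) sums ln 2" by (simp only:)
  from sums_mult[OF this, of 2] show ?thesis by (simp only: times_divide_eq_right nonzero_mult_div_cancel_left[OF zero_neq_numeral[symmetric]] mult_2[symmetric])
qed

lemma alt_zeta_one_neg: "alt_zeta 1 (-1) = - ln 2"
  using sums_minus[OF alternating_harmonic_series_sums] by (simp add: alt_zeta_def sums_iff)

lemma lerch_at_one:
  assumes "\<bar>\<sigma>\<bar> = 1" "m \<ge> 1"
  shows "lerch \<sigma> m 1 = of_real (\<sigma> * alt_zeta m \<sigma>)"
proof (cases "m = 1")
  case True
  \<comment> \<open>Here every term of the series vanishes, and only the additive constant is
    left.\<close>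
  then show ?thesis by (simp add: lerch_def lerch_term_def add.commute)
next
  case False
  have eq: "lerch_term \<sigma> m 1 = (\<lambda>b. of_real (\<sigma> ^ b / real (Suc b) ^ m))"
    using False by (simp add: lerch_term_def fun_eq_iff add.commute)
  have s: "summable (\<lambda>b. \<sigma> ^ b / real (Suc b) ^ m)"
    using summable_lerch_term[OF assms, of 1] unfolding eq by (simp only: summable_of_real_iff)
  have "alt_zeta m \<sigma> = \<sigma> * (\<Sum>b. \<sigma> ^ b / real (Suc b) ^ m)"
    using False suminf_mult[OF s, of \<sigma>] by (simp add: alt_zeta_def)
  then have "\<sigma> * alt_zeta m \<sigma> = (\<Sum>b. \<sigma> ^ b / real (Suc b) ^ m)"
    using sign_square[OF assms(1)] by (simp flip: mult.assoc)
  then show ?thesis using False s by (simp add: lerch_def eq suminf_of_real del: of_real_divide)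
qed

text \<open>For m = 1 the two signs behave differently. With sign 1 the regularised series itself
  has the value 2 ln 2. With sign -1 the regularisation subtracts ln 2, and the additive constant -
  \<open>alt_zeta 1 (-1)\<close> = ln 2 restores it.\<close>

lemma lerch_at_half:
  assumes "\<bar>\<sigma>\<bar> = 1" "m \<ge> 1"
  shows "lerch \<sigma> m (1/2) = of_real (\<sigma> * alt_t m \<sigma>)"
proof -
  have half: "complex_of_nat b + 1/2 = of_real (real b + 1/2)" for b by simp
  have suc_half: "real (Suc b) - 1/2 = real b + 1/2" for b by simp
  consider "m \<noteq> 1" | "m = 1" "\<sigma> = 1" | "m = 1" "\<sigma> = -1" using assms(1) by (auto simp: abs_if split: if_splits)
  then show ?thesis
  proof cases
    case 1
    have eq: "lerch_term \<sigma> m (1/2) = (\<lambda>b. of_real (\<sigma> ^ b / (real b + 1/2) ^ m))"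
      using 1 unfolding lerch_term_def half fun_eq_iff by simp
    have s: "summable (\<lambda>b. \<sigma> ^ b / (real b + 1/2) ^ m)"
      using summable_lerch_term[OF assms, of "1/2"] unfolding eq by (simp only: summable_of_real_iff)
    have "alt_t m \<sigma> = \<sigma> * (\<Sum>b. \<sigma> ^ b / (real b + 1/2) ^ m)"
      unfolding alt_t_def suc_half using 1 suminf_mult[OF s, of \<sigma>] by simp
    then have "\<sigma> * alt_t m \<sigma> = (\<Sum>b. \<sigma> ^ b / (real b + 1/2) ^ m)"
      using sign_square[OF assms(1)] by (simp flip: mult.assoc)
    then show ?thesis using 1 s by (simp add: lerch_def eq suminf_of_real del: of_real_divide)
  next
    case 2
    have eq: "lerch_term \<sigma> m (1/2) = (\<lambda>b. of_real (1 / (real b + 1/2) - 1 / real (Suc b)))"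
      using 2 unfolding lerch_term_def half fun_eq_iff by simp
    have "(\<lambda>b. complex_of_real (1 / (real b + 1/2) - 1 / real (Suc b))) sums of_real (2 * ln 2)"
      using sums_half_diff by (simp only: sums_of_real_iff)
    then have "suminf (lerch_term \<sigma> m (1/2)) = of_real (2 * ln 2)"
      unfolding eq by (rule sums_unique[symmetric])
    then show ?thesis using 2 by (simp add: lerch_def alt_zeta_def alt_t_def)
  next
    case 3
    let ?S = "\<Sum>b. (-1) ^ b / (real b + 1/2)"
    have eq: "lerch_term \<sigma> m (1/2) = (\<lambda>b. of_real ((-1) ^ b / (real b + 1/2) - (-1) ^ b / real (Suc b)))"
      using 3 unfolding lerch_term_def half fun_eq_iff by (simp add: algebra_simps)
    have "(\<lambda>b. (-1) ^ b / (real b + 1/2) - (-1) ^ b / real (Suc b)) sums (?S - ln 2)"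
      by (intro sums_diff alternating_harmonic_series_sums summable_sums summable_alternating_half)
    then have s: "(\<lambda>b. complex_of_real ((-1) ^ b / (real b + 1/2) - (-1) ^ b / real (Suc b))) sums of_real (?S - ln 2)"
      by (simp only: sums_of_real_iff)
    have "alt_t 1 (-1) = - ?S"
      unfolding alt_t_def suc_half using suminf_minus[OF summable_alternating_half] by simp
    have "suminf (lerch_term \<sigma> m (1/2)) = of_real (?S - ln 2)"
      unfolding eq by (rule sums_unique[OF s, symmetric])
    then show ?thesis using 3 alt_zeta_one_neg \<open>alt_t 1 (-1) = - ?S\<close> by (simp add: lerch_def)
  qed
qed

lemma lerch_shift:
  assumes "\<bar>\<sigma>\<bar> = 1" "m \<ge> 1" "z \<notin> \<int>\<^sub>\<le>\<^sub>0"
  shows "lerch \<sigma> m z = 1 / z ^ m + of_real \<sigma> * lerch \<sigma> m (z + 1)"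
proof -
  have s: "summable (lerch_term \<sigma> m z)" "summable (lerch_term \<sigma> m (z + 1))"
    using summable_lerch_term assms by auto
  have h: "(\<Sum>b. lerch_term \<sigma> m z b) = lerch_term \<sigma> m z 0 + (\<Sum>b. lerch_term \<sigma> m z (Suc b))"
    using suminf_split_head[OF s(1)] by simp
  show ?thesis
  proof (cases "m = 1")
    case False
    have "lerch_term \<sigma> m z (Suc b) = of_real \<sigma> * lerch_term \<sigma> m (z + 1) b" for b
      using False by (simp add: lerch_term_def add_ac)
    then show ?thesis using False h s(2)
      by (simp add: lerch_def suminf_mult) (simp add: lerch_term_def)
  next
    case True
    let ?a = "alt_zeta 1 \<sigma>"
    \<comment> \<open>Shifting the index replaces the subtracted 1/(b+1) by 1/(b+2).
      \<open>D\<close> is the total mismatch, a telescoping series for sign 1 and alternating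
      harmonic series for sign -1. The additive constant of \<open>lerch\<close> absorbs it exactly,
      so the functional equation for m = 1 has no correction term.\<close>
    have D: "(\<lambda>b. \<sigma> ^ Suc b * (1 / real (Suc b) - 1 / real (Suc (Suc b)))) sums (1 - \<sigma> * ?a + ?a)"
    proof (cases "\<sigma> = 1")
      case 1: True
      have "(\<lambda>n. 1 / real (Suc n)) \<longlonglongrightarrow> 0" by real_asymp
      from telescope_sums'[OF this] show ?thesis using 1 by simp
    next
      case False
      then have \<sigma>: "\<sigma> = -1" using assms(1) by (auto simp: abs_if split: if_splits)
      have "(\<lambda>b. (-1) ^ Suc b / real (Suc (Suc b))) sums (ln 2 - 1)"
        using alternating_harmonic_series_sums by (subst sums_Suc_iff) simp
      from sums_diff[OF sums_minus[OF alternating_harmonic_series_sums] this]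
      show ?thesis using alt_zeta_one_neg \<sigma> by (simp add: algebra_simps)
    qed
    have e: "lerch_term \<sigma> m z (Suc b) = of_real \<sigma> * lerch_term \<sigma> m (z + 1) b
       + of_real (\<sigma> ^ Suc b * (1 / real (Suc b) - 1 / real (Suc (Suc b))))" for b
      using True by (simp add: lerch_term_def algebra_simps)
    have "(\<lambda>b. lerch_term \<sigma> m z (Suc b)) sums (of_real \<sigma> * (\<Sum>b. lerch_term \<sigma> m (z + 1) b) + of_real (1 - \<sigma> * ?a + ?a))"
      unfolding e using D s(2) by (intro sums_add sums_mult summable_sums) (simp_all only: sums_of_real_iff)
    then have "(\<Sum>b. lerch_term \<sigma> m z (Suc b)) = of_real \<sigma> * (\<Sum>b. lerch_term \<sigma> m (z + 1) b) + of_real (1 - \<sigma> * ?a + ?a)"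
      by (rule sums_unique[symmetric])
    with h have "lerch \<sigma> m z = 1 / z ^ m - 1 + (of_real \<sigma> * (\<Sum>b. lerch_term \<sigma> m (z + 1) b)
        + of_real (1 - \<sigma> * ?a + ?a)) + of_real (\<sigma> * ?a)"
      using True by (simp add: lerch_def) (simp add: lerch_term_def)
    also have "\<dots> = 1 / z ^ m + (of_real \<sigma> * (\<Sum>b. lerch_term \<sigma> m (z + 1) b) + of_real ?a)"
      by simp
    also have "of_real ?a = of_real \<sigma> * complex_of_real (\<sigma> * ?a)"
      by (simp only: of_real_mult[symmetric] mult.assoc[symmetric] sign_square[OF assms(1)] mult_1)
    finally show ?thesis using True by (simp add: lerch_def distrib_left)
  qed
qed

lemma nonpos_Ints_add_of_nat:
  fixes z :: complex
  assumes "z \<notin> \<int>\<^sub>\<le>\<^sub>0"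
  shows "z + of_nat n \<notin> \<int>\<^sub>\<le>\<^sub>0"
proof
  assume "z + of_nat n \<in> \<int>\<^sub>\<le>\<^sub>0"
  from nonpos_Ints_diff_Nats[OF this of_nat_in_Nats[of n]] assms show False by simp
qed

lemma lerch_shift_nat:
  assumes "\<bar>\<sigma>\<bar> = 1" "m \<ge> 1" "z \<notin> \<int>\<^sub>\<le>\<^sub>0"
  shows "lerch \<sigma> m z = (\<Sum>i<n. of_real (\<sigma> ^ i) / (of_nat i + z) ^ m) + of_real (\<sigma> ^ n) * lerch \<sigma> m (z + of_nat n)"
proof (induction n)
  case (Suc n)
  from lerch_shift[OF assms(1,2) nonpos_Ints_add_of_nat[OF assms(3), of n]] Suc show ?case
    by (simp add: algebra_simps)
qed simp

text \<open>The i-th derivative in u is (-c)^i m (m+1) ... (m+i-1) f_(m+i), and division by i! turns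
  the rising factorial into a binomial coefficient. The family is abstract because Lerch functions,
  their regular parts and inverse powers all obey the same derivative rule.\<close>

lemma has_fps_expansion_deriv_chain:
  fixes f :: "nat \<Rightarrow> complex \<Rightarrow> complex"
  assumes "open S" "z0 \<in> S" "m \<ge> 1"
    and der: "\<And>m z. m \<ge> 1 \<Longrightarrow> z \<in> S \<Longrightarrow> (f m has_field_derivative - of_nat m * f (Suc m) z) (at z)"
  shows "(\<lambda>u. f m (z0 + c * u)) has_fps_expansion
           Abs_fps (\<lambda>i. (- c) ^ i * of_nat ((m + i - 1) choose i) * f (m + i) z0)"
proof -
  define T where "T = (\<lambda>u. z0 + c * u) -` S"
  define g where "g = (\<lambda>u. f m (z0 + c * u))"
  have T: "open T" "0 \<in> T"
    unfolding T_def using assms by (auto intro!: open_vimage continuous_intros)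
  define C where "C = (\<lambda>i. (- c) ^ i * fact i * of_nat ((m + i - 1) choose i))"
  have C: "C (Suc i) = - c * of_nat (m + i) * C i" for i
  proof -
    have "Suc i * (m + i choose Suc i) = (m + i) * (m + i - 1 choose i)"
      using Suc_times_binomial_eq[of "m + i - 1" i] assms(3) by (cases "m + i") (auto simp: mult.commute)
    then have *: "(of_nat (Suc i) :: complex) * of_nat (m + i choose Suc i) = of_nat (m + i) * of_nat (m + i - 1 choose i)"
      by (metis of_nat_mult)
    have "C (Suc i) = (- c) ^ Suc i * fact i * (of_nat (Suc i) * of_nat (m + i choose Suc i))"
      by (simp add: C_def)
    also have "\<dots> = - c * of_nat (m + i) * C i" unfolding * by (simp add: C_def)
    finally show ?thesis .
  qed
  have dg: "((\<lambda>u. f (m + i) (z0 + c * u)) has_field_derivative c * (- of_nat (m + i) * f (Suc (m + i)) (z0 + c * u))) (at u)"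
    if "u \<in> T" for u i
  proof -
    have "((\<lambda>u. z0 + c * u) has_field_derivative c) (at u)" by (auto intro!: derivative_eq_intros)
    have "(f (m + i) has_field_derivative - of_nat (m + i) * f (Suc (m + i)) (z0 + c * u)) (at (z0 + c * u))"
      using der[of "m + i"] that assms(3) by (simp add: T_def)
    from DERIV_chain2[OF this \<open>((\<lambda>u. z0 + c * u) has_field_derivative c) (at u)\<close>]
    show ?thesis by (simp only: mult.commute)
  qed
  have "\<forall>u\<in>T. (deriv ^^ i) g u = C i * f (m + i) (z0 + c * u)" for i
  proof (induction i)
    case 0
    then show ?case by (simp add: g_def C_def)
  next
    case (Suc i)
    show ?case
    proof
      fix u assume u: "u \<in> T"
      have "((deriv ^^ i) g has_field_derivative C i * (c * (- of_nat (m + i) * f (Suc (m + i)) (z0 + c * u)))) (at u)"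
        by (rule has_field_derivative_transform_within_open[OF DERIV_cmult[OF dg[OF u]] T(1) u])
           (use Suc in auto)
      from DERIV_imp_deriv[OF this] show "(deriv ^^ Suc i) g u = C (Suc i) * f (m + Suc i) (z0 + c * u)"
        unfolding C by (simp add: algebra_simps)
    qed
  qed
  moreover have "g holomorphic_on T"
    unfolding g_def holomorphic_on_open[OF T(1)] using dg[of _ 0] by auto
  then have "g has_fps_expansion fps_expansion g 0" using T by blast
  ultimately have "g has_fps_expansion Abs_fps (\<lambda>i. C i * f (m + i) z0 / fact i)"
    using T(2) by (simp add: fps_expansion_def)
  moreover have "C i * w / fact i = (- c) ^ i * of_nat ((m + i - 1) choose i) * w" for i w
    by (simp add: C_def)
  ultimately show ?thesis by (simp only: g_def)
qed

section \<open>Values at shifted half-integers and regular parts at the poles\<close>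

lemma not_nonpos_Ints_half: "1/2 - of_nat n \<notin> (\<int>\<^sub>\<le>\<^sub>0 :: complex set)" "1/2 + of_nat n \<notin> (\<int>\<^sub>\<le>\<^sub>0 :: complex set)"
proof -
  have "x \<notin> \<int>\<^sub>\<le>\<^sub>0" if "Re x = 1/2 + of_int j" for x :: complex and j
  proof
    assume "x \<in> \<int>\<^sub>\<le>\<^sub>0"
    then obtain i :: int where "x = of_int i" by (auto elim!: nonpos_Ints_cases)
    then have "2 * i = 1 + 2 * j" using that by (simp add: field_simps flip: of_int_add of_int_mult)
    then show False by presburger
  qed
  from this[of _ "- int n"] this[of _ "int n"]
  show "1/2 - of_nat n \<notin> (\<int>\<^sub>\<le>\<^sub>0 :: complex set)" "1/2 + of_nat n \<notin> (\<int>\<^sub>\<le>\<^sub>0 :: complex set)" by auto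
qed

lemma sign_power_diff:
  fixes \<sigma> :: real
  assumes "\<bar>\<sigma>\<bar> = 1" "1 \<le> k" "k \<le> n"
  shows "\<sigma> ^ (n - k) = \<sigma> ^ n * \<sigma> * \<sigma> ^ (k - 1)"
proof -
  have "\<sigma> ^ n = \<sigma> ^ (n - k) * \<sigma> ^ k" using assms(3) by (simp flip: power_add)
  moreover have "\<sigma> ^ k = \<sigma> * \<sigma> ^ (k - 1)" using assms(2) by (cases k) auto
  moreover have "\<sigma> ^ k * \<sigma> ^ k = 1"
    using sign_square[OF assms(1)] by (simp flip: power_mult_distrib)
  ultimately show ?thesis by (metis mult.assoc mult.right_neutral)
qed

text \<open>The functional equation produces these sums in the order opposite to
  \<open>h_sum\<close> and \<open>H_sum\<close>. As a sign is its own inverse, the reversal costs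
  only \<sigma>^n, and a further \<sigma> because the exponents there are k - 1.\<close>

lemma sum_reversed_signs:
  fixes \<sigma> :: real and g :: "nat \<Rightarrow> real"
  assumes "\<bar>\<sigma>\<bar> = 1"
  shows "(\<Sum>i<n. \<sigma> ^ i * g (n - i)) = \<sigma> ^ n * \<sigma> * (\<Sum>k=1..n. \<sigma> ^ (k - 1) * g k)"
proof -
  have "(\<Sum>i<n. \<sigma> ^ i * g (n - i)) = (\<Sum>k=1..n. \<sigma> ^ (n - k) * g k)"
    by (rule sum.reindex_bij_witness[of _ "\<lambda>k. n - k" "\<lambda>i. n - i"]) auto
  also have "\<dots> = (\<Sum>k=1..n. \<sigma> ^ n * \<sigma> * (\<sigma> ^ (k - 1) * g k))"
    by (intro sum.cong) (auto simp: sign_power_diff[OF assms] mult.assoc)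
  finally show ?thesis by (simp add: sum_distrib_left)
qed

text \<open>Needed for the residue at s = n, where the Lerch argument is 1/2 - n. Then n shifts lead
  to 1/2 through the points -(k - 1/2), whence (-1)^m.\<close>

lemma lerch_half_minus_of_nat:
  assumes "\<bar>\<sigma>\<bar> = 1" "m \<ge> 1"
  shows "lerch \<sigma> m (1/2 - of_nat n) = of_real (\<sigma> ^ n * \<sigma> * (alt_t m \<sigma> + (-1) ^ m * h_sum m \<sigma> n))"
proof -
  have "(\<Sum>i<n. of_real (\<sigma> ^ i) / (of_nat i + (1/2 - of_nat n)) ^ m)
      = complex_of_real (\<Sum>i<n. \<sigma> ^ i * ((-1) ^ m / (real (n - i) - 1/2) ^ m))"
  proof -
    have "of_real (\<sigma> ^ i) / (of_nat i + (1/2 - of_nat n)) ^ m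
      = complex_of_real (\<sigma> ^ i * ((-1) ^ m / (real (n - i) - 1/2) ^ m))" if "i < n" for i
    proof -
      have "of_nat i + (1/2 - of_nat n) = complex_of_real (- (real (n - i) - 1/2))"
        using that by (simp add: of_nat_diff)
      moreover have "x / (- y) ^ m = x * ((-1) ^ m / y ^ m)" for x y :: real
        by (cases "even m") auto
      ultimately show ?thesis by (simp only: flip: of_real_power of_real_divide)
    qed
    then show ?thesis by simp
  qed
  also have "\<dots> = of_real (\<sigma> ^ n * \<sigma> * ((-1) ^ m * h_sum m \<sigma> n))"
    unfolding sum_reversed_signs[OF assms(1), where g = "\<lambda>k. (-1) ^ m / (real k - 1/2) ^ m"]
    by (simp add: h_sum_def sum_distrib_left mult_ac)
  finally show ?thesis
    using lerch_shift_nat[OF assms not_nonpos_Ints_half(1), of n n] lerch_at_half[OF assms]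
    by (simp add: distrib_left add.commute mult.assoc)
qed

text \<open>Needed for the residue at s = -n: n shifts from 1/2 lead to this point, and the
  resulting equation is solved for its far end.\<close>

lemma lerch_half_plus_of_nat:
  assumes "\<bar>\<sigma>\<bar> = 1" "m \<ge> 1"
  shows "lerch \<sigma> m (1/2 + of_nat n) = of_real (\<sigma> ^ n * (\<sigma> * alt_t m \<sigma> - h_sum m \<sigma> n))"
proof -
  have "(\<Sum>i<n. of_real (\<sigma> ^ i) / (of_nat i + 1/2) ^ m) = complex_of_real (\<Sum>i<n. \<sigma> ^ i / (real i + 1/2) ^ m)"
    by simp
  also have "(\<Sum>i<n. \<sigma> ^ i / (real i + 1/2) ^ m) = h_sum m \<sigma> n"
    unfolding h_sum_def by (rule sum.reindex_bij_witness[of _ "\<lambda>k. k - 1" "\<lambda>i. i + 1"]) (auto simp: algebra_simps)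
  finally have "of_real (\<sigma> * alt_t m \<sigma>) = of_real (h_sum m \<sigma> n) + of_real (\<sigma> ^ n) * lerch \<sigma> m (1/2 + of_nat n)"
    using lerch_shift_nat[OF assms, of "1/2" n] lerch_at_half[OF assms] not_nonpos_Ints_half(2)[of 0]
    by simp
  then have "of_real (\<sigma> ^ n) * complex_of_real (\<sigma> * alt_t m \<sigma> - h_sum m \<sigma> n)
     = of_real (\<sigma> ^ n * \<sigma> ^ n) * lerch \<sigma> m (1/2 + of_nat n)"
    by (simp add: mult.assoc)
  moreover have "\<sigma> ^ n * \<sigma> ^ n = 1"
    using sign_square[OF assms(1)] by (simp flip: power_mult_distrib)
  ultimately show ?thesis by (simp only: of_real_mult of_real_1 mult_1)
qed

text \<open>\<open>lerch\<close> with the term that is singular at \<open>- b\<close> removed.\<close>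

definition lerch_reg :: "real \<Rightarrow> nat \<Rightarrow> nat \<Rightarrow> complex \<Rightarrow> complex" where
  "lerch_reg \<sigma> b m z = (\<Sum>i<b. of_real (\<sigma> ^ i) / (of_nat i + z) ^ m)
     + of_real (\<sigma> ^ Suc b) * lerch \<sigma> m (z + of_nat (Suc b))"

lemma lerch_eq_pole_plus_reg:
  assumes "\<bar>\<sigma>\<bar> = 1" "m \<ge> 1" "z \<notin> \<int>\<^sub>\<le>\<^sub>0"
  shows "lerch \<sigma> m z = of_real (\<sigma> ^ b) / (of_nat b + z) ^ m + lerch_reg \<sigma> b m z"
  using lerch_shift_nat[OF assms, of "Suc b"] by (simp add: lerch_reg_def add_ac)

lemma not_nonpos_Ints_if_Re_pos: "Re z > 0 \<Longrightarrow> z \<notin> \<int>\<^sub>\<le>\<^sub>0"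
  by (auto elim!: nonpos_Ints_cases)

text \<open>The unit disc about -b misses the poles -i with i < b, and adding b + 1 moves it into
  the right half-plane. So every summand of the regular part obeys the derivative rule there, also
  at -b itself.\<close>

lemma has_field_derivative_lerch_reg:
  assumes "\<bar>\<sigma>\<bar> = 1" "m \<ge> 1" "z \<in> ball (- of_nat b) 1"
  shows "(lerch_reg \<sigma> b m has_field_derivative - of_nat m * lerch_reg \<sigma> b (Suc m) z) (at z)"
proof -
  have Re: "\<bar>Re z + real b\<bar> < 1"
    using assms(3) abs_Re_le_cmod[of "- of_nat b - z"] by (simp add: dist_norm)
  have term_deriv: "((\<lambda>z. of_real (\<sigma> ^ i) / (of_nat i + z) ^ m) has_field_derivative
      - of_nat m * (of_real (\<sigma> ^ i) / (of_nat i + z) ^ Suc m)) (at z)" if "i < b" for i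
  proof -
    have "Re (of_nat i + z) < 0" using Re that by simp
    then have nz: "of_nat i + z \<noteq> 0" by (metis less_irrefl zero_complex.sel(1))
    have "(of_nat i + z) ^ m = (of_nat i + z) ^ (m - 1) * (of_nat i + z)"
      using assms(2) by (metis Suc_diff_le diff_Suc_1 power_Suc2 One_nat_def)
    then have "- of_real (\<sigma> ^ i) * (of_nat m * (of_nat i + z) ^ (m - 1)) / ((of_nat i + z) ^ m)\<^sup>2
       = - of_nat m * (of_real (\<sigma> ^ i) / (of_nat i + z) ^ Suc m)"
      using nz by (simp add: power2_eq_square)
    moreover have "((\<lambda>z. of_real (\<sigma> ^ i) / (of_nat i + z) ^ m) has_field_derivative
       - of_real (\<sigma> ^ i) * (of_nat m * (of_nat i + z) ^ (m - 1)) / ((of_nat i + z) ^ m)\<^sup>2) (at z)"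
      using nz by (auto intro!: derivative_eq_intros simp: power2_eq_square)
    ultimately show ?thesis by (simp only:)
  qed
  have "z + of_nat (Suc b) \<notin> \<int>\<^sub>\<le>\<^sub>0" using Re by (intro not_nonpos_Ints_if_Re_pos) auto
  from has_field_derivative_lerch[OF assms(1,2) this]
  have "((\<lambda>z. lerch \<sigma> m (z + of_nat (Suc b))) has_field_derivative
      - of_nat m * lerch \<sigma> (Suc m) (z + of_nat (Suc b))) (at z)"
    by (simp only: DERIV_shift)
  from DERIV_add[OF DERIV_sum[of "{..<b}", OF term_deriv] DERIV_cmult[OF this, of "of_real (\<sigma> ^ Suc b)"]]
  show ?thesis unfolding lerch_reg_def[abs_def]
    by (simp add: sum_distrib_left distrib_left sum_negf mult_ac)
qed

text \<open>The terms before the pole form a reversed harmonic sum, and those after it form a full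
  Lerch series at 1. This is the source of the two summands in the braces of the third term: R-sums
  from \<open>H_sum\<close>, zeta values from the tail.\<close>

lemma lerch_reg_at_pole:
  assumes "\<bar>\<sigma>\<bar> = 1" "m \<ge> 1"
  shows "lerch_reg \<sigma> b m (- of_nat b) = of_real (\<sigma> ^ b * (alt_zeta m \<sigma> + (-1) ^ m * \<sigma> * H_sum m \<sigma> b))"
proof -
  have "(\<Sum>i<b. of_real (\<sigma> ^ i) / (of_nat i + - of_nat b) ^ m)
      = complex_of_real (\<Sum>i<b. \<sigma> ^ i * ((-1) ^ m / real (b - i) ^ m))"
  proof -
    have "of_real (\<sigma> ^ i) / (of_nat i + - of_nat b) ^ m
      = complex_of_real (\<sigma> ^ i * ((-1) ^ m / real (b - i) ^ m))" if "i < b" for i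
    proof -
      have "of_nat i + - of_nat b = complex_of_real (- real (b - i))"
        using that by (simp add: of_nat_diff)
      moreover have "x / (- y) ^ m = x * ((-1) ^ m / y ^ m)" for x y :: real
        by (cases "even m") auto
      ultimately show ?thesis by (simp only: flip: of_real_power of_real_divide)
    qed
    then show ?thesis by simp
  qed
  also have "\<dots> = of_real (\<sigma> ^ b * ((-1) ^ m * \<sigma> * H_sum m \<sigma> b))"
    unfolding sum_reversed_signs[OF assms(1), where g = "\<lambda>k. (-1) ^ m / real k ^ m"]
    by (simp add: H_sum_def sum_distrib_left mult_ac)
  finally have *: "(\<Sum>i<b. of_real (\<sigma> ^ i) / (of_nat i + - of_nat b) ^ m)
      = complex_of_real (\<sigma> ^ b * ((-1) ^ m * \<sigma> * H_sum m \<sigma> b))" .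
  have "\<sigma> ^ Suc b * (\<sigma> * alt_zeta m \<sigma>) = \<sigma> ^ b * alt_zeta m \<sigma>"
    using sign_square[OF assms(1)] by (simp add: mult_ac)
  moreover have "- of_nat b + of_nat (Suc b) = (1 :: complex)" by simp
  ultimately show ?thesis
    unfolding lerch_reg_def * \<open>- of_nat b + of_nat (Suc b) = (1 :: complex)\<close> lerch_at_one[OF assms]
    by (simp only: of_real_mult[symmetric] of_real_add[symmetric] distrib_left add.commute)
qed

section \<open>Local expansions and residues\<close>

lemma has_fps_expansion_lerch_minus:
  assumes "\<bar>\<sigma>\<bar> = 1" "m \<ge> 1" "z \<notin> \<int>\<^sub>\<le>\<^sub>0"
  shows "(\<lambda>u. lerch \<sigma> m (z - u)) has_fps_expansion
           Abs_fps (\<lambda>i. of_nat ((m + i - 1) choose i) * lerch \<sigma> (m + i) z)"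
  using has_fps_expansion_deriv_chain[of "- \<int>\<^sub>\<le>\<^sub>0" z m "lerch \<sigma>" "-1"] assms
    has_field_derivative_lerch[OF assms(1)]
  by (simp add: closed_nonpos_Ints open_Compl)

lemma has_fps_expansion_lerch_plus:
  assumes "\<bar>\<sigma>\<bar> = 1" "m \<ge> 1" "z \<notin> \<int>\<^sub>\<le>\<^sub>0"
  shows "(\<lambda>u. lerch \<sigma> m (z + u)) has_fps_expansion
           Abs_fps (\<lambda>i. (-1) ^ i * of_nat ((m + i - 1) choose i) * lerch \<sigma> (m + i) z)"
  using has_fps_expansion_deriv_chain[of "- \<int>\<^sub>\<le>\<^sub>0" z m "lerch \<sigma>" 1] assms
    has_field_derivative_lerch[OF assms(1)]
  by (simp add: closed_nonpos_Ints open_Compl)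

lemma has_fps_expansion_lerch_reg:
  assumes "\<bar>\<sigma>\<bar> = 1" "m \<ge> 1"
  shows "(\<lambda>u. lerch_reg \<sigma> b m (- of_nat b - u)) has_fps_expansion
           Abs_fps (\<lambda>i. of_real (\<sigma> ^ b * (real ((m + i - 1) choose i)
             * (alt_zeta (m + i) \<sigma> + (-1) ^ (m + i) * \<sigma> * H_sum (m + i) \<sigma> b))))"
proof -
  have "(\<lambda>u. lerch_reg \<sigma> b m (- of_nat b + (-1) * u)) has_fps_expansion
           Abs_fps (\<lambda>i. (- (-1)) ^ i * of_nat ((m + i - 1) choose i) * lerch_reg \<sigma> b (m + i) (- of_nat b))"
    by (rule has_fps_expansion_deriv_chain[of "ball (- of_nat b) 1"])
       (use assms has_field_derivative_lerch_reg[OF assms(1)] in auto)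
  then show ?thesis using assms by (simp add: lerch_reg_at_pole mult_ac)
qed

lemma has_fps_expansion_inverse_power:
  assumes "z \<noteq> (0::complex)" "q \<ge> 1"
  shows "(\<lambda>u. 1 / (z + u) ^ q) has_fps_expansion
           Abs_fps (\<lambda>i. (-1) ^ i * of_nat ((q + i - 1) choose i) * (1 / z ^ (q + i)))"
proof -
  have "((\<lambda>z. 1 / z ^ m) has_field_derivative - of_nat m * (1 / z ^ Suc m)) (at z)"
    if "m \<ge> 1" "z \<in> - {0}" for m and z :: complex
  proof -
    have "z ^ m = z ^ (m - 1) * z"
      using that by (metis Suc_diff_le diff_Suc_1 power_Suc2 One_nat_def)
    then have "- (of_nat m * z ^ (m - 1)) / (z ^ m)\<^sup>2 = - of_nat m * (1 / z ^ Suc m)"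
      using that by (simp add: power2_eq_square)
    moreover have "((\<lambda>z. 1 / z ^ m) has_field_derivative - (of_nat m * z ^ (m - 1)) / (z ^ m)\<^sup>2) (at z)"
      using that by (auto intro!: derivative_eq_intros simp: power2_eq_square)
    ultimately show ?thesis by (simp only:)
  qed
  then show ?thesis
    using has_fps_expansion_deriv_chain[of "- {0}" z q "\<lambda>m z. 1 / z ^ m" 1] assms
    by (simp add: open_Compl)
qed

text \<open>Multiplying out leaves polar parts of orders m + p, m and p, while P A B is regular. All
  three kinds of poles are instances: at 0 the two polar factors are the lattice kernel and 1/s^q,
  at a nonzero integer the second one degenerates to 0/u + 1, and at a half-integer they are the two
  Lerch functions.\<close>

lemma residue_two_poles:
  fixes P A B :: "complex \<Rightarrow> complex"
  assumes P: "P has_fps_expansion P'" and A: "A has_fps_expansion A'" and B: "B has_fps_expansion B'"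
    and mp: "m \<ge> 1" "p \<ge> 1"
    and F: "\<And>u. u \<noteq> 0 \<Longrightarrow> norm u < 1/2 \<Longrightarrow> F (z + u) = P u * (a / u ^ m + A u) * (b / u ^ p + B u)"
  shows "residue F z = a * b * fps_nth P' (m + p - 1) + a * fps_nth (P' * B') (m - 1)
           + b * fps_nth (P' * A') (p - 1)"
proof -
  define G where "G = (\<lambda>u. P u * (a + A u * u ^ m) * (b + B u * u ^ p))"
  have G: "G has_fps_expansion P' * (fps_const a + A' * fps_X ^ m) * (fps_const b + B' * fps_X ^ p)"
    unfolding G_def by (intro fps_expansion_intros P A B)
  have "residue F z = residue (\<lambda>u. F (z + u)) 0" by (rule residue_shift_0') (simp add: NO_MATCH_def)
  also have "\<dots> = residue (\<lambda>u. G u / u ^ Suc (m + p - 1)) 0"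
  proof (rule residue_cong)
    have "\<forall>\<^sub>F u in at 0. norm (u::complex) < 1/2 \<and> u \<noteq> 0"
      unfolding eventually_at by (intro exI[of _ "1/2"]) (auto simp: dist_norm)
    then show "\<forall>\<^sub>F u in at 0. F (z + u) = G u / u ^ Suc (m + p - 1)"
    proof eventually_elim
      case (elim u)
      have "a / u ^ m + A u = (a + A u * u ^ m) / u ^ m" "b / u ^ p + B u = (b + B u * u ^ p) / u ^ p"
        using elim by (auto simp: add_divide_distrib)
      then have "F (z + u) = G u / u ^ (m + p)"
        using elim by (simp add: F G_def power_add)
      then show ?case using mp by simp
    qed
  qed auto
  also have "\<dots> = fps_nth (P' * (fps_const a + A' * fps_X ^ m) * (fps_const b + B' * fps_X ^ p)) (m + p - 1)"
    by (rule residue_fps_expansion_over_power_at_0[OF G])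
  also have "P' * (fps_const a + A' * fps_X ^ m) * (fps_const b + B' * fps_X ^ p)
    = fps_const (a * b) * P' + fps_const a * (fps_X ^ p * (P' * B')) + fps_const b * (fps_X ^ m * (P' * A'))
      + fps_X ^ (m + p) * (P' * A' * B')"
  proof -
    have "P' * (a' + A' * x) * (b' + B' * y) = a' * b' * P' + a' * (y * (P' * B')) + b' * (x * (P' * A'))
      + x * y * (P' * A' * B')" for a' b' x y
      by (simp add: algebra_simps)
    then show ?thesis by (simp only: power_add fps_const_mult)
  qed
  also have "fps_nth \<dots> (m + p - 1) = a * b * fps_nth P' (m + p - 1) + a * fps_nth (P' * B') (m - 1)
           + b * fps_nth (P' * A') (p - 1)"
  proof -
    have "m + p - 1 - p = m - 1" "m + p - 1 - m = p - 1" "\<not> m + p - 1 < p" "\<not> m + p - 1 < m" "m + p - 1 < m + p"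
      using mp by auto
    then show ?thesis
      by (simp only: fps_add_nth fps_mult_left_const_nth fps_X_power_mult_nth if_True if_False) simp
  qed
  finally show ?thesis .
qed

text \<open>This is \<open>\<pi> cot (\<pi> s)\<close> for \<open>\<tau> = 1\<close> and \<open>\<pi> / sin (\<pi> s)\<close> for \<open>\<tau> = -1\<close>.\<close>

definition lattice_kernel :: "real \<Rightarrow> complex \<Rightarrow> complex" where
  "lattice_kernel \<tau> s = lerch \<tau> 1 s - of_real \<tau> * lerch \<tau> 1 (1 - s)"

lemma not_nonpos_Ints_if_not_Ints: "s \<notin> \<int> \<Longrightarrow> s \<notin> \<int>\<^sub>\<le>\<^sub>0"
  using nonpos_Ints_Int by blast

text \<open>Apply the functional equation at s to the first Lerch function and at -s to the second;
  the polar terms agree because \<tau>^2 = 1.\<close>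

lemma lattice_kernel_add_1:
  assumes "\<bar>\<tau>\<bar> = 1" "s \<notin> \<int>"
  shows "lattice_kernel \<tau> (s + 1) = of_real \<tau> * lattice_kernel \<tau> s"
proof -
  have "- s \<notin> \<int>\<^sub>\<le>\<^sub>0" "s \<notin> \<int>\<^sub>\<le>\<^sub>0" using assms(2) not_nonpos_Ints_if_not_Ints by auto
  then have 1: "lerch \<tau> 1 s = 1 / s + of_real \<tau> * lerch \<tau> 1 (s + 1)"
    and 2: "lerch \<tau> 1 (- s) = - 1 / s + of_real \<tau> * lerch \<tau> 1 (1 - s)"
    using lerch_shift[OF assms(1), of 1 s] lerch_shift[OF assms(1), of 1 "- s"] by auto
  have 3: "1 - (s + 1) = - s" by simp
  have t: "of_real \<tau> * (of_real \<tau> * w) = w" for w :: complex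
    using sign_square[OF assms(1)] by (metis mult.assoc mult_1 of_real_1 of_real_mult)
  show ?thesis unfolding lattice_kernel_def 1 2 3 by (simp add: algebra_simps t)
qed

lemma lattice_kernel_add_of_nat:
  assumes "\<bar>\<tau>\<bar> = 1" "s \<notin> \<int>"
  shows "lattice_kernel \<tau> (s + of_nat n) = of_real (\<tau> ^ n) * lattice_kernel \<tau> s"
proof (induction n)
  case (Suc n)
  have "s + of_nat n \<notin> \<int>" using assms(2) by (metis Ints_diff Ints_of_nat add_diff_cancel_right')
  from lattice_kernel_add_1[OF assms(1) this] Suc show ?case by (simp add: add_ac)
qed simp

lemma lattice_kernel_diff_of_nat:
  assumes "\<bar>\<tau>\<bar> = 1" "s \<notin> \<int>"
  shows "lattice_kernel \<tau> (s - of_nat n) = of_real (\<tau> ^ n) * lattice_kernel \<tau> s"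
proof -
  have "s - of_nat n \<notin> \<int>" using assms(2) by (metis Ints_add Ints_of_nat diff_add_cancel)
  from lattice_kernel_add_of_nat[OF assms(1) this, of n]
  have "lattice_kernel \<tau> s = of_real (\<tau> ^ n) * lattice_kernel \<tau> (s - of_nat n)" by simp
  moreover have "\<tau> ^ n * \<tau> ^ n = 1"
    using sign_square[OF assms(1)] by (simp flip: power_mult_distrib)
  ultimately show ?thesis by (metis mult.assoc mult_1 of_real_1 of_real_mult)
qed

text \<open>The lattice kernel without its pole at 0. It is odd in u, which is why the fifth term
  contains zeta values at even arguments only.\<close>

definition lattice_kernel_reg :: "real \<Rightarrow> complex \<Rightarrow> complex" where
  "lattice_kernel_reg \<tau> u = of_real \<tau> * (lerch \<tau> 1 (1 + u) - lerch \<tau> 1 (1 - u))"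

lemma lattice_kernel_eq_pole_plus_reg:
  assumes "\<bar>\<tau>\<bar> = 1" "u \<notin> \<int>"
  shows "lattice_kernel \<tau> u = 1 / u + lattice_kernel_reg \<tau> u"
proof -
  have "lerch \<tau> 1 u = 1 / u + of_real \<tau> * lerch \<tau> 1 (1 + u)"
    using lerch_shift[OF assms(1), of 1 u] not_nonpos_Ints_if_not_Ints[OF assms(2)]
    by (simp add: add.commute)
  then show ?thesis
    by (simp only: lattice_kernel_def lattice_kernel_reg_def right_diff_distrib add_diff_eq)
qed

lemma has_fps_expansion_lattice_kernel_reg:
  assumes "\<bar>\<tau>\<bar> = 1"
  shows "lattice_kernel_reg \<tau> has_fps_expansion
           Abs_fps (\<lambda>i. of_real (((-1) ^ i - 1) * alt_zeta (i + 1) \<tau>))"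
proof -
  have "1 \<notin> (\<int>\<^sub>\<le>\<^sub>0 :: complex set)" by (rule not_nonpos_Ints_if_Re_pos) simp
  then have "lattice_kernel_reg \<tau> has_fps_expansion fps_const (of_real \<tau>) *
     (Abs_fps (\<lambda>i. (-1) ^ i * of_nat ((1 + i - 1) choose i) * lerch \<tau> (1 + i) 1)
      - Abs_fps (\<lambda>i. of_nat ((1 + i - 1) choose i) * lerch \<tau> (1 + i) 1))"
    unfolding lattice_kernel_reg_def[abs_def]
    by (intro fps_expansion_intros has_fps_expansion_lerch_minus has_fps_expansion_lerch_plus assms) auto
  also have "\<dots> = Abs_fps (\<lambda>i. of_real (((-1) ^ i - 1) * alt_zeta (i + 1) \<tau>))"
  proof (rule fps_ext)
    fix i
    have "complex_of_real \<tau> * (x * of_real (\<tau> * y) - of_real (\<tau> * y)) = (x - 1) * of_real y" for x y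
    proof -
      have "complex_of_real \<tau> * (x * of_real (\<tau> * y) - of_real (\<tau> * y)) = of_real (\<tau> * \<tau>) * ((x - 1) * of_real y)"
        by (simp add: algebra_simps)
      then show ?thesis unfolding sign_square[OF assms] by simp
    qed
    then show "fps_nth (fps_const (of_real \<tau>) *
     (Abs_fps (\<lambda>i. (-1) ^ i * of_nat ((1 + i - 1) choose i) * lerch \<tau> (1 + i) 1)
      - Abs_fps (\<lambda>i. of_nat ((1 + i - 1) choose i) * lerch \<tau> (1 + i) 1))) i
      = fps_nth (Abs_fps (\<lambda>i. of_real (((-1) ^ i - 1) * alt_zeta (i + 1) \<tau>))) i"
      using lerch_at_one[OF assms, of "Suc i"] by simp
  qed
  finally show ?thesis .
qed

text \<open>The reflection of s at 1/2 becomes a change of sign of u, so both Lerch functions expand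
  around the same point and their coefficients combine to the parity factor.\<close>

lemma has_fps_expansion_lattice_kernel_half:
  assumes "\<bar>\<tau>\<bar> = 1"
  shows "(\<lambda>u. lattice_kernel \<tau> (1/2 + u)) has_fps_expansion
           Abs_fps (\<lambda>k. of_real (- parity_delta \<tau> k * alt_t (k + 1) \<tau>))"
proof -
  have half: "1/2 \<notin> (\<int>\<^sub>\<le>\<^sub>0 :: complex set)" by (rule not_nonpos_Ints_if_Re_pos) simp
  have e: "1 - (1/2 + u) = 1/2 - u" for u :: complex by simp
  have "(\<lambda>u. lattice_kernel \<tau> (1/2 + u)) has_fps_expansion
     Abs_fps (\<lambda>i. (-1) ^ i * of_nat ((1 + i - 1) choose i) * lerch \<tau> (1 + i) (1/2))
      - fps_const (of_real \<tau>) * Abs_fps (\<lambda>i. of_nat ((1 + i - 1) choose i) * lerch \<tau> (1 + i) (1/2))"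
    unfolding lattice_kernel_def e
    by (intro fps_expansion_intros has_fps_expansion_lerch_minus has_fps_expansion_lerch_plus assms half) auto
  also have "\<dots> = Abs_fps (\<lambda>k. of_real (- parity_delta \<tau> k * alt_t (k + 1) \<tau>))"
  proof (rule fps_ext)
    fix i
    have "x * of_real (\<tau> * y) - complex_of_real \<tau> * of_real (\<tau> * y) = (of_real \<tau> * x - 1) * of_real y" for x y
    proof -
      have "x * of_real (\<tau> * y) - complex_of_real \<tau> * of_real (\<tau> * y) = (of_real \<tau> * x - of_real (\<tau> * \<tau>)) * of_real y"
        by (simp add: algebra_simps)
      then show ?thesis unfolding sign_square[OF assms] by simp
    qed
    then show "fps_nth (Abs_fps (\<lambda>i. (-1) ^ i * of_nat ((1 + i - 1) choose i) * lerch \<tau> (1 + i) (1/2))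
      - fps_const (of_real \<tau>) * Abs_fps (\<lambda>i. of_nat ((1 + i - 1) choose i) * lerch \<tau> (1 + i) (1/2))) i
      = fps_nth (Abs_fps (\<lambda>k. of_real (- parity_delta \<tau> k * alt_t (k + 1) \<tau>))) i"
      using lerch_at_half[OF assms, of "Suc i"] by (simp add: parity_delta_def)
  qed
  finally show ?thesis .
qed


text \<open>\<tau> is a free parameter here, and \<sigma>3 is absent: it enters only when the
  residues are summed, as the product \<tau> \<sigma>1 \<sigma>2.\<close>

definition euler_kernel :: "nat \<Rightarrow> nat \<Rightarrow> nat \<Rightarrow> real \<Rightarrow> real \<Rightarrow> real \<Rightarrow> complex \<Rightarrow> complex" where
  "euler_kernel m p q \<sigma>1 \<sigma>2 \<tau> s =
     lattice_kernel \<tau> s * lerch \<sigma>1 m (1/2 - s) * lerch \<sigma>2 p (1/2 - s) / s ^ q"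

section \<open>Residues of the Euler kernel at its three kinds of poles\<close>

lemma not_Ints_if_small:
  assumes "u \<noteq> 0" "norm (u::complex) < 1/2"
  shows "u \<notin> \<int>"
proof
  assume "u \<in> \<int>"
  then obtain i where "u = of_int i" by (elim Ints_cases)
  with assms show False by (simp flip: of_int_abs)
qed

text \<open>The Lerch factors are regular at 0, so the pole comes from (1/u + regular) / u^q. The
  part 1/u^(q+1) yields the first convolution, later the fourth term; the regular part of the
  lattice kernel yields the double sum, later the fifth.\<close>

lemma residue_euler_kernel_0:
  assumes "\<bar>\<sigma>1\<bar> = 1" "\<bar>\<sigma>2\<bar> = 1" "\<bar>\<tau>\<bar> = 1" "m \<ge> 1" "p \<ge> 1" "q \<ge> 1"
  defines "A \<equiv> (\<lambda>i. real ((m + i - 1) choose i) * (\<sigma>1 * alt_t (m + i) \<sigma>1))"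
    and "B \<equiv> (\<lambda>i. real ((p + i - 1) choose i) * (\<sigma>2 * alt_t (p + i) \<sigma>2))"
    and "\<psi> \<equiv> (\<lambda>i. ((-1) ^ i - 1) * alt_zeta (i + 1) \<tau>)"
  shows "residue (euler_kernel m p q \<sigma>1 \<sigma>2 \<tau>) 0
     = of_real ((\<Sum>i=0..q. A i * B (q - i))
         + (\<Sum>k=0..q-1. \<psi> k * (\<Sum>i=0..q-1-k. A i * B (q - 1 - k - i))))"
proof -
  have half: "1/2 \<notin> (\<int>\<^sub>\<le>\<^sub>0 :: complex set)" by (rule not_nonpos_Ints_if_Re_pos) simp
  let ?f = "\<lambda>r :: nat \<Rightarrow> real. Abs_fps (\<lambda>i. complex_of_real (r i))"
  have eA: "(\<lambda>u. lerch \<sigma>1 m (1/2 - u)) has_fps_expansion ?f A"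
    using has_fps_expansion_lerch_minus[OF assms(1,4) half] assms(1,4) lerch_at_half[OF assms(1)]
    by (simp add: A_def)
  have eB: "(\<lambda>u. lerch \<sigma>2 p (1/2 - u)) has_fps_expansion ?f B"
    using has_fps_expansion_lerch_minus[OF assms(2,5) half] assms(2,5) lerch_at_half[OF assms(2)]
    by (simp add: B_def)
  have e\<psi>: "lattice_kernel_reg \<tau> has_fps_expansion ?f \<psi>"
    using has_fps_expansion_lattice_kernel_reg[OF assms(3)] by (simp add: \<psi>_def)
  have "residue (euler_kernel m p q \<sigma>1 \<sigma>2 \<tau>) 0 =
      1 * 1 * fps_nth (?f A * ?f B) (1 + q - 1) + 1 * fps_nth (?f A * ?f B * 0) (1 - 1)
      + 1 * fps_nth (?f A * ?f B * ?f \<psi>) (q - 1)"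
  proof (rule residue_two_poles[where P = "\<lambda>u. lerch \<sigma>1 m (1/2 - u) * lerch \<sigma>2 p (1/2 - u)"
        and A = "lattice_kernel_reg \<tau>" and B = "\<lambda>_. 0"])
    fix u :: complex assume "u \<noteq> 0" "norm u < 1/2"
    then show "euler_kernel m p q \<sigma>1 \<sigma>2 \<tau> (0 + u) = lerch \<sigma>1 m (1/2 - u) * lerch \<sigma>2 p (1/2 - u)
        * (1 / u ^ 1 + lattice_kernel_reg \<tau> u) * (1 / u ^ q + 0)"
      using lattice_kernel_eq_pole_plus_reg[OF assms(3) not_Ints_if_small]
      by (simp add: euler_kernel_def)
  qed (rule eA eB e\<psi> has_fps_expansion_mult has_fps_expansion_0 order.refl assms(6))+
  also have "?f A * ?f B * ?f \<psi> = ?f \<psi> * (?f A * ?f B)" by (simp add: mult_ac)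
  finally show ?thesis using assms(6) by (simp add: fps_mult_nth)
qed

text \<open>The Lerch arguments are half-integers and hence away from poles, so only the simple pole
  of the lattice kernel contributes; quasi-periodicity gives it the residue \<tau>^n.\<close>

lemma residue_euler_kernel_pos:
  assumes "\<bar>\<sigma>1\<bar> = 1" "\<bar>\<sigma>2\<bar> = 1" "\<bar>\<tau>\<bar> = 1" "m \<ge> 1" "p \<ge> 1" "q \<ge> 1" "n \<ge> 1"
  shows "residue (euler_kernel m p q \<sigma>1 \<sigma>2 \<tau>) (of_nat n)
     = of_real (\<tau> ^ n * (\<sigma>1 ^ n * \<sigma>1 * (alt_t m \<sigma>1 + (-1) ^ m * h_sum m \<sigma>1 n))
         * (\<sigma>2 ^ n * \<sigma>2 * (alt_t p \<sigma>2 + (-1) ^ p * h_sum p \<sigma>2 n)) / real n ^ q)"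
proof -
  let ?z = "1/2 - of_nat n :: complex"
  have n0: "of_nat n \<noteq> (0::complex)" using assms by simp
  let ?S = "Abs_fps (\<lambda>i. (-1) ^ i * of_nat ((q + i - 1) choose i) * (1 / (of_nat n :: complex) ^ (q + i)))"
  let ?A = "\<lambda>\<sigma> m. Abs_fps (\<lambda>i. of_nat ((m + i - 1) choose i) * lerch \<sigma> (m + i) ?z)"
  note z = not_nonpos_Ints_half(1)[of n]
  have "residue (euler_kernel m p q \<sigma>1 \<sigma>2 \<tau>) (of_nat n) =
      1 * 0 * fps_nth (fps_const (of_real (\<tau> ^ n)) * (?A \<sigma>1 m * ?A \<sigma>2 p * ?S)) (1 + 1 - 1)
      + 1 * fps_nth (fps_const (of_real (\<tau> ^ n)) * (?A \<sigma>1 m * ?A \<sigma>2 p * ?S) * 1) (1 - 1)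
      + 0 * fps_nth (fps_const (of_real (\<tau> ^ n)) * (?A \<sigma>1 m * ?A \<sigma>2 p * ?S)
          * Abs_fps (\<lambda>i. of_real (((-1) ^ i - 1) * alt_zeta (i + 1) \<tau>))) (1 - 1)"
  proof (rule residue_two_poles[where A = "lattice_kernel_reg \<tau>" and B = "\<lambda>_. 1" and
        P = "\<lambda>u. of_real (\<tau> ^ n) * (lerch \<sigma>1 m (?z - u) * lerch \<sigma>2 p (?z - u) * (1 / (of_nat n + u) ^ q))"])
    show "(\<lambda>u. of_real (\<tau> ^ n) * (lerch \<sigma>1 m (?z - u) * lerch \<sigma>2 p (?z - u) * (1 / (of_nat n + u) ^ q)))
        has_fps_expansion fps_const (of_real (\<tau> ^ n)) * (?A \<sigma>1 m * ?A \<sigma>2 p * ?S)"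
      by (intro has_fps_expansion_cmult_left has_fps_expansion_mult has_fps_expansion_lerch_minus
          has_fps_expansion_inverse_power assms z n0)
    fix u :: complex assume u: "u \<noteq> 0" "norm u < 1/2"
    have e: "1/2 - (of_nat n + u) = ?z - u" by simp
    have "lattice_kernel \<tau> (of_nat n + u) = of_real (\<tau> ^ n) * (1 / u + lattice_kernel_reg \<tau> u)"
      using lattice_kernel_add_of_nat[OF assms(3) not_Ints_if_small[OF u], of n]
        lattice_kernel_eq_pole_plus_reg[OF assms(3) not_Ints_if_small[OF u]]
      by (simp add: add.commute)
    then show "euler_kernel m p q \<sigma>1 \<sigma>2 \<tau> (of_nat n + u) = of_real (\<tau> ^ n)
        * (lerch \<sigma>1 m (?z - u) * lerch \<sigma>2 p (?z - u) * (1 / (of_nat n + u) ^ q))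
        * (1 / u ^ 1 + lattice_kernel_reg \<tau> u) * (0 / u ^ 1 + 1)"
      unfolding euler_kernel_def e by simp
  qed (rule has_fps_expansion_lattice_kernel_reg[OF assms(3)] has_fps_expansion_1 order.refl)+
  also have "\<dots> = of_real (\<tau> ^ n) * (lerch \<sigma>1 m ?z * lerch \<sigma>2 p ?z * (1 / of_nat n ^ q))"
    by simp
  finally show ?thesis using assms by (simp add: lerch_half_minus_of_nat mult.assoc)
qed

lemma residue_euler_kernel_neg:
  assumes "\<bar>\<sigma>1\<bar> = 1" "\<bar>\<sigma>2\<bar> = 1" "\<bar>\<tau>\<bar> = 1" "m \<ge> 1" "p \<ge> 1" "q \<ge> 1" "n \<ge> 1"
  shows "residue (euler_kernel m p q \<sigma>1 \<sigma>2 \<tau>) (- of_nat n)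
     = of_real (\<tau> ^ n * (\<sigma>1 ^ n * (\<sigma>1 * alt_t m \<sigma>1 - h_sum m \<sigma>1 n))
         * (\<sigma>2 ^ n * (\<sigma>2 * alt_t p \<sigma>2 - h_sum p \<sigma>2 n)) * ((-1) ^ q / real n ^ q))"
proof -
  let ?z = "1/2 + of_nat n :: complex"
  have n0: "- of_nat n \<noteq> (0::complex)" using assms by simp
  let ?S = "Abs_fps (\<lambda>i. (-1) ^ i * of_nat ((q + i - 1) choose i) * (1 / (- of_nat n :: complex) ^ (q + i)))"
  let ?A = "\<lambda>\<sigma> m. Abs_fps (\<lambda>i. of_nat ((m + i - 1) choose i) * lerch \<sigma> (m + i) ?z)"
  note z = not_nonpos_Ints_half(2)[of n]
  have "residue (euler_kernel m p q \<sigma>1 \<sigma>2 \<tau>) (- of_nat n) =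
      1 * 0 * fps_nth (fps_const (of_real (\<tau> ^ n)) * (?A \<sigma>1 m * ?A \<sigma>2 p * ?S)) (1 + 1 - 1)
      + 1 * fps_nth (fps_const (of_real (\<tau> ^ n)) * (?A \<sigma>1 m * ?A \<sigma>2 p * ?S) * 1) (1 - 1)
      + 0 * fps_nth (fps_const (of_real (\<tau> ^ n)) * (?A \<sigma>1 m * ?A \<sigma>2 p * ?S)
          * Abs_fps (\<lambda>i. of_real (((-1) ^ i - 1) * alt_zeta (i + 1) \<tau>))) (1 - 1)"
  proof (rule residue_two_poles[where A = "lattice_kernel_reg \<tau>" and B = "\<lambda>_. 1" and
        P = "\<lambda>u. of_real (\<tau> ^ n) * (lerch \<sigma>1 m (?z - u) * lerch \<sigma>2 p (?z - u) * (1 / (- of_nat n + u) ^ q))"])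
    show "(\<lambda>u. of_real (\<tau> ^ n) * (lerch \<sigma>1 m (?z - u) * lerch \<sigma>2 p (?z - u) * (1 / (- of_nat n + u) ^ q)))
        has_fps_expansion fps_const (of_real (\<tau> ^ n)) * (?A \<sigma>1 m * ?A \<sigma>2 p * ?S)"
      by (intro has_fps_expansion_cmult_left has_fps_expansion_mult has_fps_expansion_lerch_minus
          has_fps_expansion_inverse_power assms z n0)
    fix u :: complex assume u: "u \<noteq> 0" "norm u < 1/2"
    have e: "1/2 - (- of_nat n + u) = ?z - u" by simp
    have "lattice_kernel \<tau> (- of_nat n + u) = of_real (\<tau> ^ n) * (1 / u + lattice_kernel_reg \<tau> u)"
      using lattice_kernel_diff_of_nat[OF assms(3) not_Ints_if_small[OF u], of n]
        lattice_kernel_eq_pole_plus_reg[OF assms(3) not_Ints_if_small[OF u]]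
      by simp
    then show "euler_kernel m p q \<sigma>1 \<sigma>2 \<tau> (- of_nat n + u) = of_real (\<tau> ^ n)
        * (lerch \<sigma>1 m (?z - u) * lerch \<sigma>2 p (?z - u) * (1 / (- of_nat n + u) ^ q))
        * (1 / u ^ 1 + lattice_kernel_reg \<tau> u) * (0 / u ^ 1 + 1)"
      unfolding euler_kernel_def e by simp
  qed (rule has_fps_expansion_lattice_kernel_reg[OF assms(3)] has_fps_expansion_1 order.refl)+
  also have "\<dots> = of_real (\<tau> ^ n) * (lerch \<sigma>1 m ?z * lerch \<sigma>2 p ?z * (1 / (- of_nat n) ^ q))"
    by simp
  also have "1 / (- of_nat n) ^ q = complex_of_real ((-1) ^ q / real n ^ q)"
    by (cases "even q") auto
  finally show ?thesis using assms by (simp add: lerch_half_plus_of_nat mult.assoc)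
qed

text \<open>Both Lerch arguments reach their pole -b here, while the lattice kernel is regular.
  \<open>\<phi>\<close>, \<open>S\<close> and \<open>T\<close> are the Taylor coefficients of the
  lattice kernel, of 1/s^q and of the regular parts. The product of the two poles leads to the
  second term; each pole times the regular part of the other factor leads to the third.\<close>

lemma residue_euler_kernel_half:
  fixes b :: nat
  assumes "\<bar>\<sigma>1\<bar> = 1" "\<bar>\<sigma>2\<bar> = 1" "\<bar>\<tau>\<bar> = 1" "m \<ge> 1" "p \<ge> 1" "q \<ge> 1"
  defines "\<phi> \<equiv> (\<lambda>k. - parity_delta \<tau> k * alt_t (k + 1) \<tau>)"
    and "S \<equiv> (\<lambda>l. (-1) ^ l * real ((q + l - 1) choose l) / (real b + 1/2) ^ (q + l))"
    and "T \<equiv> (\<lambda>\<sigma> m i. real ((m + i - 1) choose i)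
               * (alt_zeta (m + i) \<sigma> + (-1) ^ (m + i) * \<sigma> * H_sum (m + i) \<sigma> b))"
  shows "residue (euler_kernel m p q \<sigma>1 \<sigma>2 \<tau>) (of_nat b + 1/2)
     = of_real (\<tau> ^ b * \<sigma>1 ^ b * \<sigma>2 ^ b * (
         (-1) ^ (m + p) * (\<Sum>k=0..m+p-1. \<phi> k * S (m + p - 1 - k))
         + (-1) ^ m * (\<Sum>i=0..m-1. T \<sigma>2 p i * (\<Sum>k=0..m-1-i. \<phi> k * S (m - 1 - i - k)))
         + (-1) ^ p * (\<Sum>i=0..p-1. T \<sigma>1 m i * (\<Sum>k=0..p-1-i. \<phi> k * S (p - 1 - i - k)))))"
proof -
  let ?z = "of_nat b + 1/2 :: complex"
  have z: "?z = of_real (real b + 1/2)" "real b + 1/2 \<noteq> 0" by auto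
  then have z0: "?z \<noteq> 0" by (metis of_real_eq_0_iff)
  let ?f = "\<lambda>r :: nat \<Rightarrow> real. Abs_fps (\<lambda>i. complex_of_real (r i))"
  have eS: "(\<lambda>u. 1 / (?z + u) ^ q) has_fps_expansion ?f S"
    using has_fps_expansion_inverse_power[OF z0 assms(6)] unfolding z(1) S_def by simp
  have eT: "(\<lambda>u. lerch_reg \<sigma> b m (- of_nat b - u)) has_fps_expansion fps_const (of_real (\<sigma> ^ b)) * ?f (T \<sigma> m)"
    if "\<bar>\<sigma>\<bar> = 1" "m \<ge> 1" for \<sigma> m
  proof -
    have "fps_const (of_real (\<sigma> ^ b)) * ?f (T \<sigma> m) = Abs_fps (\<lambda>i. of_real (\<sigma> ^ b * (real ((m + i - 1) choose i)
             * (alt_zeta (m + i) \<sigma> + (-1) ^ (m + i) * \<sigma> * H_sum (m + i) \<sigma> b))))"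
      by (simp add: T_def fps_eq_iff)
    then show ?thesis using has_fps_expansion_lerch_reg[OF that, of b] by simp
  qed
  have e\<phi>: "(\<lambda>u. lattice_kernel \<tau> (1/2 + u)) has_fps_expansion ?f \<phi>"
    using has_fps_expansion_lattice_kernel_half[OF assms(3)] unfolding \<phi>_def .
  \<comment> \<open>The local variable enters the Lerch argument with a minus sign, and 1/(-u)^m
    supplies (-1)^m.\<close>
  have pole: "lerch \<sigma> m (- of_nat b - u) = of_real ((-1) ^ m * \<sigma> ^ b) / u ^ m + lerch_reg \<sigma> b m (- of_nat b - u)"
    if "\<bar>\<sigma>\<bar> = 1" "m \<ge> 1" "u \<notin> \<int>" for \<sigma> m u
  proof -
    have "- of_nat b - u \<notin> \<int>\<^sub>\<le>\<^sub>0"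
    proof
      assume "- of_nat b - u \<in> \<int>\<^sub>\<le>\<^sub>0"
      then have "- of_nat b - (- of_nat b - u) \<in> \<int>" by (intro Ints_diff nonpos_Ints_Int) auto
      with that show False by simp
    qed
    moreover have "x / (- u) ^ m = (-1) ^ m * x / u ^ m" for x
      by (cases "even m") auto
    ultimately show ?thesis using lerch_eq_pole_plus_reg[OF that(1,2), of _ b] by simp
  qed
  have nX: "fps_nth (?f \<phi> * ?f S) n = of_real (\<Sum>k=0..n. \<phi> k * S (n - k))" for n
    by (simp add: fps_mult_nth)
  have nT: "fps_nth (?f r * (?f \<phi> * ?f S)) n = of_real (\<Sum>i=0..n. r i * (\<Sum>k=0..n-i. \<phi> k * S (n - i - k)))" for r n
    unfolding fps_mult_nth[of "?f r"] nX by simp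
  have alg: "((-1) ^ m * s1) * ((-1) ^ p * s2) * (t * X) + ((-1) ^ m * s1) * ((t * s2) * Y) + ((-1) ^ p * s2) * ((t * s1) * Z)
     = t * s1 * s2 * ((-1) ^ (m + p) * X + (-1) ^ m * Y + (-1) ^ p * Z)" for s1 s2 t X Y Z :: real
    by (simp add: power_add algebra_simps)
  let ?P = "fps_const (of_real (\<tau> ^ b)) * (?f \<phi> * ?f S)"
  have "residue (euler_kernel m p q \<sigma>1 \<sigma>2 \<tau>) ?z =
      of_real ((-1) ^ m * \<sigma>1 ^ b) * of_real ((-1) ^ p * \<sigma>2 ^ b) * fps_nth ?P (m + p - 1)
      + of_real ((-1) ^ m * \<sigma>1 ^ b) * fps_nth (?P * (fps_const (of_real (\<sigma>2 ^ b)) * ?f (T \<sigma>2 p))) (m - 1)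
      + of_real ((-1) ^ p * \<sigma>2 ^ b) * fps_nth (?P * (fps_const (of_real (\<sigma>1 ^ b)) * ?f (T \<sigma>1 m))) (p - 1)"
  proof (rule residue_two_poles[where A = "\<lambda>u. lerch_reg \<sigma>1 b m (- of_nat b - u)"
        and B = "\<lambda>u. lerch_reg \<sigma>2 b p (- of_nat b - u)"
        and P = "\<lambda>u. of_real (\<tau> ^ b) * (lattice_kernel \<tau> (1/2 + u) * (1 / (?z + u) ^ q))"])
    fix u :: complex assume u: "u \<noteq> 0" "norm u < 1/2"
    have uZ: "u \<notin> \<int>" by (rule not_Ints_if_small[OF u])
    have e: "1/2 - (?z + u) = - of_nat b - u" "?z + u = 1/2 + u + of_nat b" by auto
    show "euler_kernel m p q \<sigma>1 \<sigma>2 \<tau> (?z + u) =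
      of_real (\<tau> ^ b) * (lattice_kernel \<tau> (1/2 + u) * (1 / (?z + u) ^ q))
      * (of_real ((-1) ^ m * \<sigma>1 ^ b) / u ^ m + lerch_reg \<sigma>1 b m (- of_nat b - u))
      * (of_real ((-1) ^ p * \<sigma>2 ^ b) / u ^ p + lerch_reg \<sigma>2 b p (- of_nat b - u))"
    proof -
      have "1/2 + u \<notin> \<int>"
      proof
        assume "1/2 + u \<in> \<int>"
        then obtain i :: int where i: "1/2 + u = of_int i" by (elim Ints_cases)
        have "\<bar>Re u\<bar> < 1/2" using abs_Re_le_cmod[of u] u by linarith
        moreover have "Re u = of_int i - 1/2" using arg_cong[OF i, of Re] by simp
        ultimately have "(0::real) < of_int i" "of_int i < (1::real)" by linarith+
        then show False by simp
      qed
      from lattice_kernel_add_of_nat[OF assms(3) this, of b]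
      have "lattice_kernel \<tau> (?z + u) = of_real (\<tau> ^ b) * lattice_kernel \<tau> (1/2 + u)"
        unfolding e(2) .
      then show ?thesis unfolding euler_kernel_def e(1) pole[OF assms(1,4) uZ] pole[OF assms(2,5) uZ] by simp
    qed
  qed (rule eS eT e\<phi> has_fps_expansion_cmult_left has_fps_expansion_mult assms(1-6))+
  also have "?P * (fps_const (of_real (\<sigma>2 ^ b)) * ?f (T \<sigma>2 p))
      = fps_const (of_real (\<tau> ^ b * \<sigma>2 ^ b)) * (?f (T \<sigma>2 p) * (?f \<phi> * ?f S))"
    by (simp add: mult_ac)
  also have "?P * (fps_const (of_real (\<sigma>1 ^ b)) * ?f (T \<sigma>1 m))
      = fps_const (of_real (\<tau> ^ b * \<sigma>1 ^ b)) * (?f (T \<sigma>1 m) * (?f \<phi> * ?f S))"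
    by (simp add: mult_ac)
  finally show ?thesis
    unfolding fps_mult_left_const_nth nX nT
    by (simp only: of_real_mult[symmetric] of_real_add[symmetric] alg)
qed

section \<open>Convergence of the Euler sums\<close>

text \<open>
  A growth class that is closed under products and contains the harmonic sums; for exponents below
  \<open>1\<close> it gives convergence even of the conditionally convergent series with \<open>q = 1\<close>.
\<close>

definition slow :: "real \<Rightarrow> (nat \<Rightarrow> real) \<Rightarrow> bool" where
  "slow a g \<longleftrightarrow> (\<exists>C. \<forall>n. \<bar>g n\<bar> \<le> C * real (Suc n) powr a
     \<and> \<bar>g (Suc n) - g n\<bar> \<le> C * real (Suc n) powr (a - 1))"

lemma slowI:
  assumes "\<And>n. \<bar>g n\<bar> \<le> C * real (Suc n) powr a"
    and "\<And>n. \<bar>g (Suc n) - g n\<bar> \<le> D * real (Suc n) powr (a - 1)"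
  shows "slow a g"
  unfolding slow_def
proof (intro exI[of _ "max C D"] allI conjI)
  fix n
  show "\<bar>g n\<bar> \<le> max C D * real (Suc n) powr a"
    by (rule order.trans[OF assms(1)]) (auto intro!: mult_right_mono)
  show "\<bar>g (Suc n) - g n\<bar> \<le> max C D * real (Suc n) powr (a - 1)"
    by (rule order.trans[OF assms(2)]) (auto intro!: mult_right_mono)
qed

text \<open>Discrete product rule. Its shifted value g(n+1) costs only the factor 2^b, as (n+2)^b
  \<le> (2(n+1))^b for b \<ge> 0.\<close>

lemma slow_mult:
  assumes "slow a f" "slow b g" "b \<ge> 0"
  shows "slow (a + b) (\<lambda>n. f n * g n)"
proof -
  obtain C where C: "\<And>n. \<bar>f n\<bar> \<le> C * real (Suc n) powr a"
    "\<And>n. \<bar>f (Suc n) - f n\<bar> \<le> C * real (Suc n) powr (a - 1)" using assms(1) by (auto simp: slow_def)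
  obtain D where D: "\<And>n. \<bar>g n\<bar> \<le> D * real (Suc n) powr b"
    "\<And>n. \<bar>g (Suc n) - g n\<bar> \<le> D * real (Suc n) powr (b - 1)" using assms(2) by (auto simp: slow_def)
  have C0: "C \<ge> 0" and D0: "D \<ge> 0" using C(1)[of 0] D(1)[of 0] by auto
  show ?thesis
  proof (rule slowI)
    fix n
    have "\<bar>f n * g n\<bar> \<le> (C * real (Suc n) powr a) * (D * real (Suc n) powr b)"
      unfolding abs_mult by (intro mult_mono C D) (use C0 in auto)
    then show "\<bar>f n * g n\<bar> \<le> (C * D) * real (Suc n) powr (a + b)" by (simp add: powr_add mult_ac)
    have "\<bar>g (Suc n)\<bar> \<le> D * real (Suc (Suc n)) powr b" by (rule D)
    also have "\<dots> \<le> D * (2 * real (Suc n)) powr b"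
      using assms(3) D0 by (intro mult_left_mono powr_mono2) auto
    also have "(2 * real (Suc n)) powr b = 2 powr b * real (Suc n) powr b" by (rule powr_mult)
    finally have gS: "\<bar>g (Suc n)\<bar> \<le> D * (2 powr b * real (Suc n) powr b)" .
    have "f (Suc n) * g (Suc n) - f n * g n = (f (Suc n) - f n) * g (Suc n) + f n * (g (Suc n) - g n)"
      by (simp add: algebra_simps)
    then have "\<bar>f (Suc n) * g (Suc n) - f n * g n\<bar> \<le> \<bar>f (Suc n) - f n\<bar> * \<bar>g (Suc n)\<bar> + \<bar>f n\<bar> * \<bar>g (Suc n) - g n\<bar>"
      by (metis abs_mult abs_triangle_ineq)
    also have "\<dots> \<le> (C * real (Suc n) powr (a - 1)) * (D * (2 powr b * real (Suc n) powr b))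
        + (C * real (Suc n) powr a) * (D * real (Suc n) powr (b - 1))"
      by (intro add_mono mult_mono C D gS) (use C0 in auto)
    also have "\<dots> = (C * D * (2 powr b + 1)) * real (Suc n) powr (a + b - 1)"
      by (simp add: powr_add powr_diff algebra_simps add_divide_distrib)
    finally show "\<bar>f (Suc n) * g (Suc n) - f n * g n\<bar> \<le> (C * D * (2 powr b + 1)) * real (Suc n) powr (a + b - 1)" .
  qed
qed

lemma harm_le_ln: "harm (Suc n) \<le> 1 + ln (real (Suc n))"
  using decseqD[OF decseq_harm_diff_ln, of 0 n] by (simp add: harm_expand)

text \<open>From ln x = 4 ln (x^(1/4)) < 4 x^(1/4). With exponent 1/4 a product of two harmonic sums
  has exponent 1/2, still below 1.\<close>

lemma harm_le_powr: "harm (Suc n) \<le> 5 * real (Suc n) powr (1/4)"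
proof -
  have "harm (Suc n) \<le> 1 + ln (real (Suc n))" by (rule harm_le_ln)
  also have "ln (real (Suc n)) = 4 * ln (real (Suc n) powr (1/4))" by (simp add: ln_powr)
  also have "ln (real (Suc n) powr (1/4)) \<le> real (Suc n) powr (1/4)"
    using ln_le_minus_one[of "real (Suc n) powr (1/4)"] by simp
  finally show ?thesis using ge_one_powr_ge_zero[of "real (Suc n)" "1/4"] by simp
qed

lemma slow_partial_sums:
  assumes "\<And>n. \<bar>f n\<bar> \<le> C / real (Suc n)"
  shows "slow (1/4) (\<lambda>n. \<Sum>k<n. f k)"
proof -
  have C0: "C \<ge> 0" using assms[of 0] by simp
  show ?thesis
  proof (rule slowI)
    fix n
    have "\<bar>\<Sum>k<n. f k\<bar> \<le> (\<Sum>k<n. C / real (Suc k))"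
      by (rule order.trans[OF sum_abs]) (intro sum_mono assms)
    also have "\<dots> = C * harm n" by (simp add: harm_altdef sum_distrib_left divide_inverse)
    also have "\<dots> \<le> C * harm (Suc n)" using C0 by (intro mult_left_mono harm_mono) auto
    also have "\<dots> \<le> C * (5 * real (Suc n) powr (1/4))" by (intro mult_left_mono harm_le_powr C0)
    finally show "\<bar>\<Sum>k<n. f k\<bar> \<le> (C * 5) * real (Suc n) powr (1/4)" by simp
    have "1 / real (Suc n) = real (Suc n) powr (-1)" by (simp add: powr_minus_divide)
    also have "\<dots> \<le> real (Suc n) powr (1/4 - 1)" by (intro powr_mono) auto
    finally have "C / real (Suc n) \<le> C * real (Suc n) powr (1/4 - 1)"
      using C0 mult_left_mono by fastforce
    then show "\<bar>(\<Sum>k<Suc n. f k) - (\<Sum>k<n. f k)\<bar> \<le> C * real (Suc n) powr (1/4 - 1)"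
      using assms[of n] by simp
  qed
qed

lemma slow_Suc:
  assumes "slow a g" "a \<ge> 0" "a \<le> 1" shows "slow a (\<lambda>n. g (Suc n))"
proof -
  obtain C where C: "\<And>n. \<bar>g n\<bar> \<le> C * real (Suc n) powr a"
    "\<And>n. \<bar>g (Suc n) - g n\<bar> \<le> C * real (Suc n) powr (a - 1)" using assms(1) by (auto simp: slow_def)
  have C0: "C \<ge> 0" using C(1)[of 0] by auto
  show ?thesis
  proof (rule slowI)
    fix n
    have "\<bar>g (Suc n)\<bar> \<le> C * real (Suc (Suc n)) powr a" by (rule C)
    also have "\<dots> \<le> C * (2 * real (Suc n)) powr a"
      using assms C0 by (intro mult_left_mono powr_mono2) auto
    also have "\<dots> = (C * 2 powr a) * real (Suc n) powr a" by (simp only: powr_mult mult.assoc)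
    finally show "\<bar>g (Suc n)\<bar> \<le> (C * 2 powr a) * real (Suc n) powr a" .
    have "\<bar>g (Suc (Suc n)) - g (Suc n)\<bar> \<le> C * real (Suc (Suc n)) powr (a - 1)" by (rule C)
    also have "\<dots> \<le> C * real (Suc n) powr (a - 1)"
      using assms C0 by (intro mult_left_mono powr_mono2') auto
    finally show "\<bar>g (Suc (Suc n)) - g (Suc n)\<bar> \<le> C * real (Suc n) powr (a - 1)" .
  qed
qed

lemma slow_const: "slow 0 (\<lambda>_. c)"
  by (rule slowI[of _ "\<bar>c\<bar>" _ 0]) auto

text \<open>Lets denominators n + 1/2 be replaced by n + 1: the ratio is absorbed into the slowly
  growing numerator without raising its exponent.\<close>

lemma slow_half_ratio: "slow 0 (\<lambda>n. (real (Suc n) / (real n + 1/2)) ^ q)"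
proof (induction q)
  case 0
  show ?case using slow_const[of 1] by simp
next
  case (Suc q)
  have "slow 0 (\<lambda>n. real (Suc n) / (real n + 1/2))"
  proof (rule slowI)
    fix n
    show "\<bar>real (Suc n) / (real n + 1/2)\<bar> \<le> 2 * real (Suc n) powr 0"
      by (simp add: field_simps)
    have "real (Suc (Suc n)) / (real (Suc n) + 1/2) - real (Suc n) / (real n + 1/2)
       = - (1/2) / ((real (Suc n) + 1/2) * (real n + 1/2))"
      by (simp add: divide_simps) (simp add: algebra_simps)
    then have "\<bar>real (Suc (Suc n)) / (real (Suc n) + 1/2) - real (Suc n) / (real n + 1/2)\<bar>
       = (1/2) / ((real (Suc n) + 1/2) * (real n + 1/2))" by (simp add: abs_mult)
    also have "\<dots> \<le> (1/2) / (real (Suc n) * (1/2))"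
      by (intro divide_left_mono mult_mono) auto
    also have "\<dots> = 1 * real (Suc n) powr (0 - 1)" by (simp add: powr_minus_divide)
    finally show "\<bar>real (Suc (Suc n)) / (real (Suc n) + 1/2) - real (Suc n) / (real n + 1/2)\<bar>
       \<le> 1 * real (Suc n) powr (0 - 1)" .
  qed
  from slow_mult[OF this Suc] show ?case by simp
qed

text \<open>Abel summation. The Leibniz test would ask for monotonicity, which is not at hand when
  the harmonic sums themselves alternate.\<close>

lemma summable_alternating_bounded_variation:
  fixes a :: "nat \<Rightarrow> real"
  assumes "a \<longlonglongrightarrow> 0" "summable (\<lambda>n. \<bar>a (Suc n) - a n\<bar>)"
  shows "summable (\<lambda>n. (-1) ^ n * a n)"
proof -
  \<comment> \<open>\<open>S n\<close> is the sum of (-1)^k over k < n.\<close>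
  define S where "S = (\<lambda>n::nat. if even n then 0 else 1 :: real)"
  have partial: "(\<Sum>k<n. (-1) ^ k * a k) = S n * a n + (\<Sum>k<n. S (Suc k) * (a k - a (Suc k)))" for n
    by (induction n) (auto simp: S_def algebra_simps)
  have "summable (\<lambda>k. S (Suc k) * (a k - a (Suc k)))"
    by (rule summable_comparison_test[OF _ assms(2)]) (auto simp: S_def abs_minus_commute intro!: exI[of _ 0])
  then have "(\<lambda>n. \<Sum>k<n. S (Suc k) * (a k - a (Suc k))) \<longlonglongrightarrow> (\<Sum>k. S (Suc k) * (a k - a (Suc k)))"
    by (rule summable_LIMSEQ)
  moreover have "(\<lambda>n. S n * a n) \<longlonglongrightarrow> 0"
    by (rule Lim_null_comparison[OF _ tendsto_rabs_zero[OF assms(1)]])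
       (auto simp: S_def intro!: always_eventually)
  ultimately have "(\<lambda>n. \<Sum>k<n. (-1) ^ k * a k) \<longlonglongrightarrow> 0 + (\<Sum>k. S (Suc k) * (a k - a (Suc k)))"
    unfolding partial by (intro tendsto_add)
  then show ?thesis by (auto simp: summable_def sums_def)
qed

text \<open>For q \<ge> 2 the terms are O(n^(a-2)). For q = 1 the sign must be -1, and now the
  differences of g(n)/(n+1) are O(n^(a-2)), so bounded variation applies.\<close>

lemma summable_slow:
  assumes "\<bar>\<sigma>\<bar> = 1" "q \<ge> 1" "(q, \<sigma>) \<noteq> (1, 1)" "slow a g" "a < 1"
  shows "summable (\<lambda>n. \<sigma> ^ n * g n / real (Suc n) ^ q)"
proof -
  obtain C where C: "\<And>n. \<bar>g n\<bar> \<le> C * real (Suc n) powr a"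
    "\<And>n. \<bar>g (Suc n) - g n\<bar> \<le> C * real (Suc n) powr (a - 1)" using assms(4) by (auto simp: slow_def)
  have C0: "C \<ge> 0" using C(1)[of 0] by auto
  have sp: "summable (\<lambda>n. D * real (Suc n) powr (a - 2))" for D
    using assms(5) summable_Suc_iff[of "\<lambda>n. real n powr (a - 2)"]
    by (intro summable_mult) (simp add: summable_real_powr_iff)
  show ?thesis
  proof (cases "q = 1")
    case False
    then have q: "q \<ge> 2" using assms by simp
    show ?thesis
    proof (rule summable_comparison_test[OF _ sp[of C]], intro exI[of _ 0] allI impI)
      fix n
      have "norm (\<sigma> ^ n * g n / real (Suc n) ^ q) = \<bar>g n\<bar> / real (Suc n) ^ q"
        using assms(1) by (simp add: abs_mult power_abs)
      also have "\<dots> \<le> (C * real (Suc n) powr a) / real (Suc n) ^ 2"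
        by (intro frac_le C power_increasing q) (use C0 in auto)
      also have "\<dots> = C * real (Suc n) powr (a - 2)" by (simp add: powr_diff)
      finally show "norm (\<sigma> ^ n * g n / real (Suc n) ^ q) \<le> C * real (Suc n) powr (a - 2)" .
    qed
  next
    case True
    then have \<sigma>: "\<sigma> = -1" using assms by (auto simp: abs_if split: if_splits)
    define b where "b = (\<lambda>n. g n / real (Suc n))"
    have "summable (\<lambda>n. (-1) ^ n * b n)"
    proof (rule summable_alternating_bounded_variation)
      have "(\<lambda>n. C * real (Suc n) powr (a - 1)) \<longlonglongrightarrow> 0" using assms(5) by real_asymp
      moreover have "norm (b n) \<le> C * real (Suc n) powr (a - 1)" for n
        using C(1)[of n] by (simp add: b_def powr_diff divide_right_mono)
      ultimately show "b \<longlonglongrightarrow> 0" by (intro Lim_null_comparison[of b]) (auto intro!: always_eventually)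
      show "summable (\<lambda>n. \<bar>b (Suc n) - b n\<bar>)"
      proof (rule summable_comparison_test[OF _ sp[of "2 * C"]], intro exI[of _ 0] allI impI)
        fix n
        have "b (Suc n) - b n = (g (Suc n) - g n) / real (Suc (Suc n)) - g n / (real (Suc n) * real (Suc (Suc n)))"
          by (simp add: b_def divide_simps) (simp add: algebra_simps)
        then have "\<bar>b (Suc n) - b n\<bar> \<le> \<bar>(g (Suc n) - g n) / real (Suc (Suc n))\<bar> + \<bar>g n / (real (Suc n) * real (Suc (Suc n)))\<bar>"
          by (metis abs_triangle_ineq4)
        also have "\<dots> = \<bar>g (Suc n) - g n\<bar> / real (Suc (Suc n)) + \<bar>g n\<bar> / (real (Suc n) * real (Suc (Suc n)))"
          by (simp add: abs_mult)
        also have "\<dots> \<le> (C * real (Suc n) powr (a - 1)) / real (Suc n) + (C * real (Suc n) powr a) / (real (Suc n) * real (Suc n))"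
          by (intro add_mono frac_le C mult_mono) (use C0 in auto)
        also have "\<dots> = 2 * C * real (Suc n) powr (a - 2)"
          by (simp add: powr_diff power2_eq_square)
        finally show "norm \<bar>b (Suc n) - b n\<bar> \<le> 2 * C * real (Suc n) powr (a - 2)" by simp
      qed
    qed
    then show ?thesis using True \<sigma> by (simp add: b_def)
  qed
qed

lemma slow_h_sum:
  assumes "\<bar>\<sigma>\<bar> = 1" "r \<ge> 1"
  shows "slow (1/4) (h_sum r \<sigma>)"
proof -
  have "h_sum r \<sigma> = (\<lambda>n. \<Sum>k<n. \<sigma> ^ k / (real k + 1/2) ^ r)"
    unfolding h_sum_def fun_eq_iff by (intro allI, rule sum.reindex_bij_witness[of _ "\<lambda>k. k + 1" "\<lambda>i. i - 1"]) (auto simp: algebra_simps)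
  moreover have "\<bar>\<sigma> ^ k / (real k + 1/2) ^ r\<bar> \<le> 2 ^ r / real (Suc k)" for k
  proof -
    have "real (Suc k) ^ 1 \<le> real (Suc k) ^ r" using assms by (intro power_increasing) auto
    also have "\<dots> \<le> (2 * (real k + 1/2)) ^ r" by (intro power_mono) auto
    finally have "real (Suc k) \<le> 2 ^ r * (real k + 1/2) ^ r" by (simp only: power_mult_distrib power_one_right)
    moreover have "\<bar>\<sigma> ^ k / (real k + 1/2) ^ r\<bar> = 1 / (real k + 1/2) ^ r"
      using assms(1) by (simp add: power_abs)
    moreover have "(real k + 1/2) ^ r > 0" by simp
    moreover have "1 / y \<le> x / n" if "0 < y" "0 < n" "n \<le> x * y" for x y n :: real
      using that by (simp add: field_simps)
    ultimately show ?thesis using of_nat_0_less_iff by (metis zero_less_Suc)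
  qed
  ultimately show ?thesis using slow_partial_sums[of "\<lambda>k. \<sigma> ^ k / (real k + 1/2) ^ r" "2 ^ r"] by simp
qed

lemma slow_H_sum:
  assumes "\<bar>\<sigma>\<bar> = 1" "r \<ge> 1"
  shows "slow (1/4) (H_sum r \<sigma>)"
proof -
  have "H_sum r \<sigma> = (\<lambda>n. \<Sum>k<n. \<sigma> ^ k / real (Suc k) ^ r)"
    unfolding H_sum_def fun_eq_iff by (intro allI, rule sum.reindex_bij_witness[of _ "\<lambda>k. k + 1" "\<lambda>i. i - 1"]) (auto simp: algebra_simps)
  moreover have "\<bar>\<sigma> ^ k / real (Suc k) ^ r\<bar> \<le> 1 / real (Suc k)" for k
  proof -
    have "real (Suc k) ^ 1 \<le> real (Suc k) ^ r" using assms by (intro power_increasing) auto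
    then show ?thesis using assms(1) by (simp add: power_abs divide_simps del: of_nat_Suc)
  qed
  ultimately show ?thesis using slow_partial_sums[of "\<lambda>k. \<sigma> ^ k / real (Suc k) ^ r" 1] by simp
qed

lemma summable_slow_half:
  assumes "\<bar>\<sigma>\<bar> = 1" "q \<ge> 1" "(q, \<sigma>) \<noteq> (1, 1)" "slow a g" "a < 1"
  shows "summable (\<lambda>n. \<sigma> ^ n * g n / (real (Suc n) - 1/2) ^ q)"
proof -
  have "slow a (\<lambda>n. g n * (real (Suc n) / (real n + 1/2)) ^ q)"
    using slow_mult[OF assms(4) slow_half_ratio, of q] by simp
  from summable_slow[OF assms(1-3) this assms(5)] show ?thesis
    by (simp add: power_divide del: of_nat_Suc) (simp add: algebra_simps)
qed

section \<open>Bounds on the contour\<close>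

lemma suminf_inverse_squares_tail:
  assumes "M \<ge> 2"
  shows "summable (\<lambda>i. 1 / real (i + M) ^ 2)" "(\<Sum>i. 1 / real (i + M) ^ 2) \<le> 2 / real M"
proof -
  have s: "(\<lambda>n. 1 / real (n + M - 1) - 1 / real (Suc n + M - 1)) sums (1 / real (0 + M - 1) - 0)"
    by (rule telescope_sums') real_asymp
  have le: "1 / real (i + M) ^ 2 \<le> 1 / real (i + M - 1) - 1 / real (Suc i + M - 1)" for i
  proof -
    have "real (i + M - 1) = real (i + M) - 1" using assms by (simp add: of_nat_diff)
    moreover have "real (i + M) > 1" using assms by simp
    ultimately show ?thesis using assms by (simp add: divide_simps power2_eq_square del: of_nat_add)
  qed
  show s1: "summable (\<lambda>i. 1 / real (i + M) ^ 2)"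
    by (rule summable_comparison_test[OF _ sums_summable[OF s]]) (use le in auto)
  have "(\<Sum>i. 1 / real (i + M) ^ 2) \<le> 1 / real (0 + M - 1) - 0"
    unfolding sums_unique[OF s] by (rule suminf_le[OF le s1 sums_summable[OF s]])
  also have "\<dots> \<le> 2 / real M" using assms by (simp add: divide_simps of_nat_diff)
  finally show "(\<Sum>i. 1 / real (i + M) ^ 2) \<le> 2 / real M" .
qed

text \<open>Separates the early terms, where -b may be close to z, from a tail with a quadratic
  majorant.\<close>

lemma norm_suminf_split_le:
  fixes f :: "nat \<Rightarrow> complex"
  assumes "M \<ge> 2" "summable f" "\<And>b. b < M \<Longrightarrow> norm (f b) \<le> g b" "\<And>b. b \<ge> M \<Longrightarrow> norm (f b) \<le> c / real b ^ 2"
  shows "norm (suminf f) \<le> (\<Sum>b<M. g b) + 2 * c / real M"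
proof -
  note t = suminf_inverse_squares_tail[OF assms(1)]
  have "c / real M ^ 2 \<ge> 0" using assms(4)[of M] norm_ge_zero order_trans by blast
  then have c0: "c \<ge> 0" using assms(1) by (simp add: zero_le_divide_iff)
  have le: "norm (f (i + M)) \<le> c * (1 / real (i + M) ^ 2)" for i using assms(4)[of "i + M"] by simp
  have s: "summable (\<lambda>i. norm (f (i + M)))"
    by (rule summable_comparison_test[OF _ summable_mult[OF t(1), of c]]) (use le in auto)
  have "suminf f = (\<Sum>i. f (i + M)) + (\<Sum>b<M. f b)" by (rule suminf_split_initial_segment[OF assms(2)])
  also have "norm \<dots> \<le> norm (\<Sum>i. f (i + M)) + norm (\<Sum>b<M. f b)" by (rule norm_triangle_ineq)
  also have "norm (\<Sum>b<M. f b) \<le> (\<Sum>b<M. g b)" by (intro sum_norm_le assms(3)) auto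
  also have "norm (\<Sum>i. f (i + M)) \<le> (\<Sum>i. norm (f (i + M)))" by (rule summable_norm[OF s])
  also have "\<dots> \<le> (\<Sum>i. c * (1 / real (i + M) ^ 2))" by (rule suminf_le[OF le s summable_mult[OF t(1)]])
  also have "\<dots> = c * (\<Sum>i. 1 / real (i + M) ^ 2)" by (rule suminf_mult[OF t(1)])
  also have "\<dots> \<le> c * (2 / real M)" by (intro mult_left_mono t c0)
  finally show ?thesis by (simp add: mult.commute)
qed

text \<open>
  Covers the arguments \<open>s\<close>, \<open>1 - s\<close> and \<open>1/2 - s\<close> of the Lerch functions for \<open>s\<close> on a rectangular
  contour with vertical sides \<open>Re s = \<plusminus>(N + 1/4)\<close>.
\<close>

definition tame :: "nat \<Rightarrow> complex \<Rightarrow> bool" where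
  "tame N z \<longleftrightarrow> N \<ge> 2 \<and> \<bar>Re z\<bar> \<le> real N + 2 \<and> norm z \<le> 3 * real N \<and> (\<forall>b. norm (of_nat b + z) \<ge> 1/4)"

text \<open>Let k be the integer part of -Re z. The distance d = |b - k| is injective in b on each
  side of k, so the sum is at most two copies of a harmonic sum. The range 8N suffices since |k|
  \<le> N + 3 and b < 4N.\<close>

lemma sum_inverse_distance_le:
  assumes "tame N z"
  shows "(\<Sum>b<4*N. 1 / norm (of_nat b + z)) \<le> 16 * harm (8 * N)"
proof -
  define k where "k = \<lfloor>- Re z\<rfloor>"
  define d where "d = (\<lambda>b. nat \<bar>int b - k\<bar>)"
  define f where "f = (\<lambda>i. 1 / real (Suc i))"
  have k: "real_of_int k \<le> - Re z" "- Re z < real_of_int k + 1" unfolding k_def by linarith+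
  have Re: "\<bar>Re z\<bar> \<le> real N + 2" "N \<ge> 2" "\<And>b. norm (of_nat b + z) \<ge> 1/4" using assms by (auto simp: tame_def)
  have kN: "\<bar>k\<bar> \<le> int N + 3"
  proof -
    have "\<bar>real_of_int k\<bar> \<le> real_of_int (int N + 3)" using k Re(1) by (auto simp: abs_if split: if_splits)
    then show ?thesis by (simp only: of_int_abs[symmetric] of_int_le_iff)
  qed
  have "1 / norm (of_nat b + z) \<le> 8 * f (d b)" for b
  proof -
    have dr: "real (d b) = \<bar>real b - real_of_int k\<bar>" by (simp add: d_def)
    have "\<bar>real b + Re z\<bar> \<le> norm (of_nat b + z)" using abs_Re_le_cmod[of "of_nat b + z"] by simp
    then have "real (d b) - 1 \<le> norm (of_nat b + z)" using k unfolding dr by linarith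
    moreover have "d b = 0 \<or> d b = 1 \<or> d b \<ge> 2" by linarith
    \<comment> \<open>For d \<le> 1 this follows from the minimal distance 1/4, for larger d from d
      - 1 \<ge> (d + 1)/8.\<close>
    ultimately have "(real (d b) + 1) / 8 \<le> norm (of_nat b + z)" using Re(3)[of b] by auto
    moreover have "(real (d b) + 1) / 8 > 0" "norm (of_nat b + z) > 0" using Re(3)[of b] by (simp, linarith)
    ultimately have "1 / norm (of_nat b + z) \<le> 1 / ((real (d b) + 1) / 8)"
      by (intro divide_left_mono mult_pos_pos) auto
    then show ?thesis by (simp add: f_def add.commute)
  qed
  then have "(\<Sum>b<4*N. 1 / norm (of_nat b + z)) \<le> (\<Sum>b<4*N. 8 * f (d b))" by (intro sum_mono)
  also have "\<dots> = 8 * (\<Sum>b<4*N. f (d b))" by (simp add: sum_distrib_left)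
  also have "(\<Sum>b<4*N. f (d b)) = (\<Sum>b\<in>{b\<in>{..<4*N}. int b \<ge> k}. f (d b)) + (\<Sum>b\<in>{b\<in>{..<4*N}. \<not> int b \<ge> k}. f (d b))"
    by (subst sum.union_disjoint[symmetric]) (auto intro!: sum.cong)
  also have "(\<Sum>b\<in>{b\<in>{..<4*N}. int b \<ge> k}. f (d b)) = sum f (d ` {b\<in>{..<4*N}. int b \<ge> k})"
    by (subst sum.reindex) (auto simp: inj_on_def d_def)
  also have "(\<Sum>b\<in>{b\<in>{..<4*N}. \<not> int b \<ge> k}. f (d b)) = sum f (d ` {b\<in>{..<4*N}. \<not> int b \<ge> k})"
    by (subst sum.reindex) (auto simp: inj_on_def d_def)
  also have "sum f (d ` {b\<in>{..<4*N}. int b \<ge> k}) \<le> sum f {..<8*N}"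
    by (intro sum_mono2) (use kN Re(2) in \<open>auto simp: d_def f_def\<close>)
  also have "sum f (d ` {b\<in>{..<4*N}. \<not> int b \<ge> k}) \<le> sum f {..<8*N}"
    by (intro sum_mono2) (use kN Re(2) in \<open>auto simp: d_def f_def\<close>)
  finally show ?thesis by (simp add: f_def harm_altdef divide_inverse)
qed

lemma tame_tail:
  assumes "tame N z" "b \<ge> 4 * N"
  shows "real b / 2 \<le> norm (of_nat b + z)" "real b / 2 \<le> norm (of_nat (Suc b) + z)" "b \<ge> 2"
proof -
  have "\<bar>Re z\<bar> \<le> real b / 2" "b \<ge> 2" using assms by (auto simp: tame_def)
  then show "real b / 2 \<le> norm (of_nat b + z)" "real b / 2 \<le> norm (of_nat (Suc b) + z)" "b \<ge> 2"
    using abs_Re_le_cmod[of "of_nat b + z"] abs_Re_le_cmod[of "of_nat (Suc b) + z"] by auto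
qed

lemma one_le_harm: "N \<ge> 1 \<Longrightarrow> 1 \<le> (harm N :: real)"
  using harm_mono[of 1 N, where ?'a = real] by (simp add: harm_expand)

lemma lerch_bound:
  assumes "\<bar>\<sigma>\<bar> = 1" "m \<ge> 1"
  obtains C where "C \<ge> 0" "\<And>N z. tame N z \<Longrightarrow> norm (lerch \<sigma> m z) \<le> C * harm (8 * N)"
proof
  \<comment> \<open>16 + 1 for the inverse distances and the regularising constants of the first 4N
    terms, 4^m for powers of distances that may be as small as 1/4, and 6 for the tail. Bounded
    parts are absorbed since \<open>harm (8 * N)\<close> is at least 1.\<close>
  define C where "C = 17 * 4 ^ m + 6 + \<bar>alt_zeta 1 \<sigma>\<bar>"
  show "C \<ge> 0" by (simp add: C_def)
  fix N z assume z: "tame N z"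
  then have N: "N \<ge> 2" and nz: "norm z \<le> 3 * real N" and q: "\<And>b. norm (of_nat b + z) \<ge> 1/4" by (auto simp: tame_def)
  let ?g = "\<lambda>b. 4 ^ m * (1 / norm (of_nat b + z) + 1 / real (Suc b))"
  have "norm (\<Sum>b. lerch_term \<sigma> m z b) \<le> (\<Sum>b<4*N. ?g b) + 2 * (6 + 2 * norm z) / real (4 * N)"
  proof (rule norm_suminf_split_le)
    show "4 * N \<ge> 2" using N by simp
    show "summable (lerch_term \<sigma> m z)" by (rule summable_lerch_term[OF assms])
    show "norm (lerch_term \<sigma> m z b) \<le> (6 + 2 * norm z) / real b ^ 2" if "b \<ge> 4 * N" for b
      using tame_tail[OF z that] by (intro norm_lerch_term_le assms)
    fix b
    let ?x = "1 / norm (of_nat b + z)"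
    have x: "0 \<le> ?x" "?x \<le> 4" using q[of b] by (auto simp: divide_le_eq)
    have "?x ^ m = ?x ^ (m - 1) * ?x" using assms(2) by (metis Suc_diff_le diff_Suc_1 power_Suc2 One_nat_def)
    also have "\<dots> \<le> 4 ^ (m - 1) * ?x" using x by (intro mult_right_mono power_mono) auto
    also have "\<dots> \<le> 4 ^ m * ?x" using x by (intro mult_right_mono power_increasing) auto
    finally have xm: "?x ^ m \<le> 4 ^ m * ?x" .
    have "norm (lerch_term \<sigma> m z b) = norm (1 / (of_nat b + z) ^ m - (if m = 1 then 1 / of_nat (Suc b) else 0))"
      using assms(1) by (simp add: lerch_term_def norm_mult norm_power)
    also have "\<dots> \<le> norm (1 / (of_nat b + z) ^ m) + norm (if m = 1 then 1 / of_nat (Suc b) else 0 :: complex)"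
      by (rule norm_triangle_ineq4)
    also have "norm (1 / (of_nat b + z) ^ m) = ?x ^ m" by (simp add: norm_divide norm_power power_one_over)
    also have "norm (if m = 1 then 1 / of_nat (Suc b) else 0 :: complex) \<le> 1 * (1 / real (Suc b))"
      by (simp add: norm_divide del: of_nat_Suc)
    also have "1 * (1 / real (Suc b)) \<le> 4 ^ m * (1 / real (Suc b))"
      by (intro mult_right_mono) auto
    finally show "norm (lerch_term \<sigma> m z b) \<le> ?g b" using xm by (simp add: distrib_left)
  qed
  also have "(\<Sum>b<4*N. ?g b) = 4 ^ m * ((\<Sum>b<4*N. 1 / norm (of_nat b + z)) + harm (4 * N))"
    by (simp add: sum_distrib_left distrib_left sum.distrib harm_altdef divide_inverse)
  also have "\<dots> \<le> 4 ^ m * (16 * harm (8 * N) + harm (8 * N))"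
    by (intro mult_left_mono add_mono sum_inverse_distance_le z harm_mono) auto
  also have "2 * (6 + 2 * norm z) / real (4 * N) \<le> 6"
    using N nz by (simp add: divide_le_eq)
  finally have 1: "norm (\<Sum>b. lerch_term \<sigma> m z b) \<le> 17 * 4 ^ m * harm (8 * N) + 6" by simp
  have "norm (lerch \<sigma> m z) \<le> norm (\<Sum>b. lerch_term \<sigma> m z b) + norm (if m = 1 then of_real (\<sigma> * alt_zeta 1 \<sigma>) else 0 :: complex)"
    unfolding lerch_def by (rule norm_triangle_ineq)
  also have "norm (if m = 1 then of_real (\<sigma> * alt_zeta 1 \<sigma>) else 0 :: complex) \<le> \<bar>alt_zeta 1 \<sigma>\<bar>"
    using assms(1) by (simp add: norm_mult)
  also note 1
  also have "17 * 4 ^ m * harm (8 * N) + 6 + \<bar>alt_zeta 1 \<sigma>\<bar> \<le> 17 * 4 ^ m * harm (8 * N) + 6 * harm (8 * N) + \<bar>alt_zeta 1 \<sigma>\<bar> * harm (8 * N)"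
  proof -
    have "1 \<le> (harm (8 * N) :: real)" using N by (intro one_le_harm) auto
    then show ?thesis using mult_left_mono[of 1 "harm (8 * N)" "\<bar>alt_zeta 1 \<sigma>\<bar>"] by simp
  qed
  finally show "norm (lerch \<sigma> m z) \<le> C * harm (8 * N)" by (simp add: C_def algebra_simps)
qed

text \<open>The extra decay that rescues q = 1. A product of two inverse distances loses one of them
  to 1/Y, and the other sums to a logarithm. For m \<ge> 2 the two factors are present already; for
  m = 1 the alternating sign produces them through differences of neighbouring terms.\<close>

lemma alternating_lerch_bound:
  assumes "m \<ge> 1" "tame N z" "\<bar>Im z\<bar> \<ge> Y" "1 \<le> Y" "Y \<le> real N"
  shows "norm (lerch (-1) m z) \<le> 20 * harm (8 * N) / Y"
proof -
  have N: "N \<ge> 2" using assms(2) by (simp add: tame_def)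
  have h1: "1 \<le> (harm (8 * N) :: real)" using N by (intro one_le_harm) auto
  have Y: "Y \<le> norm (of_nat b + z)" for b
    using abs_Im_le_cmod[of "of_nat b + z"] assms(3) by simp
  have pos: "norm (of_nat b + z) > 0" for b using Y[of b] assms(4) by linarith
  have invY: "1 / norm (of_nat b + z) \<le> 1 / Y" for b
    using Y[of b] pos[of b] assms(4) by (intro divide_left_mono mult_pos_pos) auto
  \<comment> \<open>The offset \<open>e\<close> is 0 for squares and 1 for products of neighbouring
    distances. In the constant, 16 comes from the first 4N terms and 2 from the tail, where 1/N
    \<le> 1/Y.\<close>
  have split: "norm (suminf f) \<le> 18 * harm (8 * N) / Y"
    if f: "summable f" and fb: "\<And>b. norm (f b) \<le> (1 / norm (of_nat b + z)) * (1 / norm (of_nat (b + e) + z))"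
      and e: "e \<le> 1" for f :: "nat \<Rightarrow> complex" and e
  proof -
    have "norm (suminf f) \<le> (\<Sum>b<4*N. (1 / Y) * (1 / norm (of_nat b + z))) + 2 * 4 / real (4 * N)"
    proof (rule norm_suminf_split_le[OF _ f])
      show "4 * N \<ge> 2" using N by simp
      show "norm (f b) \<le> (1 / Y) * (1 / norm (of_nat b + z))" for b
      proof (rule order.trans[OF fb])
        show "(1 / norm (of_nat b + z)) * (1 / norm (of_nat (b + e) + z)) \<le> (1 / Y) * (1 / norm (of_nat b + z))"
          unfolding mult.commute[of "1 / Y"] by (intro mult_left_mono invY) auto
      qed
      fix b assume b: "b \<ge> 4 * N"
      note t = tame_tail[OF assms(2) b]
      have "e = 0 \<or> e = 1" using e by auto
      then have "real b / 2 \<le> norm (of_nat (b + e) + z)" using t by (auto simp: add_ac)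
      then have "(1 / norm (of_nat b + z)) * (1 / norm (of_nat (b + e) + z)) \<le> (1 / (real b / 2)) * (1 / (real b / 2))"
        using t pos by (intro mult_mono divide_left_mono mult_pos_pos) auto
      also have "\<dots> = 4 / real b ^ 2" by (simp add: power2_eq_square)
      finally show "norm (f b) \<le> 4 / real b ^ 2" using fb order.trans by blast
    qed
    also have "(\<Sum>b<4*N. (1 / Y) * (1 / norm (of_nat b + z))) = (1 / Y) * (\<Sum>b<4*N. 1 / norm (of_nat b + z))"
      by (rule sum_distrib_left[symmetric])
    also have "\<dots> \<le> (1 / Y) * (16 * harm (8 * N))"
      using assms(4) by (intro mult_left_mono sum_inverse_distance_le assms(2)) auto
    also have "2 * 4 / real (4 * N) = 2 / real N" by simp
    also have "2 / real N \<le> 2 * harm (8 * N) / Y"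
      using assms(4,5) h1 by (intro frac_le) auto
    finally show ?thesis by (simp add: field_simps)
  qed
  show ?thesis
  proof (cases "m = 1")
    case False
    have "norm (lerch_term (-1) m z b) \<le> (1 / norm (of_nat b + z)) * (1 / norm (of_nat (b + 0) + z))" for b
    proof -
      have "1 / norm (of_nat b + z) \<le> 1" using Y[of b] assms(4) pos[of b] by (simp add: divide_le_eq)
      then have "(1 / norm (of_nat b + z)) ^ m \<le> (1 / norm (of_nat b + z)) ^ 2"
        using assms(1) False by (intro power_decreasing) auto
      moreover have "norm (lerch_term (-1) m z b) = (1 / norm (of_nat b + z)) ^ m"
        using False by (simp add: lerch_term_def norm_mult norm_divide norm_power power_one_over)
      ultimately show ?thesis by (simp add: power2_eq_square)
    qed
    from split[OF summable_lerch_term this] assms(1) have "norm (lerch (-1) m z) \<le> 18 * harm (8 * N) / Y"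
      using False by (simp add: lerch_def)
    also have "\<dots> \<le> 20 * harm (8 * N) / Y" using h1 assms(4) by (intro divide_right_mono) auto
    finally show ?thesis .
  next
    case True
    \<comment> \<open>By the functional equation, 2 L(z) = 1/z + (L(z) - L(z+1)). In the difference
      the regularising constants cancel and each term becomes 1/((b+z)(b+1+z)) up to sign.\<close>
    let ?f = "\<lambda>b. lerch_term (-1) 1 z b - lerch_term (-1) 1 (z + 1) b"
    have s: "summable (lerch_term (-1) 1 z)" "summable (lerch_term (-1) 1 (z + 1))"
      by (auto intro!: summable_lerch_term)
    have "norm (?f b) \<le> (1 / norm (of_nat b + z)) * (1 / norm (of_nat (b + 1) + z))" for b
    proof -
      have nz: "of_nat b + z \<noteq> 0" "of_nat b + (z + 1) \<noteq> 0" "of_nat b + (z + 1) = of_nat (b + 1) + z"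
        using pos[of b] pos[of "b + 1"] by (auto simp: add_ac)
      have "?f b = (-1) ^ b * (1 / (of_nat b + z) - 1 / (of_nat b + (z + 1)))"
        by (simp add: lerch_term_def algebra_simps)
      also have "1 / (of_nat b + z) - 1 / (of_nat b + (z + 1)) = 1 / (of_nat b + z) * (1 / (of_nat b + (z + 1)))"
        using nz(1,2) by (simp add: divide_simps)
      finally show ?thesis unfolding nz(3) by (simp add: norm_mult norm_divide norm_power)
    qed
    from split[OF summable_diff[OF s] this] have
      "norm (lerch (-1) 1 z - lerch (-1) 1 (z + 1)) \<le> 18 * harm (8 * N) / Y"
      using suminf_diff[OF s] by (simp add: lerch_def)
    moreover have "z \<notin> \<int>\<^sub>\<le>\<^sub>0" using assms(3,4) by (auto elim!: nonpos_Ints_cases)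
    then have "lerch (-1) 1 z = 1 / z - lerch (-1) 1 (z + 1)" using lerch_shift[of "-1" 1 z] by simp
    then have "2 * lerch (-1) 1 z = 1 / z + (lerch (-1) 1 z - lerch (-1) 1 (z + 1))" by (simp add: algebra_simps)
    then have "2 * norm (lerch (-1) 1 z) \<le> 1 / norm z + norm (lerch (-1) 1 z - lerch (-1) 1 (z + 1))"
      by (metis norm_triangle_ineq norm_mult norm_divide norm_one norm_numeral)
    moreover have "1 / norm z \<le> harm (8 * N) / Y"
      using invY[of 0] h1 assms(4) divide_right_mono[OF h1, of Y] by simp
    ultimately have "2 * norm (lerch (-1) 1 z) \<le> harm (8 * N) / Y + 18 * harm (8 * N) / Y" by linarith
    moreover have "harm (8 * N) / Y \<ge> 0" using h1 assms(4) by simp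
    ultimately show ?thesis using True by simp
  qed
qed

section \<open>The residue theorem on rectangles\<close>

definition euler_poles :: "complex set" where
  "euler_poles = \<int> \<union> range (\<lambda>b. of_nat b + 1/2)"

lemma holomorphic_euler_kernel:
  assumes "\<bar>\<sigma>1\<bar> = 1" "\<bar>\<sigma>2\<bar> = 1" "\<bar>\<tau>\<bar> = 1" "m \<ge> 1" "p \<ge> 1"
  shows "euler_kernel m p q \<sigma>1 \<sigma>2 \<tau> holomorphic_on (- euler_poles)"
proof -
  have hol: "lerch \<sigma> m holomorphic_on (- \<int>\<^sub>\<le>\<^sub>0)" if "\<bar>\<sigma>\<bar> = 1" "m \<ge> 1" for \<sigma> m
    using has_field_derivative_lerch[OF that]
    by (subst holomorphic_on_open) (auto simp: closed_nonpos_Ints open_Compl)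
  have comp: "(\<lambda>s. lerch \<sigma> m (c - s)) holomorphic_on (- euler_poles)"
    if "\<bar>\<sigma>\<bar> = 1" "m \<ge> 1" "c = 1 \<or> c = 1/2" for \<sigma> m c
  proof (rule holomorphic_on_compose_gen[of "\<lambda>s. c - s" _ "lerch \<sigma> m" "- \<int>\<^sub>\<le>\<^sub>0", unfolded o_def])
    show "lerch \<sigma> m holomorphic_on (- \<int>\<^sub>\<le>\<^sub>0)" by (rule hol[OF that(1,2)])
    show "(\<lambda>s. c - s) ` (- euler_poles) \<subseteq> - \<int>\<^sub>\<le>\<^sub>0"
    proof safe
      fix s assume s: "s \<notin> euler_poles" and "c - s \<in> \<int>\<^sub>\<le>\<^sub>0"
      then obtain b :: nat where "c - s = - of_nat b" by (elim nonpos_Ints_cases')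
      then have "s = of_nat b + c" by (simp add: algebra_simps)
      then show False using s that(3) by (elim disjE) (auto simp: euler_poles_def)
    qed
  qed (auto intro!: holomorphic_intros)
  have "lerch \<tau> 1 holomorphic_on (- euler_poles)"
    by (rule holomorphic_on_subset[OF hol[OF assms(3)]])
       (use nonpos_Ints_Int in \<open>auto simp: euler_poles_def\<close>)
  moreover have "s \<noteq> 0" if "s \<in> - euler_poles" for s using that by (auto simp: euler_poles_def)
  ultimately show ?thesis
    unfolding euler_kernel_def[abs_def] lattice_kernel_def
    by (intro holomorphic_intros comp assms) auto
qed

text \<open>This is the reason for the offset 1/4: on the vertical sides all three arguments have a
  real part that is an odd multiple of 1/4, so they keep distance 1/4 from the integers. On the
  horizontal sides the imaginary part alone gives distance 1.\<close>

lemma tame_near_box: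
  assumes "N \<ge> 2" "\<bar>Re s\<bar> \<le> real N + 1/4" "\<bar>Im s\<bar> \<le> real N"
    and "\<bar>Im s\<bar> \<ge> 1 \<or> \<bar>Re s\<bar> = real N + 1/4"
    and "z = s \<or> z = 1 - s \<or> z = 1/2 - s"
  shows "tame N z"
  unfolding tame_def
proof (intro conjI allI)
  have R: "\<bar>Re z\<bar> \<le> real N + 5/4" and I: "\<bar>Im z\<bar> = \<bar>Im s\<bar>" using assms(2,5) by auto
  show "\<bar>Re z\<bar> \<le> real N + 2" using R by simp
  show "norm z \<le> 3 * real N" using cmod_le[of z] R I assms(1,3) by simp
  fix b
  show "1/4 \<le> norm (of_nat b + z)"
  proof (cases "\<bar>Im s\<bar> \<ge> 1")
    case True
    then show ?thesis using abs_Im_le_cmod[of "of_nat b + z"] I by simp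
  next
    case False
    with assms(4) have "\<bar>Re s\<bar> = real N + 1/4" by simp
    then have "Re s = real N + 1/4 \<or> Re s = - (real N + 1/4)" by linarith
    then obtain e :: int where e: "e = 1 \<or> e = -1" "Re s = of_int e * (real N + 1/4)" by force
    obtain j :: int where "4 * Re (of_nat b + z) = of_int j" "odd j"
      using assms(5)
    proof (elim disjE)
      assume "z = s"
      then show thesis
        using e by (intro that[of "4 * int b + e * (4 * int N + 1)"]) auto
    next
      assume "z = 1 - s"
      then show thesis
        using e by (intro that[of "4 * int b + 4 - e * (4 * int N + 1)"]) auto
    next
      assume "z = 1/2 - s"
      then show thesis
        using e by (intro that[of "4 * int b + 2 - e * (4 * int N + 1)"]) auto
    qed
    then have "\<bar>j\<bar> \<ge> 1" by (cases "j = 0") auto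
    then have "\<bar>real_of_int j\<bar> \<ge> 1" by linarith
    with \<open>4 * Re (of_nat b + z) = of_int j\<close> have "\<bar>Re (of_nat b + z)\<bar> \<ge> 1/4" by linarith
    then show ?thesis using abs_Re_le_cmod[of "of_nat b + z"] by linarith
  qed
qed (rule assms)

lemma triple_product_le:
  fixes X A B x a b Y :: real
  assumes "0 \<le> X" "X \<le> x" "0 \<le> A" "A \<le> a" "0 \<le> B" "B \<le> b" "Y \<ge> 1"
    and "X \<le> x / Y \<or> A \<le> a / Y \<or> B \<le> b / Y"
  shows "X * A * B \<le> x * a * b / Y"
  using assms(8)
proof (elim disjE)
  assume "X \<le> x / Y"
  then have "X * A * B \<le> (x / Y) * a * b" using assms by (intro mult_mono) auto
  then show ?thesis by simp
next
  assume "A \<le> a / Y"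
  then have "X * A * B \<le> x * (a / Y) * b" using assms by (intro mult_mono) auto
  then show ?thesis by simp
next
  assume "B \<le> b / Y"
  then have "X * A * B \<le> x * a * (b / Y)" using assms by (intro mult_mono) auto
  then show ?thesis by simp
qed

text \<open>Each of the three factors costs one logarithm. On vertical sides 1/|s|^q gives 1/N. On
  horizontal sides the exponent q \<ge> 2 gives 1/Y^2 directly; for q = 1 one power of 1/Y comes
  from 1/s and the other from a factor of sign -1.\<close>

lemma euler_kernel_bound:
  assumes "\<bar>\<sigma>1\<bar> = 1" "\<bar>\<sigma>2\<bar> = 1" "\<bar>\<tau>\<bar> = 1" "m \<ge> 1" "p \<ge> 1" "q \<ge> 1"
    and "q = 1 \<Longrightarrow> \<tau> = -1 \<or> \<sigma>1 = -1 \<or> \<sigma>2 = -1"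
  obtains C where "C \<ge> 0"
    "\<And>N Y s. N \<ge> 2 \<Longrightarrow> 1 \<le> Y \<Longrightarrow> Y \<le> real N \<Longrightarrow> \<bar>Re s\<bar> = real N + 1/4 \<Longrightarrow> \<bar>Im s\<bar> \<le> Y \<Longrightarrow>
       norm (euler_kernel m p q \<sigma>1 \<sigma>2 \<tau> s) \<le> C * harm (8 * N) ^ 3 / real N"
    "\<And>N Y s. N \<ge> 2 \<Longrightarrow> 1 \<le> Y \<Longrightarrow> Y \<le> real N \<Longrightarrow> \<bar>Re s\<bar> \<le> real N + 1/4 \<Longrightarrow> \<bar>Im s\<bar> = Y \<Longrightarrow>
       norm (euler_kernel m p q \<sigma>1 \<sigma>2 \<tau> s) \<le> C * harm (8 * N) ^ 3 / Y ^ 2"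
proof -
  obtain C0 where C0: "C0 \<ge> 0" "\<And>N z. tame N z \<Longrightarrow> norm (lerch \<tau> 1 z) \<le> C0 * harm (8 * N)"
    using lerch_bound[OF assms(3), of 1] by auto
  obtain C1 where C1: "C1 \<ge> 0" "\<And>N z. tame N z \<Longrightarrow> norm (lerch \<sigma>1 m z) \<le> C1 * harm (8 * N)"
    using lerch_bound[OF assms(1,4)] by auto
  obtain C2 where C2: "C2 \<ge> 0" "\<And>N z. tame N z \<Longrightarrow> norm (lerch \<sigma>2 p z) \<le> C2 * harm (8 * N)"
    using lerch_bound[OF assms(2,5)] by auto
  \<comment> \<open>The summand 20 makes the same constants valid for the alternating bound, and the
    factor 2 in \<open>x\<close> counts the two Lerch functions in the lattice kernel.\<close>
  define x a b where "x = 2 * (C0 + 20)" and "a = C1 + 20" and "b = C2 + 20"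
  have xab: "x \<ge> 0" "a \<ge> 0" "b \<ge> 0" using C0 C1 C2 by (auto simp: x_def a_def b_def)
  let ?F = "euler_kernel m p q \<sigma>1 \<sigma>2 \<tau>"
  have norm_F: "norm (?F s) = norm (lattice_kernel \<tau> s) * norm (lerch \<sigma>1 m (1/2 - s)) * norm (lerch \<sigma>2 p (1/2 - s)) / norm s ^ q" for s
    by (simp add: euler_kernel_def norm_mult norm_divide norm_power)
  have norm_lat: "norm (lattice_kernel \<tau> s) \<le> norm (lerch \<tau> 1 s) + norm (lerch \<tau> 1 (1 - s))" for s
    using norm_triangle_ineq4[of "lerch \<tau> 1 s" "of_real \<tau> * lerch \<tau> 1 (1 - s)"] assms(3)
    by (simp add: lattice_kernel_def norm_mult)
  have basic: "norm (lattice_kernel \<tau> s) \<le> x * harm (8 * N)" "norm (lerch \<sigma>1 m (1/2 - s)) \<le> a * harm (8 * N)"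
     "norm (lerch \<sigma>2 p (1/2 - s)) \<le> b * harm (8 * N)"
    if "N \<ge> 2" "\<bar>Re s\<bar> \<le> real N + 1/4" "\<bar>Im s\<bar> \<le> real N" "\<bar>Im s\<bar> \<ge> 1 \<or> \<bar>Re s\<bar> = real N + 1/4" for N s
  proof -
    note t = tame_near_box[OF that]
    have h: "(harm (8 * N) :: real) \<ge> 0" by (rule harm_nonneg)
    show "norm (lattice_kernel \<tau> s) \<le> x * harm (8 * N)"
      using norm_lat[of s] C0(2)[OF t[of s]] C0(2)[OF t[of "1 - s"]] h by (simp add: x_def algebra_simps)
    show "norm (lerch \<sigma>1 m (1/2 - s)) \<le> a * harm (8 * N)"
      using C1(2)[OF t[of "1/2 - s"]] h by (simp add: a_def algebra_simps)
    show "norm (lerch \<sigma>2 p (1/2 - s)) \<le> b * harm (8 * N)"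
      using C2(2)[OF t[of "1/2 - s"]] h by (simp add: b_def algebra_simps)
  qed
  show ?thesis
  proof (rule that[of "x * a * b"])
    show "x * a * b \<ge> 0" using xab by simp
  next
    fix N :: nat and Y :: real and s
    assume s: "N \<ge> 2" "1 \<le> Y" "Y \<le> real N" "\<bar>Re s\<bar> = real N + 1/4" "\<bar>Im s\<bar> \<le> Y"
    have h: "(harm (8 * N) :: real) \<ge> 0" by (rule harm_nonneg)
    have "real N \<le> norm s" using abs_Re_le_cmod[of s] s by simp
    then have "real N ^ q \<le> norm s ^ q" by (intro power_mono) auto
    moreover have "real N \<le> real N ^ q"
      using power_increasing[of 1 q "real N"] s(1) assms(6) by (simp del: of_nat_le_iff flip: of_nat_power)
    ultimately have Nq: "real N \<le> norm s ^ q" by linarith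
    have "norm (lattice_kernel \<tau> s) * norm (lerch \<sigma>1 m (1/2 - s)) * norm (lerch \<sigma>2 p (1/2 - s))
        \<le> (x * harm (8 * N)) * (a * harm (8 * N)) * (b * harm (8 * N))"
      using s xab h by (intro mult_mono basic) auto
    then have "norm (?F s) \<le> (x * harm (8 * N)) * (a * harm (8 * N)) * (b * harm (8 * N)) / real N"
      unfolding norm_F using Nq s(1) xab h by (intro frac_le) auto
    then show "norm (?F s) \<le> x * a * b * harm (8 * N) ^ 3 / real N"
      by (simp add: power3_eq_cube mult_ac)
  next
    fix N :: nat and Y :: real and s
    assume s: "N \<ge> 2" "1 \<le> Y" "Y \<le> real N" "\<bar>Re s\<bar> \<le> real N + 1/4" "\<bar>Im s\<bar> = Y"
    have h: "(harm (8 * N) :: real) \<ge> 0" by (rule harm_nonneg)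
    have bas: "norm (lattice_kernel \<tau> s) \<le> x * harm (8 * N)" "norm (lerch \<sigma>1 m (1/2 - s)) \<le> a * harm (8 * N)"
     "norm (lerch \<sigma>2 p (1/2 - s)) \<le> b * harm (8 * N)" using basic[of N s] s by auto
    have Ys: "Y \<le> norm s" using abs_Im_le_cmod[of s] s by simp
    let ?P = "norm (lattice_kernel \<tau> s) * norm (lerch \<sigma>1 m (1/2 - s)) * norm (lerch \<sigma>2 p (1/2 - s))"
    let ?Q = "(x * harm (8 * N)) * (a * harm (8 * N)) * (b * harm (8 * N))"
    have "norm (?F s) \<le> ?Q / Y ^ 2"
    proof (cases "q = 1")
      case False
      have "Y ^ 2 \<le> Y ^ q" using s assms(6) False by (intro power_increasing) auto
      also have "\<dots> \<le> norm s ^ q" using Ys s by (intro power_mono) auto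
      finally have "Y ^ 2 \<le> norm s ^ q" .
      moreover have "?P \<le> ?Q" using bas xab h by (intro mult_mono) auto
      ultimately show ?thesis unfolding norm_F using s xab h by (intro frac_le) auto
    next
      case True
      have t: "tame N s" "tame N (1 - s)" "tame N (1/2 - s)" using s by (auto intro!: tame_near_box[of N s])
      have alt: "norm (lerch (-1) n z) \<le> 20 * harm (8 * N) / Y" if "tame N z" "\<bar>Im z\<bar> = Y" "n \<ge> 1" for n z
        by (rule alternating_lerch_bound) (use that s in auto)
      have hY: "harm (8 * N) / Y \<ge> 0" using h s by simp
      have "norm (lattice_kernel \<tau> s) \<le> x * harm (8 * N) / Y \<or> norm (lerch \<sigma>1 m (1/2 - s)) \<le> a * harm (8 * N) / Y
        \<or> norm (lerch \<sigma>2 p (1/2 - s)) \<le> b * harm (8 * N) / Y"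
        using assms(7)[OF True]
      proof (elim disjE)
        assume "\<tau> = -1"
        moreover have "norm (lerch (-1) 1 s) \<le> 20 * harm (8 * N) / Y" "norm (lerch (-1) 1 (1 - s)) \<le> 20 * harm (8 * N) / Y"
          using s alt[OF t(1), of 1] alt[OF t(2), of 1] by simp_all
        ultimately have "norm (lattice_kernel \<tau> s) \<le> 40 * (harm (8 * N) / Y)"
          using norm_lat[of s] by simp
        also have "\<dots> \<le> x * (harm (8 * N) / Y)" using C0 hY by (intro mult_right_mono) (auto simp: x_def)
        finally show ?thesis by simp
      next
        assume "\<sigma>1 = -1"
        then have "norm (lerch \<sigma>1 m (1/2 - s)) \<le> 20 * (harm (8 * N) / Y)"
          using alt[OF t(3)] s assms(4) by simp
        also have "\<dots> \<le> a * (harm (8 * N) / Y)" using C1 hY by (intro mult_right_mono) (auto simp: a_def)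
        finally show ?thesis by simp
      next
        assume "\<sigma>2 = -1"
        then have "norm (lerch \<sigma>2 p (1/2 - s)) \<le> 20 * (harm (8 * N) / Y)"
          using alt[OF t(3)] s assms(5) by simp
        also have "\<dots> \<le> b * (harm (8 * N) / Y)" using C2 hY by (intro mult_right_mono) (auto simp: b_def)
        finally show ?thesis by simp
      qed
      from triple_product_le[OF norm_ge_zero bas(1) norm_ge_zero bas(2) norm_ge_zero bas(3) s(2) this]
      have "?P \<le> ?Q / Y" .
      then have "?P / norm s ^ q \<le> (?Q / Y) / Y"
        using Ys s xab h True by (intro frac_le) auto
      then show ?thesis unfolding norm_F by (simp add: power2_eq_square)
    qed
    then show "norm (?F s) \<le> x * a * b * harm (8 * N) ^ 3 / Y ^ 2"
      by (simp add: power3_eq_cube mult_ac)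
  qed
qed

lemma contour_integral_rectpath_bound:
  assumes cont: "continuous_on (path_image (rectpath a b)) f" and "Re a \<le> Re b" "Im a \<le> Im b"
    and V: "\<And>s. Re s = Re a \<or> Re s = Re b \<Longrightarrow> Im s \<in> {Im a..Im b} \<Longrightarrow> norm (f s) \<le> V"
    and H: "\<And>s. Im s = Im a \<or> Im s = Im b \<Longrightarrow> Re s \<in> {Re a..Re b} \<Longrightarrow> norm (f s) \<le> H"
  shows "norm (contour_integral (rectpath a b) f) \<le> 2 * H * (Re b - Re a) + 2 * V * (Im b - Im a)"
proof -
  define a2 a4 where "a2 = Complex (Re b) (Im a)" and "a4 = Complex (Re a) (Im b)"
  have rect: "rectpath a b = linepath a a2 +++ linepath a2 b +++ linepath b a4 +++ linepath a4 a"
    by (simp add: rectpath_def Let_def a2_def a4_def)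
  have img: "path_image (rectpath a b) = closed_segment a a2 \<union> closed_segment a2 b \<union> closed_segment b a4 \<union> closed_segment a4 a"
    unfolding rect by (simp add: path_image_join Un_assoc)
  have int: "(f has_contour_integral contour_integral (linepath u v) f) (linepath u v)"
    if "closed_segment u v \<subseteq> path_image (rectpath a b)" for u v
    using contour_integrable_continuous_linepath[OF continuous_on_subset[OF cont that]]
    by (rule has_contour_integral_integral)
  have subs: "closed_segment a a2 \<subseteq> path_image (rectpath a b)" "closed_segment a2 b \<subseteq> path_image (rectpath a b)"
     "closed_segment b a4 \<subseteq> path_image (rectpath a b)" "closed_segment a4 a \<subseteq> path_image (rectpath a b)"
    unfolding img by auto
  have "norm (f a) \<le> H" "norm (f a) \<le> V" using assms(2,3) by (auto intro: H V)
  then have H0: "H \<ge> 0" and V0: "V \<ge> 0" using norm_ge_zero order_trans by blast+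
  have seg: "norm (contour_integral (linepath u v) f) \<le> B * norm (v - u)"
    if "closed_segment u v \<subseteq> path_image (rectpath a b)" "B \<ge> 0" "\<And>s. s \<in> closed_segment u v \<Longrightarrow> norm (f s) \<le> B" for u v B
    using has_contour_integral_bound_linepath[OF int[OF that(1)] that(2,3)] by simp
  have "(f has_contour_integral (contour_integral (linepath a a2) f + (contour_integral (linepath a2 b) f
      + (contour_integral (linepath b a4) f + contour_integral (linepath a4 a) f)))) (rectpath a b)"
    unfolding rect by (intro has_contour_integral_join int subs valid_path_join valid_path_linepath) simp_all
  then have "norm (contour_integral (rectpath a b) f) = norm (contour_integral (linepath a a2) f + (contour_integral (linepath a2 b) f
      + (contour_integral (linepath b a4) f + contour_integral (linepath a4 a) f)))"
    by (simp only: contour_integral_unique)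
  also have "\<dots> \<le> norm (contour_integral (linepath a a2) f) + (norm (contour_integral (linepath a2 b) f)
      + (norm (contour_integral (linepath b a4) f) + norm (contour_integral (linepath a4 a) f)))"
    by (intro order.trans[OF norm_triangle_ineq] add_mono order.refl)
  also have "\<dots> \<le> H * norm (a2 - a) + (V * norm (b - a2) + (H * norm (a4 - b) + V * norm (a - a4)))"
  proof (intro add_mono seg subs H0 V0)
    show "norm (f s) \<le> H" if "s \<in> closed_segment a a2" for s
      using that assms(2) by (intro H) (auto simp: a2_def closed_segment_same_Im closed_segment_eq_real_ivl split: if_splits)
    show "norm (f s) \<le> V" if "s \<in> closed_segment a2 b" for s
      using that assms(3) by (intro V) (auto simp: a2_def closed_segment_same_Re closed_segment_eq_real_ivl split: if_splits)
    show "norm (f s) \<le> H" if "s \<in> closed_segment b a4" for s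
      using that assms(2) by (intro H) (auto simp: a4_def closed_segment_same_Im closed_segment_eq_real_ivl split: if_splits)
    show "norm (f s) \<le> V" if "s \<in> closed_segment a4 a" for s
      using that assms(3) by (intro V) (auto simp: a4_def closed_segment_same_Re closed_segment_eq_real_ivl split: if_splits)
  qed
  finally have "norm (contour_integral (rectpath a b) f)
      \<le> H * norm (a2 - a) + (V * norm (b - a2) + (H * norm (a4 - b) + V * norm (a - a4)))" .
  moreover have "norm (a2 - a) = Re b - Re a" "norm (b - a2) = Im b - Im a" "norm (a4 - b) = Re b - Re a" "norm (a - a4) = Im b - Im a"
    using assms(2,3) by (auto simp: a2_def a4_def cmod_def)
  ultimately show ?thesis by (simp add: algebra_simps)
qed


lemma contour_integral_rectpath_euler_kernel:
  fixes N q :: nat and Y :: real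
  assumes "\<bar>\<sigma>1\<bar> = 1" "\<bar>\<sigma>2\<bar> = 1" "\<bar>\<tau>\<bar> = 1" "m \<ge> 1" "p \<ge> 1" "Y > 0"
  defines "F \<equiv> euler_kernel m p q \<sigma>1 \<sigma>2 \<tau>"
    and "a \<equiv> Complex (- (real N + 1/4)) (- Y)" and "b \<equiv> Complex (real N + 1/4) Y"
  shows "contour_integral (rectpath a b) F = 2 * pi * \<i> * (residue F 0
      + (\<Sum>n=1..N. residue F (of_nat n) + residue F (- of_nat n)) + (\<Sum>k<N. residue F (of_nat k + 1/2)))"
    and "path_image (rectpath a b) \<subseteq> - euler_poles"
proof -
  \<comment> \<open>A convex open strip around the rectangle. Its half-width N + 1/3 stays below N +
    1/2, the next pole on the right, so it contains no poles beyond \<open>pts\<close>.\<close>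
  define S where "S = {s. Re s < real N + 1/3} \<inter> {s. Re s > - (real N + 1/3)}"
  define A B C where "A = (of_nat ` {1..N} :: complex set)" and "B = (\<lambda>n. - of_nat n :: complex) ` {1..N}"
    and "C = (\<lambda>k. of_nat k + 1/2 :: complex) ` {..<N}"
  define pts where "pts = {0 :: complex} \<union> A \<union> B \<union> C"
  have S: "open S" "convex S"
    unfolding S_def by (auto intro!: open_Int open_halfspace_Re_lt open_halfspace_Re_gt convex_Int convex_halfspace_Re_lt convex_halfspace_Re_gt)
  have pole_cases: "Im s = 0 \<and> ((\<exists>i::int. s = of_int i) \<or> (\<exists>k::nat. s = of_nat k + 1/2))" if "s \<in> euler_poles" for s
    using that by (auto simp: euler_poles_def elim!: Ints_cases)
  have inside: "s \<in> pts" if sS: "s \<in> S" and sP: "s \<in> euler_poles" for s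
  proof -
    consider i :: int where "s = of_int i" | k :: nat where "s = of_nat k + 1/2" using pole_cases[OF sP] by blast
    then show ?thesis
    proof cases
      case 1
      then have "of_int i < real N + 1" "of_int i > - (real N + 1)" using sS by (auto simp: S_def)
      then have i: "i \<le> int N" "i \<ge> - int N" by linarith+
      have "s = 0 \<or> (s = of_nat (nat i) \<and> nat i \<in> {1..N}) \<or> (s = - of_nat (nat (-i)) \<and> nat (-i) \<in> {1..N})"
        using i 1 by (cases "i = 0"; cases "i > 0") auto
      then show ?thesis by (auto simp: pts_def A_def B_def)
    next
      case 2
      then have "real k < real N" using sS by (simp add: S_def)
      then show ?thesis using 2 by (auto simp: pts_def C_def)
    qed
  qed
  have ab: "Re a \<le> Re b" "Im a \<le> Im b" using assms(6) by (auto simp: a_def b_def)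
  show avoid: "path_image (rectpath a b) \<subseteq> - euler_poles"
  proof
    fix s assume "s \<in> path_image (rectpath a b)"
    then have "\<bar>Re s\<bar> = real N + 1/4 \<or> \<bar>Im s\<bar> = Y"
      using assms(6) unfolding path_image_rectpath[OF ab] by (auto simp: a_def b_def)
    then show "s \<in> - euler_poles"
    proof
      assume "\<bar>Im s\<bar> = Y"
      then show ?thesis using pole_cases[of s] assms(6) by auto
    next
      assume "\<bar>Re s\<bar> = real N + 1/4"
      \<comment> \<open>Four times the real part is odd on the vertical sides but even at every
        integer and half-integer.\<close>
      then have R: "4 * Re s = of_int (4 * int N + 1) \<or> 4 * Re s = of_int (- (4 * int N + 1))" by auto
      have "\<exists>j::int. 4 * Re s = of_int j \<and> even j" if s: "s \<in> euler_poles"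
      proof -
        consider i :: int where "s = of_int i" | k :: nat where "s = of_nat k + 1/2" using pole_cases[OF s] by blast
        then show ?thesis
        proof cases
          case 1 then show ?thesis by (intro exI[of _ "4 * i"]) auto
        next
          case 2 then show ?thesis by (intro exI[of _ "4 * int k + 2"]) auto
        qed
      qed
      moreover have "odd j" if "4 * Re s = of_int j" for j
        using R unfolding that of_int_eq_iff by auto
      ultimately show ?thesis by blast
    qed
  qed
  have in_S: "path_image (rectpath a b) \<subseteq> S"
    using assms(6) unfolding path_image_rectpath[OF ab] by (auto simp: a_def b_def S_def)
  have "pts \<subseteq> euler_poles"
    by (auto simp: pts_def A_def B_def C_def euler_poles_def)
  have "contour_integral (rectpath a b) F = 2 * pi * \<i> * (\<Sum>s\<in>pts. winding_number (rectpath a b) s * residue F s)"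
  proof (rule Residue_theorem[of S])
    show "connected S" by (rule convex_connected[OF S(2)])
    show "finite pts" by (simp add: pts_def A_def B_def C_def)
    show "F holomorphic_on S - pts"
      unfolding F_def by (rule holomorphic_on_subset[OF holomorphic_euler_kernel[OF assms(1-5)]]) (use inside in auto)
    show "path_image (rectpath a b) \<subseteq> S - pts" using in_S avoid \<open>pts \<subseteq> euler_poles\<close> by auto
    show "\<forall>z. z \<notin> S \<longrightarrow> winding_number (rectpath a b) z = 0"
      using winding_number_zero_outside[OF valid_path_imp_path[OF valid_path_rectpath] S(2) _ _ in_S] by simp
  qed (use S in auto)
  also have "(\<Sum>s\<in>pts. winding_number (rectpath a b) s * residue F s) = (\<Sum>s\<in>pts. residue F s)"
  proof (rule sum.cong[OF refl])
    fix s assume "s \<in> pts"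
    then have "s \<in> box a b"
      using assms(6) by (auto simp: pts_def A_def B_def C_def in_box_complex_iff a_def b_def)
    then show "winding_number (rectpath a b) s * residue F s = residue F s"
      by (simp add: winding_number_rectpath)
  qed
  also have "\<dots> = residue F 0 + sum (residue F) A + sum (residue F) B + sum (residue F) C"
  proof -
    have half: "of_nat k + 1/2 \<noteq> (of_int i :: complex)" for k :: nat and i :: int
    proof
      assume "of_nat k + 1/2 = (of_int i :: complex)"
      then have "Re (of_nat k + 1/2) = Re (of_int i)" by (rule arg_cong)
      then have "real_of_int (2 * int k + 1) = real_of_int (2 * i)" by simp
      then have "2 * int k + 1 = 2 * i" by (simp only: of_int_eq_iff)
      then show False by presburger
    qed
    have ints: "s \<in> \<int>" if "s \<in> {0} \<union> A \<union> B" for s using that by (auto simp: A_def B_def)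
    have C: "s \<notin> \<int>" if "s \<in> C" for s using that half by (auto simp: C_def elim!: Ints_cases)
    have "({0} \<union> A \<union> B) \<inter> C = {}" using ints C by blast
    moreover have "({0} \<union> A) \<inter> B = {}"
    proof -
      have "Re s \<ge> 0" if "s \<in> {0} \<union> A" for s using that by (auto simp: A_def)
      moreover have "Re s < 0" if "s \<in> B" for s using that by (auto simp: B_def)
      ultimately show ?thesis by force
    qed
    moreover have "0 \<notin> A" by (auto simp: A_def)
    moreover have fin: "finite A" "finite B" "finite C" by (simp_all add: A_def B_def C_def)
    ultimately have "sum (residue F) pts = sum (residue F) ({0} \<union> A \<union> B) + sum (residue F) C"
      "sum (residue F) ({0} \<union> A \<union> B) = sum (residue F) ({0} \<union> A) + sum (residue F) B"
      unfolding pts_def by (simp_all only: sum.union_disjoint finite_Un fin finite.intros simp_thms)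
    moreover have "sum (residue F) ({0} \<union> A) = residue F 0 + sum (residue F) A"
      using fin(1) \<open>0 \<notin> A\<close> by simp
    ultimately show ?thesis by (simp only:)
  qed
  also have "sum (residue F) A = (\<Sum>n=1..N. residue F (of_nat n))"
    unfolding A_def by (subst sum.reindex) (auto simp: inj_on_def)
  also have "sum (residue F) B = (\<Sum>n=1..N. residue F (- of_nat n))"
    unfolding B_def by (subst sum.reindex) (auto simp: inj_on_def)
  also have "sum (residue F) C = (\<Sum>k<N. residue F (of_nat k + 1/2))"
    unfolding C_def by (subst sum.reindex) (auto simp: inj_on_def)
  finally show "contour_integral (rectpath a b) F = 2 * pi * \<i> * (residue F 0
      + (\<Sum>n=1..N. residue F (of_nat n) + residue F (- of_nat n)) + (\<Sum>k<N. residue F (of_nat k + 1/2)))"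
    by (simp add: sum.distrib add.assoc)
qed

text \<open>
  The contour has half-width \<open>K^4 + 1/4\<close> and half-height \<open>K^3\<close>.  With this choice pointwise bounds suffice
  even for \<open>q = 1\<close>: the short vertical sides are controlled by \<open>1 / norm s\<close>, and on the horizontal sides
  one of the three factors then has sign \<open>-1\<close> and is smaller by a factor \<open>1 / K^3\<close>.
\<close>

lemma residues_euler_kernel_tendsto:
  assumes "\<bar>\<sigma>1\<bar> = 1" "\<bar>\<sigma>2\<bar> = 1" "\<bar>\<tau>\<bar> = 1" "m \<ge> 1" "p \<ge> 1" "q \<ge> 1"
    and "q = 1 \<Longrightarrow> \<tau> = -1 \<or> \<sigma>1 = -1 \<or> \<sigma>2 = -1"
  defines "F \<equiv> euler_kernel m p q \<sigma>1 \<sigma>2 \<tau>"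
  shows "(\<lambda>K. residue F 0 + (\<Sum>n=1..K^4. residue F (of_nat n) + residue F (- of_nat n))
     + (\<Sum>k<K^4. residue F (of_nat k + 1/2))) \<longlonglongrightarrow> 0"
proof -
  obtain C where C: "C \<ge> 0"
    "\<And>N Y s. N \<ge> 2 \<Longrightarrow> 1 \<le> Y \<Longrightarrow> Y \<le> real N \<Longrightarrow> \<bar>Re s\<bar> = real N + 1/4 \<Longrightarrow> \<bar>Im s\<bar> \<le> Y \<Longrightarrow>
       norm (F s) \<le> C * harm (8 * N) ^ 3 / real N"
    "\<And>N Y s. N \<ge> 2 \<Longrightarrow> 1 \<le> Y \<Longrightarrow> Y \<le> real N \<Longrightarrow> \<bar>Re s\<bar> \<le> real N + 1/4 \<Longrightarrow> \<bar>Im s\<bar> = Y \<Longrightarrow>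
       norm (F s) \<le> C * harm (8 * N) ^ 3 / Y ^ 2"
    unfolding F_def using euler_kernel_bound[OF assms(1-7)] by metis
  let ?R = "\<lambda>K. residue F 0 + (\<Sum>n=1..K^4. residue F (of_nat n) + residue F (- of_nat n))
     + (\<Sum>k<K^4. residue F (of_nat k + 1/2))"
  \<comment> \<open>Two sides of length 2 K^4 + 1/2 with a factor 1/K^6 and two of length 2 K^3 with
    a factor 1/K^4, times the cube of a logarithm.\<close>
  let ?E = "\<lambda>K. C * (1 + ln (8 * real K ^ 4)) ^ 3 * (2 * (2 * real K ^ 4 + 1/2) / real K ^ 6 + 4 / real K)"
  have "norm (2 * pi * \<i> * ?R K) \<le> ?E K" if K: "K \<ge> 2" for K
  proof -
    define N where "N = K ^ 4"
    define Y where "Y = real K ^ 3"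
    have "(2::nat) ^ 1 \<le> 2 ^ 4" by simp
    also have "(2::nat) ^ 4 \<le> K ^ 4" using K by (intro power_mono) auto
    finally have N: "N \<ge> 2" by (simp add: N_def)
    have Y: "1 \<le> Y" "Y \<le> real N"
      using K by (auto simp: Y_def N_def intro!: power_increasing)
    define a b where "a = Complex (- (real N + 1/4)) (- Y)" and "b = Complex (real N + 1/4) Y"
    have "Y > 0" using Y by simp
    note ci = contour_integral_rectpath_euler_kernel(1)[OF assms(1-5) this, where N = N and q = q, folded F_def a_def b_def]
      contour_integral_rectpath_euler_kernel(2)[OF assms(1-5) this, where N = N, folded a_def b_def]
    have "norm (contour_integral (rectpath a b) F) \<le> 2 * (C * harm (8 * N) ^ 3 / Y ^ 2) * (Re b - Re a)
        + 2 * (C * harm (8 * N) ^ 3 / real N) * (Im b - Im a)"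
    proof (rule contour_integral_rectpath_bound)
      show "continuous_on (path_image (rectpath a b)) F"
        unfolding F_def
        by (rule holomorphic_on_imp_continuous_on, rule holomorphic_on_subset[OF holomorphic_euler_kernel[OF assms(1-5)]])
           (use ci(2) Y in auto)
    next
      fix s assume "Re s = Re a \<or> Re s = Re b" "Im s \<in> {Im a..Im b}"
      then show "norm (F s) \<le> C * harm (8 * N) ^ 3 / real N"
        by (intro C(2)[OF N Y]) (auto simp: a_def b_def)
    next
      fix s assume "Im s = Im a \<or> Im s = Im b" "Re s \<in> {Re a..Re b}"
      then show "norm (F s) \<le> C * harm (8 * N) ^ 3 / Y ^ 2"
        using Y by (intro C(3)[OF N Y]) (auto simp: a_def b_def)
    qed (use Y in \<open>auto simp: a_def b_def\<close>)
    also have "\<dots> = C * harm (8 * N) ^ 3 * (2 * (2 * real N + 1/2) / Y ^ 2 + 4 * Y / real N)"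
      by (simp add: a_def b_def algebra_simps)
    also have "4 * Y / real N = 4 / real K" using K by (simp add: Y_def N_def field_simps eval_nat_numeral)
    also have "Y ^ 2 = real K ^ 6" by (simp add: Y_def flip: power_mult)
    also have "C * harm (8 * N) ^ 3 * (2 * (2 * real N + 1/2) / real K ^ 6 + 4 / real K)
        \<le> C * (1 + ln (8 * real N)) ^ 3 * (2 * (2 * real N + 1/2) / real K ^ 6 + 4 / real K)"
    proof (intro mult_right_mono mult_left_mono power_mono C(1))
      show "harm (8 * N) \<le> 1 + ln (8 * real N)"
        using harm_le_ln[of "8 * N - 1"] N by simp
    qed (auto simp: harm_nonneg)
    finally have "norm (contour_integral (rectpath a b) F) \<le> ?E K" by (simp add: N_def)
    then show ?thesis using ci(1) by (simp add: N_def)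
  qed
  then have "eventually (\<lambda>K. norm (2 * pi * \<i> * ?R K) \<le> ?E K) sequentially"
    by (intro eventually_sequentiallyI[of 2])
  moreover have "?E \<longlonglongrightarrow> 0" by real_asymp
  ultimately have "(\<lambda>K. 2 * pi * \<i> * ?R K) \<longlonglongrightarrow> 0" by (rule Lim_null_comparison)
  then show ?thesis using tendsto_mult_left_iff[of "2 * pi * \<i>" ?R 0] by simp
qed

section \<open>Summation of the residues\<close>

lemma S_quad_sums:
  assumes "\<bar>\<sigma>1\<bar> = 1" "\<bar>\<sigma>2\<bar> = 1" "\<bar>\<sigma>3\<bar> = 1" "m \<ge> 1" "p \<ge> 1" "q \<ge> 1" "(q, \<sigma>3) \<noteq> (1, 1)"
  shows "(\<lambda>n. \<sigma>3 ^ n * (h_sum m \<sigma>1 (Suc n) * h_sum p \<sigma>2 (Suc n)) / real (Suc n) ^ q) sums S_quad m p q \<sigma>1 \<sigma>2 \<sigma>3"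
proof -
  have "slow (1/4 + 1/4) (\<lambda>n. h_sum m \<sigma>1 (Suc n) * h_sum p \<sigma>2 (Suc n))"
    using assms by (intro slow_mult slow_Suc slow_h_sum) auto
  from summable_slow[OF assms(3,6,7) this] show ?thesis
    unfolding S_quad_def by (intro summable_sums) auto
qed

lemma S_lin_sums:
  assumes "\<bar>\<sigma>1\<bar> = 1" "\<bar>\<sigma>2\<bar> = 1" "p \<ge> 1" "q \<ge> 1" "(q, \<sigma>2) \<noteq> (1, 1)"
  shows "(\<lambda>n. \<sigma>2 ^ n * h_sum p \<sigma>1 (Suc n) / real (Suc n) ^ q) sums S_lin p q \<sigma>1 \<sigma>2"
proof -
  have "slow (1/4) (\<lambda>n. h_sum p \<sigma>1 (Suc n))"
    using assms by (intro slow_Suc slow_h_sum) auto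
  from summable_slow[OF assms(2,4,5) this] show ?thesis
    unfolding S_lin_def by (intro summable_sums) auto
qed

lemma R_lin_sums:
  assumes "\<bar>\<sigma>1\<bar> = 1" "\<bar>\<sigma>2\<bar> = 1" "p \<ge> 1" "q \<ge> 1" "(q, \<sigma>2) \<noteq> (1, 1)"
  shows "(\<lambda>n. \<sigma>2 ^ n * H_sum p \<sigma>1 n / (real (Suc n) - 1/2) ^ q) sums R_lin p q \<sigma>1 \<sigma>2"
  using summable_slow_half[OF assms(2,4,5) slow_H_sum[OF assms(1,3)]]
  unfolding R_lin_def by (intro summable_sums) auto

text \<open>The factor \<sigma> corrects the exponent: n + 1 in the definition of
  \<open>alt_zeta\<close>, but n in the residue series.\<close>

lemma alt_zeta_sums:
  assumes "\<bar>\<sigma>\<bar> = 1" "s \<ge> 1" "(s, \<sigma>) \<noteq> (1, 1)"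
  shows "(\<lambda>n. \<sigma> ^ n / real (Suc n) ^ s) sums (\<sigma> * alt_zeta s \<sigma>)"
proof -
  have s: "summable (\<lambda>n. \<sigma> ^ n / real (Suc n) ^ s)"
    using summable_slow[OF assms slow_const[of 1]] by simp
  have "\<sigma> * alt_zeta s \<sigma> = \<sigma> * (\<Sum>n. \<sigma> * (\<sigma> ^ n / real (Suc n) ^ s))"
    using assms(3) by (auto simp: alt_zeta_def)
  also have "\<dots> = \<sigma> * \<sigma> * (\<Sum>n. \<sigma> ^ n / real (Suc n) ^ s)"
    by (simp only: suminf_mult[OF s] mult.assoc)
  finally show ?thesis using summable_sums[OF s] sign_square[OF assms(1)] by simp
qed

lemma alt_t_sums:
  assumes "\<bar>\<sigma>\<bar> = 1" "s \<ge> 1" "(s, \<sigma>) \<noteq> (1, 1)"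
  shows "(\<lambda>n. \<sigma> ^ n / (real (Suc n) - 1/2) ^ s) sums (\<sigma> * alt_t s \<sigma>)"
proof -
  have s: "summable (\<lambda>n. \<sigma> ^ n / (real (Suc n) - 1/2) ^ s)"
    using summable_slow_half[OF assms slow_const[of 1]] by simp
  have "\<sigma> * alt_t s \<sigma> = \<sigma> * (\<Sum>n. \<sigma> * (\<sigma> ^ n / (real (Suc n) - 1/2) ^ s))"
    using assms(3) by (auto simp: alt_t_def)
  also have "\<dots> = \<sigma> * \<sigma> * (\<Sum>n. \<sigma> ^ n / (real (Suc n) - 1/2) ^ s)"
    by (simp only: suminf_mult[OF s] mult.assoc)
  finally show ?thesis using summable_sums[OF s] sign_square[OF assms(1)] by simp
qed

section \<open>Reindexing of finite sums and parity signs\<close>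

lemma sum_pairs_eq:
  fixes f :: "nat \<Rightarrow> nat \<Rightarrow> real"
  shows "(\<Sum>(k1, k2) \<in> {(k1, k2). k1 + k2 = n}. f k1 k2) = (\<Sum>i=0..n. f i (n - i))"
proof -
  have "{(k1, k2). k1 + k2 = n} = (\<lambda>i. (i, n - i)) ` {0..n}" by force
  then show ?thesis by (simp add: sum.reindex inj_on_def)
qed

lemma sum_from_1_shift:
  fixes f :: "nat \<Rightarrow> real"
  assumes "m \<ge> 1"
  shows "(\<Sum>j=1..m. f j) = (\<Sum>i=0..m-1. f (Suc i))"
  using assms sum.shift_bounds_cl_Suc_ivl[of f 0 "m - 1"] by simp

text \<open>For the coefficients of an odd function: k = 2j - 1 makes the zeta argument k + 1 equal
  to 2j.\<close>

lemma sum_odd_indices: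
  fixes f :: "nat \<Rightarrow> real"
  assumes "q \<ge> 1" "\<And>k. even k \<Longrightarrow> f k = 0"
  shows "(\<Sum>k=0..q-1. f k) = (\<Sum>j=1..q div 2. f (2 * j - 1))"
proof -
  have "(\<Sum>k=0..q-1. f k) = (\<Sum>k | k \<le> q - 1 \<and> odd k. f k)"
    by (rule sum.mono_neutral_right) (use assms in auto)
  also have "\<dots> = (\<Sum>j=1..q div 2. f (2 * j - 1))"
  proof (rule sum.reindex_bij_witness[of _ "\<lambda>j. 2 * j - 1" "\<lambda>k. (k + 1) div 2"])
    fix k assume k: "k \<in> {k. k \<le> q - 1 \<and> odd k}"
    then obtain i where "k = 2 * i + 1" by (auto elim: oddE)
    then show "2 * ((k + 1) div 2) - 1 = k" "(k + 1) div 2 \<in> {1..q div 2}" "f (2 * ((k + 1) div 2) - 1) = f k"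
      using k assms(1) by auto
  next
    fix j assume j: "j \<in> {1..q div 2}"
    then show "(2 * j - 1 + 1) div 2 = j" "2 * j - 1 \<in> {k. k \<le> q - 1 \<and> odd k}"
      by auto
  qed
  finally show ?thesis .
qed

lemma choose_pred_symmetric:
  assumes "m \<ge> 1"
  shows "(m + i - 1) choose i = (m + i - 1) choose (m - 1)"
  using binomial_symmetric[of i "m + i - 1"] assms by simp

text \<open>Either the parity factor vanishes or (-1)^k = -\<tau>. In this way signs that depend on
  the summation index k leave the sums of the second and third terms.\<close>

lemma parity_delta_times_sign:
  assumes "\<bar>\<tau>\<bar> = 1"
  shows "parity_delta \<tau> k * (-1) ^ k = - \<tau> * parity_delta \<tau> k"
  using sign_square[OF assms] by (cases "even k") (simp_all add: parity_delta_def algebra_simps)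

section \<open>Assembly of the identity for fixed parameters\<close>

context
  fixes m p q :: nat and \<sigma>1 \<sigma>2 \<sigma>3 \<tau> :: real
  assumes pos: "m \<ge> 1" "p \<ge> 1" "q \<ge> 1"
    and signs: "\<bar>\<sigma>1\<bar> = 1" "\<bar>\<sigma>2\<bar> = 1" "\<bar>\<sigma>3\<bar> = 1"
    and q\<sigma>: "(q, \<sigma>3) \<noteq> (1, 1)"
    and \<tau>: "\<tau> = \<sigma>1 * \<sigma>2 * \<sigma>3"
begin

text \<open>Sum of the residues at n and -n, in the shape of the two residue formulas so that these
  apply directly.\<close>

abbreviation "pair_res n \<equiv> \<tau> ^ n * (\<sigma>1 ^ n * \<sigma>1 * (alt_t m \<sigma>1 + (-1) ^ m * h_sum m \<sigma>1 n))
         * (\<sigma>2 ^ n * \<sigma>2 * (alt_t p \<sigma>2 + (-1) ^ p * h_sum p \<sigma>2 n)) / real n ^ q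
      + \<tau> ^ n * (\<sigma>1 ^ n * (\<sigma>1 * alt_t m \<sigma>1 - h_sum m \<sigma>1 n))
         * (\<sigma>2 ^ n * (\<sigma>2 * alt_t p \<sigma>2 - h_sum p \<sigma>2 n)) * ((-1) ^ q / real n ^ q)"

lemma abs_\<tau>: "\<bar>\<tau>\<bar> = 1" using signs by (simp add: \<tau> abs_mult)

lemma sign_powers: "\<tau> ^ n * \<sigma>1 ^ n * \<sigma>2 ^ n = \<sigma>3 ^ n"
proof -
  have "\<tau> * \<sigma>1 * \<sigma>2 = (\<sigma>1 * \<sigma>1) * (\<sigma>2 * \<sigma>2) * \<sigma>3" by (simp add: \<tau>)
  then have "\<tau> * \<sigma>1 * \<sigma>2 = \<sigma>3" using sign_square signs by simp
  then show ?thesis by (simp flip: power_mult_distrib)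
qed

lemma q_plus_ne: "(q + l, \<sigma>3) \<noteq> (1, 1)"
  using q\<sigma> pos by auto

text \<open>Multiplying out separates four series, each convergent by itself: products of two
  harmonic sums give the quadratic sum with its parity factor, and the other three make up the first
  term.\<close>

lemma pair_res_sums:
  "(\<lambda>n. pair_res (Suc n)) sums
     ((-1) ^ (m + p) * (\<tau> * parity_delta (\<sigma>1 * \<sigma>2) (m + p + q - 1) * S_quad m p q \<sigma>1 \<sigma>2 \<sigma>3
        - term1 m p q \<sigma>1 \<sigma>2 \<sigma>3))"
proof -
  let ?h1 = "\<lambda>n. h_sum m \<sigma>1 (Suc n)" and ?h2 = "\<lambda>n. h_sum p \<sigma>2 (Suc n)" and ?d = "\<lambda>n. real (Suc n) ^ q"
  let ?t1 = "alt_t m \<sigma>1" and ?t2 = "alt_t p \<sigma>2"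
  let ?em = "(-1) ^ m :: real" and ?ep = "(-1) ^ p :: real" and ?eq = "(-1) ^ q :: real"
  have eq: "pair_res (Suc n) = \<sigma>3 * (
      (\<sigma>1 * \<sigma>2 * ?em * ?ep + ?eq) * (\<sigma>3 ^ n * (?h1 n * ?h2 n) / ?d n)
      + (\<sigma>1 * \<sigma>2 * ?ep - ?eq * \<sigma>1) * ?t1 * (\<sigma>3 ^ n * ?h2 n / ?d n)
      + (\<sigma>1 * \<sigma>2 * ?em - ?eq * \<sigma>2) * ?t2 * (\<sigma>3 ^ n * ?h1 n / ?d n)
      + \<sigma>1 * \<sigma>2 * (1 + ?eq) * ?t1 * ?t2 * (\<sigma>3 ^ n / ?d n))" for n
  proof -
    have "pair_res (Suc n) = (\<tau> ^ Suc n * \<sigma>1 ^ Suc n * \<sigma>2 ^ Suc n) / ?d n *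
       (\<sigma>1 * (?t1 + ?em * ?h1 n) * (\<sigma>2 * (?t2 + ?ep * ?h2 n)) + (\<sigma>1 * ?t1 - ?h1 n) * (\<sigma>2 * ?t2 - ?h2 n) * ?eq)"
    proof -
      have "t * (a * s * A) * (b * s' * B) / d + t * (a * A') * (b * B') * (e / d)
         = (t * a * b) / d * (s * A * (s' * B) + A' * B' * e)" for t a b s s' A B A' B' d e :: real
        by (simp add: divide_inverse algebra_simps)
      then show ?thesis .
    qed
    also have "\<dots> = (\<sigma>3 * \<sigma>3 ^ n) / ?d n *
       (\<sigma>1 * (?t1 + ?em * ?h1 n) * (\<sigma>2 * (?t2 + ?ep * ?h2 n)) + (\<sigma>1 * ?t1 - ?h1 n) * (\<sigma>2 * ?t2 - ?h2 n) * ?eq)"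
      unfolding sign_powers by (simp only: power_Suc)
    also have "x / d * (\<sigma>1 * (t1 + em * h1) * (\<sigma>2 * (t2 + ep * h2)) + (\<sigma>1 * t1 - h1) * (\<sigma>2 * t2 - h2) * e)
       = (\<sigma>1 * \<sigma>2 * em * ep + e) * (x * (h1 * h2) / d) + (\<sigma>1 * \<sigma>2 * ep - e * \<sigma>1) * t1 * (x * h2 / d)
         + (\<sigma>1 * \<sigma>2 * em - e * \<sigma>2) * t2 * (x * h1 / d) + \<sigma>1 * \<sigma>2 * (1 + e) * t1 * t2 * (x / d)" for x d t1 t2 em ep e h1 h2
      by (simp add: divide_inverse algebra_simps)
    finally show ?thesis by (simp add: distrib_left mult_ac)
  qed
  have sums: "(\<lambda>n. pair_res (Suc n)) sums (\<sigma>3 * (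
      (\<sigma>1 * \<sigma>2 * ?em * ?ep + ?eq) * S_quad m p q \<sigma>1 \<sigma>2 \<sigma>3
      + (\<sigma>1 * \<sigma>2 * ?ep - ?eq * \<sigma>1) * ?t1 * S_lin p q \<sigma>2 \<sigma>3
      + (\<sigma>1 * \<sigma>2 * ?em - ?eq * \<sigma>2) * ?t2 * S_lin m q \<sigma>1 \<sigma>3
      + \<sigma>1 * \<sigma>2 * (1 + ?eq) * ?t1 * ?t2 * (\<sigma>3 * alt_zeta q \<sigma>3)))"
    unfolding eq
    by (intro sums_mult sums_add S_quad_sums S_lin_sums alt_zeta_sums signs pos q\<sigma>)
  have "\<sigma>3 * (
      (\<sigma>1 * \<sigma>2 * ?em * ?ep + ?eq) * S_quad m p q \<sigma>1 \<sigma>2 \<sigma>3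
      + (\<sigma>1 * \<sigma>2 * ?ep - ?eq * \<sigma>1) * ?t1 * S_lin p q \<sigma>2 \<sigma>3
      + (\<sigma>1 * \<sigma>2 * ?em - ?eq * \<sigma>2) * ?t2 * S_lin m q \<sigma>1 \<sigma>3
      + \<sigma>1 * \<sigma>2 * (1 + ?eq) * ?t1 * ?t2 * (\<sigma>3 * alt_zeta q \<sigma>3))
      = (-1) ^ (m + p) * (\<tau> * parity_delta (\<sigma>1 * \<sigma>2) (m + p + q - 1) * S_quad m p q \<sigma>1 \<sigma>2 \<sigma>3
        - term1 m p q \<sigma>1 \<sigma>2 \<sigma>3)"
  proof -
    have e: "(-1) ^ (m + p + q - 1) = - (?em * ?ep * ?eq)"
    proof -
      have "(-1 :: real) ^ Suc (m + p + q - 1) = ?em * ?ep * ?eq" using pos by (simp add: power_add)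
      then show ?thesis by simp
    qed
    have s: "\<sigma>1 = 1 \<or> \<sigma>1 = -1" "\<sigma>2 = 1 \<or> \<sigma>2 = -1" "\<sigma>3 = 1 \<or> \<sigma>3 = -1" using signs by linarith+
    have es: "?em = 1 \<or> ?em = -1" "?ep = 1 \<or> ?ep = -1" "?eq = 1 \<or> ?eq = -1"
      by (metis minus_one_power_iff)+
    \<comment> \<open>With powers of -1 abstracted to variables, the claim is a polynomial identity
      for each choice of the signs.\<close>
    have alg: "s3 * ((s1 * s2 * em * ep + e) * S + (s1 * s2 * ep - e * s1) * t1 * S1
      + (s1 * s2 * em - e * s2) * t2 * S2 + s1 * s2 * (1 + e) * t1 * t2 * (s3 * z))
      = em * ep * (s1 * s2 * s3 * (1 - s1 * s2 * - (em * ep * e)) * S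
         - (- (s1 * s2 * s3) * em * (1 - s2 * (ep * e)) * t1 * S1
            - (s1 * s2 * s3) * ep * (1 - s1 * (em * e)) * t2 * S2
            - s1 * s2 * (em * ep) * (1 + e) * t1 * t2 * z))"
      if "s1 = 1 \<or> s1 = -1" "s2 = 1 \<or> s2 = -1" "s3 = 1 \<or> s3 = -1" "em = 1 \<or> em = -1" "ep = 1 \<or> ep = -1"
      for s1 s2 s3 em ep e S t1 t2 S1 S2 z :: real
      using that by (elim disjE) (simp_all add: algebra_simps)
    show ?thesis
      unfolding parity_delta_def e term1_def Let_def \<tau> power_add
      by (rule alg[OF s es(1,2)])
  qed
  from sums[unfolded this] show ?thesis .
qed

text \<open>Taylor coefficients at b + 1/2, with the factor of 1/s^q independent of b split off as
  \<open>power_const\<close>. \<open>reg_power_sum\<close> is the result of summing a product of two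
  of them over b.\<close>

abbreviation "lattice_coeff k \<equiv> - parity_delta \<tau> k * alt_t (k + 1) \<tau>"
abbreviation "power_const l \<equiv> (-1) ^ l * real ((q + l - 1) choose l)"
abbreviation "power_coeff b l \<equiv> power_const l / (real b + 1/2) ^ (q + l)"
abbreviation "reg_coeff \<sigma> n b i \<equiv> real ((n + i - 1) choose i) * (alt_zeta (n + i) \<sigma> + (-1) ^ (n + i) * \<sigma> * H_sum (n + i) \<sigma> b)"
abbreviation "reg_power_sum \<sigma> n i l \<equiv> real ((n + i - 1) choose i) * power_const l * (alt_zeta (n + i) \<sigma> * (\<sigma>3 * alt_t (q + l) \<sigma>3)
     + (-1) ^ (n + i) * \<sigma> * R_lin (n + i) (q + l) \<sigma> \<sigma>3)"

lemma power_coeff_sums: "(\<lambda>b. \<sigma>3 ^ b * power_coeff b l) sums (power_const l * (\<sigma>3 * alt_t (q + l) \<sigma>3))"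
proof -
  have "q + l \<ge> 1" using pos by simp
  from sums_mult[OF alt_t_sums[OF signs(3) this q_plus_ne], of "power_const l"]
  have "(\<lambda>b. power_const l * (\<sigma>3 ^ b / (real (Suc b) - 1/2) ^ (q + l))) sums (power_const l * (\<sigma>3 * alt_t (q + l) \<sigma>3))" .
  moreover have "power_const l * (\<sigma>3 ^ b / (real (Suc b) - 1/2) ^ (q + l)) = \<sigma>3 ^ b * power_coeff b l" for b
  proof -
    have "real (Suc b) - 1/2 = real b + 1/2" by simp
    then show ?thesis by (simp only: mult_ac divide_inverse)
  qed
  ultimately show ?thesis by (simp only:)
qed

text \<open>The pole b + 1/2 corresponds to n = b + 1 in the linear sums, so \<open>H_sum\<close> up
  to b is the H_(n-1) of the R-sums. The zeta part does not depend on b and leaves a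
  t-value.\<close>

lemma reg_coeff_sums:
  assumes "\<bar>\<sigma>\<bar> = 1" "n \<ge> 1"
  shows "(\<lambda>b. \<sigma>3 ^ b * (reg_coeff \<sigma> n b i * power_coeff b l)) sums reg_power_sum \<sigma> n i l"
proof -
  have "q + l \<ge> 1" "n + i \<ge> 1" using pos assms by auto
  let ?B = "real ((n + i - 1) choose i)" and ?z = "alt_zeta (n + i) \<sigma>"
  have "(\<lambda>b. ?B * power_const l * (?z * (\<sigma>3 ^ b / (real (Suc b) - 1/2) ^ (q + l))
      + (-1) ^ (n + i) * \<sigma> * (\<sigma>3 ^ b * H_sum (n + i) \<sigma> b / (real (Suc b) - 1/2) ^ (q + l)))) sums reg_power_sum \<sigma> n i l"
    by (intro sums_mult sums_add alt_t_sums R_lin_sums signs assms q_plus_ne \<open>q + l \<ge> 1\<close> \<open>n + i \<ge> 1\<close>)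
  moreover have "?B * power_const l * (?z * (\<sigma>3 ^ b / (real (Suc b) - 1/2) ^ (q + l))
      + (-1) ^ (n + i) * \<sigma> * (\<sigma>3 ^ b * H_sum (n + i) \<sigma> b / (real (Suc b) - 1/2) ^ (q + l)))
      = \<sigma>3 ^ b * (reg_coeff \<sigma> n b i * power_coeff b l)" for b
  proof -
    have "real (Suc b) - 1/2 = real b + 1/2" by simp
    moreover have "B * d * (z * (s / y) + e * (s * h / y)) = s * (B * (z + e * h) * (d / y))" for B d z s y e h :: real
      by (simp add: divide_inverse algebra_simps)
    ultimately show ?thesis by (simp only:)
  qed
  ultimately show ?thesis by (simp only:)
qed

abbreviation "half_res b \<equiv> \<tau> ^ b * \<sigma>1 ^ b * \<sigma>2 ^ b * (
         (-1) ^ (m + p) * (\<Sum>k=0..m+p-1. lattice_coeff k * power_coeff b (m + p - 1 - k))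
         + (-1) ^ m * (\<Sum>i=0..m-1. reg_coeff \<sigma>2 p b i * (\<Sum>k=0..m-1-i. lattice_coeff k * power_coeff b (m - 1 - i - k)))
         + (-1) ^ p * (\<Sum>i=0..p-1. reg_coeff \<sigma>1 m b i * (\<Sum>k=0..p-1-i. lattice_coeff k * power_coeff b (p - 1 - i - k))))"

lemma half_res_sums_aux:
  "half_res sums (
         (-1) ^ (m + p) * (\<Sum>k=0..m+p-1. lattice_coeff k * (power_const (m + p - 1 - k) * (\<sigma>3 * alt_t (q + (m + p - 1 - k)) \<sigma>3)))
         + (-1) ^ m * (\<Sum>i=0..m-1. \<Sum>k=0..m-1-i. lattice_coeff k * reg_power_sum \<sigma>2 p i (m - 1 - i - k))
         + (-1) ^ p * (\<Sum>i=0..p-1. \<Sum>k=0..p-1-i. lattice_coeff k * reg_power_sum \<sigma>1 m i (p - 1 - i - k)))"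
proof -
  have eq: "half_res b =
         (-1) ^ (m + p) * (\<Sum>k=0..m+p-1. lattice_coeff k * (\<sigma>3 ^ b * power_coeff b (m + p - 1 - k)))
         + (-1) ^ m * (\<Sum>i=0..m-1. \<Sum>k=0..m-1-i. lattice_coeff k * (\<sigma>3 ^ b * (reg_coeff \<sigma>2 p b i * power_coeff b (m - 1 - i - k))))
         + (-1) ^ p * (\<Sum>i=0..p-1. \<Sum>k=0..p-1-i. lattice_coeff k * (\<sigma>3 ^ b * (reg_coeff \<sigma>1 m b i * power_coeff b (p - 1 - i - k))))" for b
  proof -
    have 1: "s * (\<Sum>k=0..n. f k * g k) = (\<Sum>k=0..n. f k * (s * g k))" for s n and f g :: "nat \<Rightarrow> real"
      by (simp add: sum_distrib_left mult_ac)
    have 2: "s * (\<Sum>i=0..n. t i * (\<Sum>k=0..N i. f k * g i k)) = (\<Sum>i=0..n. \<Sum>k=0..N i. f k * (s * (t i * g i k)))"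
      for s n and f t :: "nat \<Rightarrow> real" and N g
      by (simp add: sum_distrib_left mult_ac)
    have 3: "s * (a * x + b * y + d * z) = a * (s * x) + b * (s * y) + d * (s * z)" for s a b d x y z :: real
      by (simp add: algebra_simps)
    show ?thesis unfolding sign_powers 3
      by (intro arg_cong2[of _ _ _ _ "(+)"] arg_cong2[of _ _ _ _ "(*)"] refl 1 2)
  qed
  show ?thesis unfolding eq
    by (intro sums_add sums_mult sums_sum power_coeff_sums reg_coeff_sums signs pos)
qed

text \<open>Dictionary: j = i + 1 and M + q - j - k = q + l, with M either m or p. The sign (-1)^l
  of 1/s^q still depends on i and k; the parity factor removes k, and (-1)^i passes into the sign of
  the zeta part.\<close>

lemma reg_power_sum_term:
  assumes "\<bar>s1\<bar> = 1" "\<bar>s2\<bar> = 1" "\<tau> = s1 * s2 * \<sigma>3" "n \<ge> 1" "M = Suc (i + k + l)"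
  shows "(-1) ^ M * (lattice_coeff k * reg_power_sum s2 n i l) = - ((-1) ^ (M + n)) * (s1 * \<sigma>3 * (-1) ^ M * (
     real ((n + Suc i - 2) choose (n - 1)) * real ((M + q - Suc i - k - 1) choose (q - 1)) * parity_delta \<tau> k * alt_t (k + 1) \<tau>
          * (R_lin (n + Suc i - 1) (M + q - Suc i - k) s2 \<sigma>3
             - s2 * \<sigma>3 * (-1) ^ (n + Suc i) * alt_zeta (n + Suc i - 1) s2 * alt_t (M + q - Suc i - k) \<sigma>3)))"
proof -
  have idx: "n + Suc i - 2 = n + i - 1" "M + q - Suc i - k = q + l" "n + Suc i - 1 = n + i"
    using assms(4,5) pos by auto
  have b: "(n + i - 1) choose i = (n + i - 1) choose (n - 1)" "(q + l - 1) choose l = (q + l - 1) choose (q - 1)"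
    using choose_pred_symmetric assms(4) pos by auto
  define ei ek el en :: real where "ei = (-1) ^ i" and "ek = (-1) ^ k" and "el = (-1) ^ l" and "en = (-1) ^ n"
  have e: "ei = 1 \<or> ei = -1" "ek = 1 \<or> ek = -1" "el = 1 \<or> el = -1" "en = 1 \<or> en = -1"
    unfolding ei_def ek_def el_def en_def by (metis minus_one_power_iff)+
  have s: "s1 = 1 \<or> s1 = -1" "s2 = 1 \<or> s2 = -1" "\<sigma>3 = 1 \<or> \<sigma>3 = -1"
    using assms(1,2) signs(3) by linarith+
  have pd: "parity_delta \<tau> k * ek = - (s1 * s2 * \<sigma>3) * parity_delta \<tau> k"
    using parity_delta_times_sign[OF abs_\<tau>] unfolding ek_def assms(3) .
  have pw: "(-1) ^ M = - (ei * ek * el)" "(-1) ^ (M + n) = - (ei * ek * el) * en"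
    "(-1) ^ (n + i) = en * ei" "(-1) ^ (n + Suc i) = - (en * ei)" "(-1) ^ l = el"
    unfolding assms(5) ei_def ek_def el_def en_def by (simp_all add: power_add)
  have alg: "- (ei * ek * el) * (- D * t' * (B1 * (el * B2) * (z * (s3 * t) + en * ei * s2 * R)))
     = - (- (ei * ek * el) * en) * (s1 * s3 * - (ei * ek * el) * (B1 * B2 * D * t' * (R - s2 * s3 * - (en * ei) * z * t)))"
    if "ei = 1 \<or> ei = -1" "ek = 1 \<or> ek = -1" "el = 1 \<or> el = -1" "en = 1 \<or> en = -1"
      "s1 = 1 \<or> s1 = -1" "s2 = 1 \<or> s2 = -1" "s3 = 1 \<or> s3 = -1" "D * ek = - (s1 * s2 * s3) * D"
    for ei ek el en s1 s2 s3 D t' B1 B2 z t R :: real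
  proof -
    have "el * el = 1" "ei * ei = 1" "ek * ek = 1" "s3 * s3 = 1" using that(1,2,3,7) by auto
    have "- (ei * ek * el) * (- D * t' * (B1 * (el * B2) * (z * (s3 * t) + en * ei * s2 * R)))
      = (el * el) * (D * ek) * t' * B1 * B2 * (ei * z * s3 * t + en * (ei * ei) * s2 * R)"
      by (simp add: algebra_simps)
    also have "\<dots> = - (s1 * s2 * s3) * D * t' * B1 * B2 * (ei * z * s3 * t + en * s2 * R)"
      unfolding that(8) \<open>el * el = 1\<close> \<open>ei * ei = 1\<close> by simp
    also have "\<dots> = - (D * t' * B1 * B2 * (s1 * s2 * ei * z * t * (s3 * s3) + en * s1 * s3 * R * (s2 * s2)))"
      by (simp add: algebra_simps)
    also have "s2 * s2 = 1" using that(6) by auto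
    finally have L: "- (ei * ek * el) * (- D * t' * (B1 * (el * B2) * (z * (s3 * t) + en * ei * s2 * R)))
       = - (D * t' * B1 * B2 * (s1 * s2 * ei * z * t + en * s1 * s3 * R))"
      unfolding \<open>s3 * s3 = 1\<close> by simp
    have "- (- (ei * ek * el) * en) * (s1 * s3 * - (ei * ek * el) * (B1 * B2 * D * t' * (R - s2 * s3 * - (en * ei) * z * t)))
      = - ((ei * ei) * (ek * ek) * (el * el) * D * t' * B1 * B2 * (en * s1 * s3 * R + s1 * s2 * ei * z * t * (s3 * s3) * (en * en)))"
      by (simp add: algebra_simps)
    also have "en * en = 1" using that(4) by auto
    finally show ?thesis
      unfolding L \<open>el * el = 1\<close> \<open>ei * ei = 1\<close> \<open>ek * ek = 1\<close> \<open>s3 * s3 = 1\<close> by (simp add: algebra_simps)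
  qed
  show ?thesis unfolding idx b pw by (rule alg[OF e s pd])
qed

text \<open>Here l = m + p - 1 - k, and \<open>parity_delta_times_sign\<close> turns the alternating
  sign (-1)^l into a constant one.\<close>

lemma power_coeff_term:
  assumes "m + p = Suc (k + l)"
  shows "(-1) ^ (m + p) * (lattice_coeff k * (power_const l * (\<sigma>3 * alt_t (q + l) \<sigma>3))) = - ((-1) ^ (m + p)) * (\<sigma>1 * \<sigma>2 * (-1) ^ (m + p) * (
     real ((m + p + q - k - 2) choose (q - 1)) * parity_delta \<tau> k
          * alt_t (k + 1) \<tau> * alt_t (m + p + q - k - 1) \<sigma>3))"
proof -
  have idx: "m + p + q - k - 2 = q + l - 1" "m + p + q - k - 1 = q + l" using assms pos by auto
  have b: "(q + l - 1) choose l = (q + l - 1) choose (q - 1)"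
    using choose_pred_symmetric pos by auto
  define ek el :: real where "ek = (-1) ^ k" and "el = (-1) ^ l"
  have e: "ek * ek = 1" "el * el = 1"
    by (simp_all add: ek_def el_def flip: power_mult_distrib)
  have pw: "(-1) ^ (m + p) = - (ek * el)" "(-1) ^ l = el"
    unfolding assms ek_def el_def by (simp_all add: power_add)
  have pd: "parity_delta \<tau> k * ek = - \<tau> * parity_delta \<tau> k"
    using parity_delta_times_sign[OF abs_\<tau>] unfolding ek_def .
  have "\<tau> * \<sigma>3 = \<sigma>1 * \<sigma>2" using sign_square[OF signs(3)] by (simp add: \<tau> mult.assoc)
  have alg: "- (ek * el) * (- D * t' * (el * B * (s3 * t))) = - (- (ek * el)) * (s12 * - (ek * el) * (B * D * t' * t))"
    if "D * ek = - u * D" "u * s3 = s12" "ek * ek = 1" "el * el = 1" for ek el D t' B s3 t s12 u :: real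
  proof -
    have "- (ek * el) * (- D * t' * (el * B * (s3 * t))) = (el * el) * (D * ek) * t' * B * s3 * t" by (simp add: algebra_simps)
    also have "\<dots> = 1 * (- u * D) * t' * B * s3 * t" unfolding that(1,4) ..
    also have "\<dots> = - ((u * s3) * D * t' * B * t)" by (simp add: mult_ac)
    also have "\<dots> = - ((ek * ek) * (el * el) * s12 * (B * D * t' * t))"
      unfolding that(2,3,4) by (simp add: mult_ac)
    finally show ?thesis by (simp add: algebra_simps)
  qed
  show ?thesis unfolding idx b pw by (rule alg[OF pd \<open>\<tau> * \<sigma>3 = \<sigma>1 * \<sigma>2\<close> e])
qed

lemma reg_power_double_sum:
  assumes "\<bar>s1\<bar> = 1" "\<bar>s2\<bar> = 1" "\<tau> = s1 * s2 * \<sigma>3" "n \<ge> 1" "M \<ge> 1"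
  shows "(-1) ^ M * (\<Sum>i=0..M-1. \<Sum>k=0..M-1-i. lattice_coeff k * reg_power_sum s2 n i (M - 1 - i - k)) =
    - ((-1) ^ (M + n)) * (s1 * \<sigma>3 * (-1) ^ M * (\<Sum>j=1..M. \<Sum>k=0..M-j.
     real ((n + j - 2) choose (n - 1)) * real ((M + q - j - k - 1) choose (q - 1)) * parity_delta \<tau> k * alt_t (k + 1) \<tau>
          * (R_lin (n + j - 1) (M + q - j - k) s2 \<sigma>3
             - s2 * \<sigma>3 * (-1) ^ (n + j) * alt_zeta (n + j - 1) s2 * alt_t (M + q - j - k) \<sigma>3)))"
    (is "_ = - ?e * (?f * (\<Sum>j=1..M. \<Sum>k=0..M-j. ?g j k))")
proof -
  have "(-1) ^ M * (\<Sum>i=0..M-1. \<Sum>k=0..M-1-i. lattice_coeff k * reg_power_sum s2 n i (M - 1 - i - k))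
     = (\<Sum>i=0..M-1. \<Sum>k=0..M-1-i. (-1) ^ M * (lattice_coeff k * reg_power_sum s2 n i (M - 1 - i - k)))"
    by (simp only: sum_distrib_left)
  also have "\<dots> = (\<Sum>i=0..M-1. \<Sum>k=0..M-1-i. - ?e * (?f * ?g (Suc i) k))"
  proof (intro sum.cong refl)
    fix i k assume "i \<in> {0..M-1}" "k \<in> {0..M-1-i}"
    then have "M = Suc (i + k + (M - 1 - i - k))" using assms(5) by auto
    from reg_power_sum_term[OF assms(1-4) this]
    show "(-1) ^ M * (lattice_coeff k * reg_power_sum s2 n i (M - 1 - i - k)) = - ?e * (?f * ?g (Suc i) k)" .
  qed
  also have "\<dots> = - ?e * (?f * (\<Sum>i=0..M-1. \<Sum>k=0..M-Suc i. ?g (Suc i) k))"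
    by (simp only: sum_distrib_left diff_Suc_eq_diff_pred)
  finally show ?thesis unfolding sum_from_1_shift[OF assms(5)] .
qed

lemma half_res_sums:
  "half_res sums (- ((-1) ^ (m + p)) * (term2 m p q \<sigma>1 \<sigma>2 \<sigma>3 + term3 m p q \<sigma>1 \<sigma>2 \<sigma>3))"
proof -
  let ?g = "\<lambda>k. real ((m + p + q - k - 2) choose (q - 1)) * parity_delta \<tau> k
          * alt_t (k + 1) \<tau> * alt_t (m + p + q - k - 1) \<sigma>3"
  have "(-1) ^ (m + p) * (\<Sum>k=0..m+p-1. lattice_coeff k * (power_const (m + p - 1 - k) * (\<sigma>3 * alt_t (q + (m + p - 1 - k)) \<sigma>3)))
     = (\<Sum>k=0..m+p-1. (-1) ^ (m + p) * (lattice_coeff k * (power_const (m + p - 1 - k) * (\<sigma>3 * alt_t (q + (m + p - 1 - k)) \<sigma>3))))"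
    by (simp only: sum_distrib_left)
  also have "\<dots> = (\<Sum>k=0..m+p-1. - ((-1) ^ (m + p)) * (\<sigma>1 * \<sigma>2 * (-1) ^ (m + p) * ?g k))"
  proof (intro sum.cong refl power_coeff_term)
    fix k assume "k \<in> {0..m+p-1}"
    then show "m + p = Suc (k + (m + p - 1 - k))" using pos by auto
  qed
  also have "\<dots> = - ((-1) ^ (m + p)) * term2 m p q \<sigma>1 \<sigma>2 \<sigma>3"
    unfolding term2_def Let_def \<tau> by (simp only: sum_distrib_left)
  finally have 2: "(-1) ^ (m + p) * (\<Sum>k=0..m+p-1. lattice_coeff k * (power_const (m + p - 1 - k) * (\<sigma>3 * alt_t (q + (m + p - 1 - k)) \<sigma>3)))
     = - ((-1) ^ (m + p)) * term2 m p q \<sigma>1 \<sigma>2 \<sigma>3" .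
  \<comment> \<open>The second half of the third term is the first with (m, \<sigma>1) and (p,
    \<sigma>2) exchanged.\<close>
  have "\<tau> = \<sigma>2 * \<sigma>1 * \<sigma>3" by (simp add: \<tau>)
  note 3 = reg_power_double_sum[OF signs(1,2) \<tau> pos(2,1)] reg_power_double_sum[OF signs(2,1) this pos(1,2)]
  show ?thesis
    using half_res_sums_aux unfolding 2 3 term3_def Let_def \<tau>[symmetric]
    by (simp only: distrib_left add.assoc add.commute[of p m])
qed

lemma residue_0_eq:
  fixes A B \<psi> :: "nat \<Rightarrow> real"
  defines "A \<equiv> (\<lambda>i. real ((m + i - 1) choose i) * (\<sigma>1 * alt_t (m + i) \<sigma>1))"
    and "B \<equiv> (\<lambda>i. real ((p + i - 1) choose i) * (\<sigma>2 * alt_t (p + i) \<sigma>2))"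
    and "\<psi> \<equiv> (\<lambda>i. ((-1) ^ i - 1) * alt_zeta (i + 1) \<tau>)"
  shows "(\<Sum>i=0..q. A i * B (q - i)) + (\<Sum>k=0..q-1. \<psi> k * (\<Sum>i=0..q-1-k. A i * B (q - 1 - k - i)))
     = - ((-1) ^ (m + p)) * (term4 m p q \<sigma>1 \<sigma>2 + term5 m p q \<sigma>1 \<sigma>2 \<sigma>3)"
proof -
  let ?g = "\<lambda>k1 k2. real ((m + k1 - 1) choose (m - 1)) * real ((p + k2 - 1) choose (p - 1))
          * alt_t (m + k1) \<sigma>1 * alt_t (p + k2) \<sigma>2"
  let ?P = "\<lambda>n. \<Sum>i=0..n. ?g i (n - i)"
  have AB: "(\<Sum>i=0..n. A i * B (n - i)) = \<sigma>1 * \<sigma>2 * ?P n" for n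
    unfolding A_def B_def choose_pred_symmetric[OF pos(1)] choose_pred_symmetric[OF pos(2)]
    by (simp add: sum_distrib_left mult_ac)
  have e: "(-1) ^ (m + p) * ((-1) ^ (m + p) * x) = x" for x :: real
    by (simp flip: mult.assoc power_mult_distrib)
  have 4: "- ((-1) ^ (m + p)) * term4 m p q \<sigma>1 \<sigma>2 = \<sigma>1 * \<sigma>2 * ?P q"
  proof -
    have "- ((-1) ^ (m + p)) * term4 m p q \<sigma>1 \<sigma>2 = (-1) ^ (m + p) * ((-1) ^ (m + p) * (\<sigma>1 * \<sigma>2 * ?P q))"
      unfolding term4_def sum_pairs_eq by simp
    then show ?thesis unfolding e .
  qed
  have "(\<Sum>k=0..q-1. \<psi> k * (\<Sum>i=0..q-1-k. A i * B (q - 1 - k - i)))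
     = (\<Sum>k=0..q-1. \<psi> k * (\<sigma>1 * \<sigma>2 * ?P (q - 1 - k)))"
    unfolding AB ..
  \<comment> \<open>Even k drop out because the regular part of the lattice kernel is odd; at k = 2j
    - 1 the factor (-1)^k - 1 = -2 gives the coefficient 2 of the fifth term.\<close>
  also have "\<dots> = (\<Sum>j=1..q div 2. \<psi> (2 * j - 1) * (\<sigma>1 * \<sigma>2 * ?P (q - 1 - (2 * j - 1))))"
    by (rule sum_odd_indices) (use pos in \<open>auto simp: \<psi>_def\<close>)
  also have "\<dots> = (\<Sum>j=1..q div 2. - 2 * \<sigma>1 * \<sigma>2 * (\<Sum>i=0..q-2*j. ?g i (q - 2 * j - i) * alt_zeta (2 * j) \<tau>))"
  proof (rule sum.cong[OF refl])
    fix j assume "j \<in> {1..q div 2}"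
    then have "odd (2 * j - 1)" "2 * j - 1 + 1 = 2 * j" "q - 1 - (2 * j - 1) = q - 2 * j" by auto
    then have "\<psi> (2 * j - 1) = - 2 * alt_zeta (2 * j) \<tau>" unfolding \<psi>_def by simp
    then show "\<psi> (2 * j - 1) * (\<sigma>1 * \<sigma>2 * ?P (q - 1 - (2 * j - 1)))
       = - 2 * \<sigma>1 * \<sigma>2 * (\<Sum>i=0..q-2*j. ?g i (q - 2 * j - i) * alt_zeta (2 * j) \<tau>)"
      unfolding \<open>q - 1 - (2 * j - 1) = q - 2 * j\<close> by (simp add: sum_distrib_right[symmetric])
  qed
  also have "\<dots> = - ((-1) ^ (m + p)) * term5 m p q \<sigma>1 \<sigma>2 \<sigma>3"
  proof -
    have "- ((-1) ^ (m + p)) * term5 m p q \<sigma>1 \<sigma>2 \<sigma>3 = (-1) ^ (m + p) * ((-1) ^ (m + p) * (- 2 * \<sigma>1 * \<sigma>2 *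
       (\<Sum>j=1..q div 2. \<Sum>i=0..q-2*j. ?g i (q - 2 * j - i) * alt_zeta (2 * j) \<tau>)))"
      unfolding term5_def Let_def sum_pairs_eq \<tau> by (simp add: mult_ac)
    then show ?thesis unfolding e by (simp only: sum_distrib_left)
  qed
  finally show ?thesis unfolding AB distrib_left 4 by simp
qed

lemma quadratic_euler_sum:
  "\<tau> * parity_delta (\<sigma>1 * \<sigma>2) (m + p + q - 1) * S_quad m p q \<sigma>1 \<sigma>2 \<sigma>3
     = term1 m p q \<sigma>1 \<sigma>2 \<sigma>3 + term2 m p q \<sigma>1 \<sigma>2 \<sigma>3 + term3 m p q \<sigma>1 \<sigma>2 \<sigma>3
       + term4 m p q \<sigma>1 \<sigma>2 + term5 m p q \<sigma>1 \<sigma>2 \<sigma>3"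
proof -
  let ?F = "euler_kernel m p q \<sigma>1 \<sigma>2 \<tau>" and ?e = "(-1) ^ (m + p) :: real"
  let ?L = "\<tau> * parity_delta (\<sigma>1 * \<sigma>2) (m + p + q - 1) * S_quad m p q \<sigma>1 \<sigma>2 \<sigma>3"
  let ?t = "term1 m p q \<sigma>1 \<sigma>2 \<sigma>3" and ?t23 = "term2 m p q \<sigma>1 \<sigma>2 \<sigma>3 + term3 m p q \<sigma>1 \<sigma>2 \<sigma>3"
    and ?t45 = "term4 m p q \<sigma>1 \<sigma>2 + term5 m p q \<sigma>1 \<sigma>2 \<sigma>3"
  \<comment> \<open>For q = 1 the third sign is -1, so \<tau> = - \<sigma>1 \<sigma>2 and the three
    signs cannot all be 1.\<close>
  have neg: "\<tau> = -1 \<or> \<sigma>1 = -1 \<or> \<sigma>2 = -1" if "q = 1"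
  proof -
    have "\<sigma>3 = -1" using that q\<sigma> signs(3) by (auto simp: abs_if split: if_splits)
    moreover have "\<sigma>1 = 1 \<or> \<sigma>1 = -1" "\<sigma>2 = 1 \<or> \<sigma>2 = -1" using signs by linarith+
    ultimately show ?thesis by (auto simp: \<tau>)
  qed
  have r0: "residue ?F 0 = of_real (- ?e * ?t45)"
    unfolding residue_euler_kernel_0[OF signs(1,2) abs_\<tau> pos] residue_0_eq ..
  have rn: "residue ?F (of_nat n) + residue ?F (- of_nat n) = of_real (pair_res n)" if "n \<ge> 1" for n
    unfolding residue_euler_kernel_pos[OF signs(1,2) abs_\<tau> pos that]
      residue_euler_kernel_neg[OF signs(1,2) abs_\<tau> pos that] of_real_add ..
  have rh: "residue ?F (of_nat b + 1/2) = of_real (half_res b)" for b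
    by (rule residue_euler_kernel_half[OF signs(1,2) abs_\<tau> pos])
  have "residue ?F 0 + (\<Sum>n=1..K^4. residue ?F (of_nat n) + residue ?F (- of_nat n)) + (\<Sum>k<K^4. residue ?F (of_nat k + 1/2))
     = of_real (- ?e * ?t45 + (\<Sum>n<K^4. pair_res (Suc n)) + (\<Sum>b<K^4. half_res b))" for K :: nat
  proof -
    have "(\<Sum>n=1..K^4. residue ?F (of_nat n) + residue ?F (- of_nat n)) = of_real (\<Sum>n=1..K^4. pair_res n)"
      unfolding of_real_sum by (intro sum.cong refl rn) auto
    also have "(\<Sum>n=1..K^4. pair_res n) = (\<Sum>n<K^4. pair_res (Suc n))"
      by (simp only: One_nat_def sum.atLeast1_atMost_eq)
    finally show ?thesis unfolding r0 rh of_real_add of_real_sum by simp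
  qed
  with residues_euler_kernel_tendsto[OF signs(1,2) abs_\<tau> pos neg]
  have "(\<lambda>K. complex_of_real (- ?e * ?t45 + (\<Sum>n<K^4. pair_res (Suc n)) + (\<Sum>b<K^4. half_res b))) \<longlonglongrightarrow> of_real 0"
    by (simp only: of_real_0)
  then have lim0: "(\<lambda>K. - ?e * ?t45 + (\<Sum>n<K^4. pair_res (Suc n)) + (\<Sum>b<K^4. half_res b)) \<longlonglongrightarrow> 0"
    by (simp only: tendsto_of_real_iff)
  \<comment> \<open>Both series converge by themselves, so their partial sums along fourth powers
    have the full sums as limits.\<close>
  have sub: "filterlim (\<lambda>K::nat. K ^ 4) sequentially sequentially"
    by (rule filterlim_subseq) (simp add: strict_mono_def power_strict_mono)
  have "(\<lambda>K. - ?e * ?t45 + (\<Sum>n<K^4. pair_res (Suc n)) + (\<Sum>b<K^4. half_res b)) \<longlonglongrightarrow>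
      - ?e * ?t45 + ?e * (?L - ?t) + - ?e * ?t23"
    by (intro tendsto_add tendsto_const filterlim_compose[OF _ sub] pair_res_sums[unfolded sums_def] half_res_sums[unfolded sums_def])
  from LIMSEQ_unique[OF this lim0] have "?e * (?L - ?t - ?t23 - ?t45) = 0" by (simp add: algebra_simps)
  then have "?L - ?t - ?t23 - ?t45 = 0" by simp
  then show ?thesis by simp
qed

end

theorem theorem4p6:
  fixes m p q :: nat and \<sigma>1 \<sigma>2 \<sigma>3 :: real
  assumes "m \<ge> 1" and "p \<ge> 1" and "q \<ge> 1"
    and "\<sigma>1 \<in> {1, -1}" and "\<sigma>2 \<in> {1, -1}" and "\<sigma>3 \<in> {1, -1}"
    and "(q, \<sigma>3) \<noteq> (1, 1)"
  shows "(\<sigma>1 * \<sigma>2 * \<sigma>3) * parity_delta (\<sigma>1 * \<sigma>2) (m + p + q - 1) * S_quad m p q \<sigma>1 \<sigma>2 \<sigma>3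
       = term1 m p q \<sigma>1 \<sigma>2 \<sigma>3 + term2 m p q \<sigma>1 \<sigma>2 \<sigma>3 + term3 m p q \<sigma>1 \<sigma>2 \<sigma>3
         + term4 m p q \<sigma>1 \<sigma>2 + term5 m p q \<sigma>1 \<sigma>2 \<sigma>3"
  by (rule quadratic_euler_sum[OF assms(1-3) _ _ _ assms(7) refl]) (use assms in auto)

end
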